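(* Let $(\mathcal{X},\rho,\mu)$ be a space of homogeneous type satisfying the weak reverse doubling (WRD) condition. Let $0<q\le p<\infty$ and let $Y(\mathcal{X})$ be a ball quasi-Banach function space such that $Y^{\frac1p}(\mathcal{X})$ is a ball Banach function space and the Hardy--Littlewood maximal operator $\mathcal{M}$ is bounded on $[Y^{\frac1p}(\mathcal{X})]'$. Then there exist two positive constants $C$ and $\widetilde{C}$ such that the following assertions hold. (i) Let $\beta\in(0,\infty)$. For any $f\in C^\beta_{\mathrm b}(\mathcal{X})\cap\bigcup_{s\in(0,1)}\dot{W}^{s,q}_Y(\mathcal{X})$, $$C\|f\|_{Y(\mathcal{X})}\le\liminf_{s\to0^+}s^{\frac1q}\left\|\left\{\int_{\mathcal{X}}\frac{|f(\cdot)-f(y)|^q}{U(\cdot,y)[\rho(\cdot,y)]^{sq}}\,d\mu(y)\right\}^{\frac1q}\right\|_{Y(\mathcal{X})}\le\limsup_{s\to0^+}s^{\frac1q}\left\|\left\{\int_{\mathcal{X}}\frac{|f(\cdot)-f(y)|^q}{U(\cdot,y)[\rho(\cdot,y)]^{sq}}\,d\mu(y)\right\}^{\frac1q}\right\|_{Y(\mathcal{X})}\le\widetilde{C}\|f\|_{Y(\mathcal{X})}.$$ (ii) If $Y(\mathcal{X})$ is further assumed to have an absolutely continuous quasi-norm, then, for any $f\in[Y(\mathcal{X})/\mathbb{R}]\cap\bigcup_{s\in(0,1)}\dot{W}^{s,q}_Y(\mathcal{X})$, $$C\|f\|_{Y(\mathcal{X})/\mathbb{R}}\le\liminf_{s\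to0^+}s^{\frac1q}\left\|\left\{\int_{\mathcal{X}}\frac{|f(\cdot)-f(y)|^q}{U(\cdot,y)[\rho(\cdot,y)]^{sq}}\,d\mu(y)\right\}^{\frac1q}\right\|_{Y(\mathcal{X})}\le\limsup_{s\to0^+}s^{\frac1q}\left\|\left\{\int_{\mathcal{X}}\frac{|f(\cdot)-f(y)|^q}{U(\cdot,y)[\rho(\cdot,y)]^{sq}}\,d\mu(y)\right\}^{\frac1q}\right\|_{Y(\mathcal{X})}\le\widetilde{C}\|f\|_{Y(\mathcal{X})/\mathbb{R}}.$$
   Context: A quasi-metric on a nonempty set $\mathcal{X}$ is $\rho:\mathcal{X}\times\mathcal{X}\to[0,\infty)$ with $\rho(x,y)=0$ iff $x=y$, $\rho(x,y)=\rho(y,x)$, and $\rho(x,z)\le K_0[\rho(x,y)+\rho(y,z)]$ for some constant $K_0\in[1,\infty)$. Balls: $B(x,r):=\{y:\rho(x,y)<r\}$. $(\mathcal{X},\rho,\mu)$ is a space of homogeneous type if $\rho$ is a quasi-metric, $\mu$ is a nonnegative measure on a $\sigma$-algebra containing all balls, and there is $L_{(\mu)}\in[1,\infty)$ with $0<\mu(B(x,2r))\le L_{(\mu)}\mu(B(x,r))<\infty$ for all $x\in\mathcal{X}$, $r\in(0,\infty)$. WRD condition: there exist $x_0\in\mathcal{X}$ and $\lambda,C_{(\mu)}\in(1,\infty)$ with $\liminf_{r\to\infty}\frac{\mu(B(x_0,\lambda r))}{\mu(B(x_0,r))}\ge C_{(\mu)}$. Put $U(x,y):=\min\{\mu(B(x,\rho(x,y))),\mu(B(y,\rho(x,y)))\}$.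 The integrand $|f(x)-f(y)|^q/(U(x,y)[\rho(x,y)]^{sq})$ is read as $0$ at $y=x$. $\mathscr{M}(\mathcal{X})$ is the set of $\mu$-measurable functions. A ball quasi-Banach function space $Y(\mathcal{X})$ is a quasi-Banach space of functions in $\mathscr{M}(\mathcal{X})$ whose quasi-norm makes sense (with values in $[0,\infty]$) for all $f\in\mathscr{M}(\mathcal{X})$, such that: (i) $\|f\|_{Y(\mathcal{X})}=0$ implies $f=0$ $\mu$-a.e.; (ii) $|g|\le|f|$ $\mu$-a.e. implies $\|g\|_{Y(\mathcal{X})}\le\|f\|_{Y(\mathcal{X})}$; (iii) $0\le f_m\uparrow f$ $\mu$-a.e. implies $\|f_m\|_{Y(\mathcal{X})}\uparrow\|f\|_{Y(\mathcal{X})}$; (iv) $\mathbf{1}_B\in Y(\mathcal{X})$ for every ball $B$. It is a ball Banach function space if moreover (v) the triangle inequality holds and (vi) for each ball $B$ there is $C_{(B)}\in(0,\infty)$ with $\int_B|f|\,d\mu\le C_{(B)}\|f\|_{Y(\mathcal{X})}$ for all $f\in Y(\mathcal{X})$. For $t\in(0,\infty)$, $Y^t(\mathcal{X}):=\{f\in\mathscr{M}(\mathcal{X}):|f|^t\in Y(\mathcal{X})\}$ with $\|f\|_{Y^t(\mathcal{X})}:=\||f|^t\|_{Y(\mathcal{X})}^{1/t}$. For a ball Banach function space $Z(\mathcal{X})$, the associate space is $[Z(\mathcal{X})]':=\{f\in\mathscr{M}(\mathcal{X}):\|f\|_{[Z(\mathcal{X})]'}:=\sup_{\|g\|_{Z(\mathcal{X})}\le1}\|fg\|_{L^1(\mathcal{X})}<\infty\}$.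 $\mathcal{M}f(x):=\sup_{B\ni x}\frac1{\mu(B)}\int_B|f|\,d\mu$, supremum over all balls containing $x$. $Y(\mathcal{X})$ has an absolutely continuous quasi-norm if $\|f\mathbf{1}_{E_j}\|_{Y(\mathcal{X})}\to0$ whenever $f\in Y(\mathcal{X})$ and $\{E_j\}$ are measurable sets with $\mathbf{1}_{E_j}\to0$ $\mu$-a.e. $C^\beta_{\mathrm b}(\mathcal{X})$: complex-valued functions $f$ on $\mathcal{X}$ with bounded support $\{f\ne0\}$ and $\sup_{x\ne y}|f(x)-f(y)|/[\rho(x,y)]^\beta<\infty$. $\dot W^{s,q}_Y(\mathcal{X})$: all $f\in\mathscr{M}(\mathcal{X})$ with $\big\|\{\int_{\mathcal{X}}\frac{|f(\cdot)-f(y)|^q}{U(\cdot,y)[\rho(\cdot,y)]^{sq}}d\mu(y)\}^{1/q}\big\|_{Y(\mathcal{X})}<\infty$. $Y(\mathcal{X})/\mathbb{R}$: (classes modulo additive real constants of) measurable $f$ with $\|f\|_{Y(\mathcal{X})/\mathbb{R}}:=\inf_{a\in\mathbb{R}}\|f+a\|_{Y(\mathcal{X})}<\infty$. $s\to0^+$ means $s\in(0,1)$, $s\to0$. *)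

theory Defs
  imports "HOL-Analysis.Analysis"
begin

text \<open>The underlying set is \<^term>\<open>space M\<close>; the function \<^term>\<open>rho\<close> is only constrained there.\<close>

definition quasi_metric_on :: "'a set \<Rightarrow> ('a \<Rightarrow> 'a \<Rightarrow> real) \<Rightarrow> bool" where
  "quasi_metric_on X rho \<longleftrightarrow>
     X \<noteq> {} \<and>
     (\<forall>x\<in>X. \<forall>y\<in>X. 0 \<le> rho x y \<and> (rho x y = 0 \<longleftrightarrow> x = y) \<and> rho x y = rho y x) \<and>
     (\<exists>K0\<ge>1. \<forall>x\<in>X. \<forall>y\<in>X. \<forall>z\<in>X. rho x z \<le> K0 * (rho x y + rho y z))"

definition qball :: "'a measure \<Rightarrow> ('a \<Rightarrow> 'a \<Rightarrow> real) \<Rightarrow> 'a \<Rightarrow> real \<Rightarrow> 'a set" where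
  "qball M rho x r = {y \<in> space M. rho x y < r}"

definition qballs :: "'a measure \<Rightarrow> ('a \<Rightarrow> 'a \<Rightarrow> real) \<Rightarrow> 'a set set" where
  "qballs M rho = {qball M rho x r | x r. x \<in> space M \<and> 0 < r}"

definition homogeneous_type :: "'a measure \<Rightarrow> ('a \<Rightarrow> 'a \<Rightarrow> real) \<Rightarrow> bool" where
  "homogeneous_type M rho \<longleftrightarrow>
     quasi_metric_on (space M) rho \<and>
     qballs M rho \<subseteq> sets M \<and>
     (\<exists>L::real. 1 \<le> L \<and> (\<forall>x\<in>space M. \<forall>r>0.
        0 < emeasure M (qball M rho x (2 * r)) \<and>
        emeasure M (qball M rho x (2 * r)) \<le> ennreal L * emeasure M (qball M rho x r) \<and>
        ennreal L * emeasure M (qball M rho x r) < \<infinity>))"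

definition weak_reverse_doubling :: "'a measure \<Rightarrow> ('a \<Rightarrow> 'a \<Rightarrow> real) \<Rightarrow> bool" where
  "weak_reverse_doubling M rho \<longleftrightarrow>
     (\<exists>x0\<in>space M. \<exists>l>1. \<exists>C>1::real.
        ennreal C \<le> Liminf at_top
          (\<lambda>r::real. emeasure M (qball M rho x0 (l * r)) / emeasure M (qball M rho x0 r)))"

definition qU :: "'a measure \<Rightarrow> ('a \<Rightarrow> 'a \<Rightarrow> real) \<Rightarrow> 'a \<Rightarrow> 'a \<Rightarrow> ennreal" where
  "qU M rho x y =
     min (emeasure M (qball M rho x (rho x y))) (emeasure M (qball M rho y (rho x y)))"

text \<open>
  A function space is given by its quasi-norm \<^term>\<open>N\<close>, which takes values in \<open>[0,\<infinity>]\<close> and is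
  meaningful on all complex-valued measurable functions; the space is the set of measurable
  functions of finite quasi-norm. Functions are not identified almost everywhere.
\<close>

definition fun_space :: "'a measure \<Rightarrow> (('a \<Rightarrow> complex) \<Rightarrow> ennreal) \<Rightarrow> ('a \<Rightarrow> complex) set" where
  "fun_space M N = {f \<in> borel_measurable M. N f < \<infinity>}"

definition quasi_Banach_fun_space :: "'a measure \<Rightarrow> (('a \<Rightarrow> complex) \<Rightarrow> ennreal) \<Rightarrow> bool" where
  "quasi_Banach_fun_space M N \<longleftrightarrow>
     (\<forall>f\<in>borel_measurable M. (AE x in M. f x = 0) \<longrightarrow> N f = 0) \<and>
     (\<forall>f\<in>borel_measurable M. N f = 0 \<longrightarrow> (AE x in M. f x = 0)) \<and>
     (\<forall>f\<in>fun_space M N. \<forall>c::complex. N (\<lambda>x. c * f x) = ennreal (cmod c) * N f) \<and>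
     (\<exists>K::real. 1 \<le> K \<and>
        (\<forall>f\<in>fun_space M N. \<forall>g\<in>fun_space M N. N (\<lambda>x. f x + g x) \<le> ennreal K * (N f + N g))) \<and>
     (\<forall>F::nat \<Rightarrow> 'a \<Rightarrow> complex.
        (\<forall>n. F n \<in> fun_space M N) \<longrightarrow>
        (\<forall>e>0. \<exists>n0. \<forall>m\<ge>n0. \<forall>n\<ge>n0. N (\<lambda>x. F m x - F n x) < e) \<longrightarrow>
        (\<exists>f\<in>fun_space M N. (\<lambda>n. N (\<lambda>x. F n x - f x)) \<longlonglongrightarrow> 0))"

definition ball_quasi_Banach ::
    "'a measure \<Rightarrow> ('a \<Rightarrow> 'a \<Rightarrow> real) \<Rightarrow> (('a \<Rightarrow> complex) \<Rightarrow> ennreal) \<Rightarrow> bool" where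
  "ball_quasi_Banach M rho N \<longleftrightarrow>
     quasi_Banach_fun_space M N \<and>
     (\<forall>f\<in>borel_measurable M. N f = 0 \<longrightarrow> (AE x in M. f x = 0)) \<and>
     (\<forall>f\<in>borel_measurable M. \<forall>g\<in>borel_measurable M.
        (AE x in M. cmod (g x) \<le> cmod (f x)) \<longrightarrow> N g \<le> N f) \<and>
     (\<forall>(F::nat \<Rightarrow> 'a \<Rightarrow> real) f.
        (\<forall>m. F m \<in> borel_measurable M) \<longrightarrow> f \<in> borel_measurable M \<longrightarrow>
        (AE x in M. 0 \<le> F 0 x \<and> incseq (\<lambda>m. F m x) \<and> (\<lambda>m. F m x) \<longlonglongrightarrow> f x) \<longrightarrow>
        incseq (\<lambda>m. N (\<lambda>x. complex_of_real (F m x))) \<and>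
        (\<lambda>m. N (\<lambda>x. complex_of_real (F m x))) \<longlonglongrightarrow> N (\<lambda>x. complex_of_real (f x))) \<and>
     (\<forall>B\<in>qballs M rho. indicator B \<in> fun_space M N)"

definition ball_Banach ::
    "'a measure \<Rightarrow> ('a \<Rightarrow> 'a \<Rightarrow> real) \<Rightarrow> (('a \<Rightarrow> complex) \<Rightarrow> ennreal) \<Rightarrow> bool" where
  "ball_Banach M rho N \<longleftrightarrow>
     ball_quasi_Banach M rho N \<and>
     (\<forall>f\<in>fun_space M N. \<forall>g\<in>fun_space M N. N (\<lambda>x. f x + g x) \<le> N f + N g) \<and>
     (\<forall>B\<in>qballs M rho. \<exists>C>0::real. \<forall>f\<in>fun_space M N.
        (\<integral>\<^sup>+x\<in>B. ennreal (cmod (f x)) \<partial>M) \<le> ennreal C * N f)"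

definition abs_continuous_norm :: "'a measure \<Rightarrow> (('a \<Rightarrow> complex) \<Rightarrow> ennreal) \<Rightarrow> bool" where
  "abs_continuous_norm M N \<longleftrightarrow>
     (\<forall>f\<in>fun_space M N. \<forall>E::nat \<Rightarrow> 'a set.
        (\<forall>j. E j \<in> sets M) \<longrightarrow>
        (AE x in M. (\<lambda>j. indicator (E j) x :: real) \<longlonglongrightarrow> 0) \<longrightarrow>
        (\<lambda>j. N (\<lambda>x. f x * indicator (E j) x)) \<longlonglongrightarrow> 0)"

text \<open>Only meant for \<^term>\<open>t > (0::real)\<close>; the domain is \<open>[0,\<infinity>]\<close>.\<close>

definition epowr :: "ennreal \<Rightarrow> real \<Rightarrow> ennreal" where
  "epowr a t = (if a = \<infinity> then \<infinity> else ennreal (enn2real a powr t))"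

definition power_norm :: "(('a \<Rightarrow> complex) \<Rightarrow> ennreal) \<Rightarrow> real \<Rightarrow> ('a \<Rightarrow> complex) \<Rightarrow> ennreal" where
  "power_norm N t f = epowr (N (\<lambda>x. complex_of_real (cmod (f x) powr t))) (1 / t)"

definition assoc_norm ::
    "'a measure \<Rightarrow> (('a \<Rightarrow> complex) \<Rightarrow> ennreal) \<Rightarrow> ('a \<Rightarrow> complex) \<Rightarrow> ennreal" where
  "assoc_norm M N f =
     (SUP g\<in>{g \<in> borel_measurable M. N g \<le> 1}. \<integral>\<^sup>+x. ennreal (cmod (f x * g x)) \<partial>M)"

text \<open>
  The quasi-norm of a \<open>[0,\<infinity>]\<close>-valued function \<^term>\<open>G\<close>, needed because maximal functions and
  Gagliardo-type integrals may be infinite. For measurable \<^term>\<open>G\<close> this is the usual value: it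
  is \<open>\<infinity>\<close> if \<open>G = \<infinity>\<close> on a set of positive measure (there is no admissible majorant), and
  otherwise it is \<^term>\<open>N G\<close> by the lattice property, as the lemma below confirms. The infimum
  over measurable majorants also gives a meaning to the quasi-norm in the degenerate case where
  \<^term>\<open>G\<close> fails to be measurable, which measurability of balls alone does not exclude.
\<close>

definition ext_norm ::
    "'a measure \<Rightarrow> (('a \<Rightarrow> complex) \<Rightarrow> ennreal) \<Rightarrow> ('a \<Rightarrow> ennreal) \<Rightarrow> ennreal" where
  "ext_norm M N G =
     (INF g\<in>{g \<in> borel_measurable M. AE x in M. G x \<le> ennreal (cmod (g x))}. N g)"

lemma ext_norm_eq:
  assumes N: "ball_quasi_Banach M rho N" and f: "f \<in> borel_measurable M"
    and G: "AE x in M. G x = ennreal (cmod (f x))"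
  shows "ext_norm M N G = N f"
  unfolding ext_norm_def
proof (rule antisym)
  show "(INF g\<in>{g \<in> borel_measurable M. AE x in M. G x \<le> ennreal (cmod (g x))}. N g) \<le> N f"
    using f G by (intro INF_lower) auto
next
  show "N f \<le> (INF g\<in>{g \<in> borel_measurable M. AE x in M. G x \<le> ennreal (cmod (g x))}. N g)"
  proof (rule INF_greatest)
    fix g assume "g \<in> {g \<in> borel_measurable M. AE x in M. G x \<le> ennreal (cmod (g x))}"
    then have g: "g \<in> borel_measurable M" and "AE x in M. G x \<le> ennreal (cmod (g x))" by auto
    with G have "AE x in M. cmod (f x) \<le> cmod (g x)"
      by (auto elim: AE_mp)
    with N f g show "N f \<le> N g" unfolding ball_quasi_Banach_def by blast
  qed
qed

definition maximal_fun ::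
    "'a measure \<Rightarrow> ('a \<Rightarrow> 'a \<Rightarrow> real) \<Rightarrow> ('a \<Rightarrow> complex) \<Rightarrow> 'a \<Rightarrow> ennreal" where
  "maximal_fun M rho f x =
     (SUP B\<in>{B \<in> qballs M rho. x \<in> B}. (\<integral>\<^sup>+z\<in>B. ennreal (cmod (f z)) \<partial>M) / emeasure M B)"

definition maximal_bounded ::
    "'a measure \<Rightarrow> ('a \<Rightarrow> 'a \<Rightarrow> real) \<Rightarrow> (('a \<Rightarrow> complex) \<Rightarrow> ennreal) \<Rightarrow> bool" where
  "maximal_bounded M rho N \<longleftrightarrow>
     (\<exists>C>0::real. \<forall>f\<in>fun_space M N. ext_norm M N (maximal_fun M rho f) \<le> ennreal C * N f)"

definition holder_bounded_support ::
    "'a measure \<Rightarrow> ('a \<Rightarrow> 'a \<Rightarrow> real) \<Rightarrow> real \<Rightarrow> ('a \<Rightarrow> complex) set" where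
  "holder_bounded_support M rho b =
     {f. (\<exists>B\<in>qballs M rho. {x \<in> space M. f x \<noteq> 0} \<subseteq> B) \<and>
         bdd_above {cmod (f x - f y) / rho x y powr b | x y. x \<in> space M \<and> y \<in> space M \<and> x \<noteq> y}}"

definition frac_integral ::
    "'a measure \<Rightarrow> ('a \<Rightarrow> 'a \<Rightarrow> real) \<Rightarrow> real \<Rightarrow> real \<Rightarrow> ('a \<Rightarrow> complex) \<Rightarrow> 'a \<Rightarrow> ennreal" where
  "frac_integral M rho q s f x =
     (\<integral>\<^sup>+y. (if y = x then 0
             else ennreal (cmod (f x - f y) powr q) /
                  (qU M rho x y * ennreal (rho x y powr (s * q)))) \<partial>M)"

definition frac_seminorm ::
    "'a measure \<Rightarrow> ('a \<Rightarrow> 'a \<Rightarrow> real) \<Rightarrow> (('a \<Rightarrow> complex) \<Rightarrow> ennreal) \<Rightarrow> real \<Rightarrow> real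
      \<Rightarrow> ('a \<Rightarrow> complex) \<Rightarrow> ennreal" where
  "frac_seminorm M rho N q s f = ext_norm M N (\<lambda>x. epowr (frac_integral M rho q s f x) (1 / q))"

definition frac_sobolev ::
    "'a measure \<Rightarrow> ('a \<Rightarrow> 'a \<Rightarrow> real) \<Rightarrow> (('a \<Rightarrow> complex) \<Rightarrow> ennreal) \<Rightarrow> real \<Rightarrow> real
      \<Rightarrow> ('a \<Rightarrow> complex) set" where
  "frac_sobolev M rho N q s = {f \<in> borel_measurable M. frac_seminorm M rho N q s f < \<infinity>}"

definition mod_const_norm :: "(('a \<Rightarrow> complex) \<Rightarrow> ennreal) \<Rightarrow> ('a \<Rightarrow> complex) \<Rightarrow> ennreal" where
  "mod_const_norm N f = (INF a::real. N (\<lambda>x. f x + complex_of_real a))"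

end

theory Submission
  imports Defs
begin

text \<open>
  As \<open>s\<close> tends to \<open>0\<close>, only pairs of points at distance at least \<open>1\<close> matter. On the pairs with
  \<open>rho x y < 1\<close> the weight \<open>(rho x y) powr (- s q)\<close> increases with \<open>s\<close>, so that this part of the
  integral is at most the integral at a level \<open>s0\<close> where the seminorm is finite, and the factor
  \<open>s powr (1/q)\<close> makes it disappear. At distance at least \<open>1\<close> the weight
  \<open>1 / (U(x,y) (rho x y) powr (s q))\<close> has total mass of order \<open>1/s\<close>: by doubling, the dyadic annulus
  of radius \<open>2^k\<close> contributes at most a multiple of \<open>2 powr (- k s q)\<close>, and the geometric series sums to
  a multiple of \<open>1/s\<close>. Hence \<open>s\<close> times the integral compares with \<open>\<bar>f x\<bar> powr q\<close>, up to a term in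
  which \<open>\<bar>f y\<bar> powr q\<close> is averaged against the weight.

  The weight need not be measurable in \<open>y\<close>, let alone jointly, hence it is replaced by a kernel
  \<open>far_ker\<close> which dominates it up to a constant: a countable sum, over scales \<open>2^k\<close> and over the points of a
  maximal \<open>2^k\<close>-separated net, of products of indicators of balls divided by their measure. It is
  jointly measurable and symmetric, and since the balls of one scale overlap boundedly, \<open>s\<close> times
  the operator with this kernel is dominated pointwise by the maximal operator
  (\<open>far_op_maximal\<close>). Let \<open>Z\<close> be the space with norm \<open>power_norm N (1/p)\<close>. By symmetry the operator is
  tested against the associate space of \<open>Z\<close>, on which the maximal operator is bounded; so it is bounded
  on \<open>Z\<close>, uniformly in \<open>s\<close> (\<open>far_op_bounded\<close>). An inequality of Jensen type
  passes from the exponent \<open>p\<close> to \<open>q\<close> (\<open>far_op_power_bounded\<close>). This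
  bounds the averaged term and gives the upper estimate.

  The passage back from the associate space recovers the norm of \<open>Z\<close> from the associate norm, which is the
  theorem of Lorentz and Luxemburg. The inequality that is used (\<open>ext_norm_le_by_duality\<close>) follows
  from an elementary separation argument: if a bounded function \<open>u\<close> lies outside a ball of \<open>Z\<close>, the
  residual of its best \<open>L\<^sup>2\<close> approximation from that ball is a functional separating \<open>u\<close> from it.

  For the lower estimate, weak reverse doubling says that the large annuli around \<open>x0\<close> with ratio \<open>l\<close> fill a
  fixed proportion of the balls they bound. So the part of the weight outside a large ball around
  \<open>x0\<close> still has mass at least \<open>c/s\<close>, with \<open>c\<close> independent of the ball (\<open>annular_kernel\<close>). If \<open>x\<close> is close
  to \<open>x0\<close> and \<open>y\<close> ranges over these annuli, \<open>f y\<close> is a value of the tail of \<open>f\<close>, that is, of \<open>f\<close> cut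
  off to the outside of a ball around \<open>x0\<close>, and its contribution is the averaged term for the tail.
  This bounds the norm of \<open>f\<close> by the lower limit of the seminorms plus the norm of the tail
  (\<open>norm_le_Liminf_frac_seminorm\<close>). The tails vanish eventually if the support is bounded, and their norms
  tend to \<open>0\<close> if the quasi-norm is absolutely continuous. Modulo constants, all of
  this is applied to \<open>f + a\<close>, which has the same seminorms as \<open>f\<close>.
\<close>

section \<open>Powers and quasi-norms of functions with values in \<open>[0,\<infinity>]\<close>\<close>

lemma epowr_ennreal [simp]: "0 \<le> a \<Longrightarrow> epowr (ennreal a) t = ennreal (a powr t)"
  by (simp add: epowr_def)

lemma epowr_top [simp]: "epowr top t = top"
  by (simp add: epowr_def)

lemma epowr_0 [simp]: "epowr 0 t = 0"
  by (simp add: epowr_def)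

lemma epowr_mono: "0 \<le> t \<Longrightarrow> a \<le> b \<Longrightarrow> epowr a t \<le> epowr b t"
  by (cases a; cases b) (auto intro!: ennreal_leI powr_mono2 simp: top_unique)

lemma epowr_epowr: "epowr (epowr a t) u = epowr a (t * u)"
  by (cases a) (auto simp: powr_powr)

lemma epowr_one [simp]: "epowr a 1 = a"
  by (cases a) auto

lemma epowr_mult: "epowr (a * b) t = epowr a t * epowr b t"
proof (cases a; cases b)
  fix r s assume "0 \<le> r" "a = ennreal r" "0 \<le> s" "b = ennreal s"
  then show ?thesis by (simp add: ennreal_mult[symmetric] powr_mult)
qed (auto simp: ennreal_mult_top ennreal_top_mult)

lemma epowr_add_le:
  assumes "0 \<le> t"
  shows "epowr (a + b) t \<le> ennreal (2 powr t) * (epowr a t + epowr b t)"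
proof -
  have le: "epowr (a + b) t \<le> epowr (2 * max a b) t"
    by (intro epowr_mono assms) (metis add_mono max.cobounded1 max.cobounded2 mult_2)
  also have "\<dots> = ennreal (2 powr t) * epowr (max a b) t"
    by (simp add: epowr_mult flip: ennreal_numeral)
  also have "epowr (max a b) t \<le> epowr a t + epowr b t"
    by (cases "a \<le> b") (auto simp: max_def)
  finally show ?thesis by (auto simp: mult_left_mono)
qed

lemma epowr_measurable [measurable]:
  assumes [measurable]: "u \<in> borel_measurable M"
  shows "(\<lambda>x. epowr (u x) t) \<in> borel_measurable M"
  unfolding epowr_def by measurable

lemma le_ennreal_mult_iff:
  fixes x y :: ennreal
  assumes "0 < c"
  shows "x \<le> ennreal c * y \<longleftrightarrow> ennreal (1/c) * x \<le> y"
proof -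
  have eq: "ennreal (1/c) * (ennreal c * z) = z" "ennreal c * (ennreal (1/c) * z) = z" for z
    using assms by (simp_all add: mult.assoc[symmetric] ennreal_mult[symmetric])
  show ?thesis
    using mult_left_mono[of x "ennreal c * y" "ennreal (1/c)"]
      mult_left_mono[of "ennreal (1/c) * x" y "ennreal c"] by (auto simp: eq)
qed

lemma le_ennreal_mult_INF:
  fixes x :: ennreal
  assumes "0 < c" and "\<And>g. g \<in> A \<Longrightarrow> x \<le> ennreal c * F g"
  shows "x \<le> ennreal c * (INF g\<in>A. F g)"
  using assms by (auto simp: le_ennreal_mult_iff intro!: INF_greatest)

lemma le_INF_add:
  fixes x c :: ennreal
  assumes "\<And>g. g \<in> A \<Longrightarrow> x \<le> F g + c"
  shows "x \<le> (INF g\<in>A. F g) + c"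
proof (cases "c = top")
  case False
  have "x - c \<le> (INF g\<in>A. F g)"
    using assms False by (intro INF_greatest) (auto simp: ennreal_minus_le_iff add.commute)
  then show ?thesis using False by (auto simp: ennreal_minus_le_iff add.commute)
qed auto

lemma ext_norm_mono:
  assumes "AE x in M. G x \<le> H x"
  shows "ext_norm M N G \<le> ext_norm M N H"
  unfolding ext_norm_def
  by (rule INF_superset_mono) (use assms in \<open>auto elim!: AE_mp intro: order.trans\<close>)

lemma ext_norm_le:
  assumes "g \<in> borel_measurable M" "AE x in M. G x \<le> ennreal (cmod (g x))"
  shows "ext_norm M N G \<le> N g"
  unfolding ext_norm_def using assms by (intro INF_lower) auto

lemma ball_quasi_Banach_mono:
  assumes "ball_quasi_Banach M rho N" "f \<in> borel_measurable M" "g \<in> borel_measurable M"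
    and "AE x in M. cmod (g x) \<le> cmod (f x)"
  shows "N g \<le> N f"
  using assms unfolding ball_quasi_Banach_def by blast

lemma ball_quasi_Banach_cong:
  assumes "ball_quasi_Banach M rho N" "f \<in> borel_measurable M" "g \<in> borel_measurable M"
    and "AE x in M. cmod (g x) = cmod (f x)"
  shows "N g = N f"
  by (rule antisym; rule ball_quasi_Banach_mono[OF assms(1)]) (use assms in auto)

lemma ball_quasi_Banach_eq_0_iff:
  assumes "ball_quasi_Banach M rho N" "f \<in> borel_measurable M"
  shows "N f = 0 \<longleftrightarrow> (AE x in M. f x = 0)"
  using assms unfolding ball_quasi_Banach_def quasi_Banach_fun_space_def by blast

lemma ball_quasi_Banach_scale:
  assumes N: "ball_quasi_Banach M rho N" and f: "f \<in> borel_measurable M" and "0 < c"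
  shows "N (\<lambda>x. complex_of_real c * f x) = ennreal c * N f"
proof -
  have homog: "N (\<lambda>x. d * g x) = ennreal (cmod d) * N g" if "g \<in> fun_space M N" for g d
    using N that unfolding ball_quasi_Banach_def quasi_Banach_fun_space_def by auto
  show ?thesis
  proof (cases "N f < \<infinity>")
    case True
    then have "f \<in> fun_space M N" using f by (simp add: fun_space_def)
    then show ?thesis
      using homog \<open>0 < c\<close> by simp
  next
    case False
    have "N (\<lambda>x. complex_of_real c * f x) = \<infinity>"
    proof (rule ccontr)
      assume "N (\<lambda>x. complex_of_real c * f x) \<noteq> \<infinity>"
      then have "(\<lambda>x. complex_of_real c * f x) \<in> fun_space M N"
        using f by (simp add: fun_space_def top.not_eq_extremum)
      then have "N (\<lambda>x. complex_of_real (1/c) * (complex_of_real c * f x)) =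
          ennreal (cmod (complex_of_real (1/c))) * N (\<lambda>x. complex_of_real c * f x)"
        by (rule homog)
      moreover have "(\<lambda>x. complex_of_real (1/c) * (complex_of_real c * f x)) = f"
        using \<open>0 < c\<close> by auto
      ultimately show False
        using False \<open>N (\<lambda>x. complex_of_real c * f x) \<noteq> \<infinity>\<close>
        by (simp add: ennreal_mult_less_top top.not_eq_extremum)
    qed
    with False \<open>0 < c\<close> show ?thesis by (simp add: ennreal_mult_top not_less top_unique)
  qed
qed

lemma ext_norm_scale:
  assumes N: "ball_quasi_Banach M rho N" and "0 < c"
  shows "ext_norm M N (\<lambda>x. ennreal c * G x) \<le> ennreal c * ext_norm M N G"
proof -
  have "ext_norm M N (\<lambda>x. ennreal c * G x) \<le> ennreal c * N g"
    if g: "g \<in> borel_measurable M" "AE x in M. G x \<le> ennreal (cmod (g x))" for g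
  proof -
    have "ext_norm M N (\<lambda>x. ennreal c * G x) \<le> N (\<lambda>x. complex_of_real c * g x)"
    proof (rule ext_norm_le)
      show "AE x in M. ennreal c * G x \<le> ennreal (cmod (complex_of_real c * g x))"
        using g(2) \<open>0 < c\<close> by (auto elim!: AE_mp simp: norm_mult ennreal_mult intro!: mult_left_mono)
    qed (use g in measurable)
    then show ?thesis using ball_quasi_Banach_scale[OF N g(1) \<open>0 < c\<close>] by simp
  qed
  then show ?thesis
    unfolding ext_norm_def[of M N G] by (intro le_ennreal_mult_INF \<open>0 < c\<close>) auto
qed

text \<open>
  Two measurable majorants \<open>g\<close> and \<open>h\<close> of finite quasi-norm give the majorant \<open>cmod g + cmod h\<close> of the
  sum; the moduli are added because \<open>g + h\<close> itself may be small by cancellation.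
\<close>

lemma ext_norm_triangle:
  assumes N: "ball_quasi_Banach M rho N"
  obtains K where "1 \<le> K"
    "\<And>G H. ext_norm M N (\<lambda>x. G x + H x) \<le> ennreal K * (ext_norm M N G + ext_norm M N H)"
proof -
  obtain K where K: "1 \<le> K" and
    tri: "\<And>f g. f \<in> fun_space M N \<Longrightarrow> g \<in> fun_space M N \<Longrightarrow>
       N (\<lambda>x. f x + g x) \<le> ennreal K * (N f + N g)"
    using N unfolding ball_quasi_Banach_def quasi_Banach_fun_space_def by metis
  have "ext_norm M N (\<lambda>x. G x + H x) \<le> ennreal K * (ext_norm M N G + ext_norm M N H)" for G H
  proof -
    have *: "ext_norm M N (\<lambda>x. G x + H x) \<le> ennreal K * (N g + N h)"
      if g: "g \<in> borel_measurable M" "AE x in M. G x \<le> ennreal (cmod (g x))"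
       and h: "h \<in> borel_measurable M" "AE x in M. H x \<le> ennreal (cmod (h x))" for g h
    proof (cases "N g < \<infinity> \<and> N h < \<infinity>")
      case True
      let ?g = "\<lambda>x. complex_of_real (cmod (g x))" and ?h = "\<lambda>x. complex_of_real (cmod (h x))"
      note [measurable] = g(1) h(1)
      have eq: "N ?g = N g" "N ?h = N h"
        by (rule ball_quasi_Banach_cong[OF N]; simp)+
      have "ext_norm M N (\<lambda>x. G x + H x) \<le> N (\<lambda>x. ?g x + ?h x)"
      proof (rule ext_norm_le)
        show "AE x in M. G x + H x \<le> ennreal (cmod (?g x + ?h x))"
          using g(2) h(2)
        proof eventually_elim
          case (elim x)
          have "cmod (?g x + ?h x) = cmod (g x) + cmod (h x)"
            by (metis abs_norm_cancel norm_of_real norm_add_rule_thm of_real_add abs_of_nonneg add_nonneg_nonneg norm_ge_zero)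
          with elim show ?case by (simp add: ennreal_plus add_mono)
        qed
      qed simp
      also have "\<dots> \<le> ennreal K * (N ?g + N ?h)"
        using True eq by (intro tri) (auto simp: fun_space_def)
      finally show ?thesis using eq by simp
    next
      case False
      then have "N g + N h = top" by (auto simp: top_unique not_less)
      then show ?thesis using K by (simp only: ennreal_mult_top) (simp add: ennreal_mult_top)
    qed
    have div: "x \<le> ennreal K * y \<longleftrightarrow> ennreal (1/K) * x \<le> y" for x y
      using K by (simp add: le_ennreal_mult_iff)
    show ?thesis
      unfolding div ext_norm_def[of M N G]
    proof (rule le_INF_add)
      fix g assume g: "g \<in> {g \<in> borel_measurable M. AE x in M. G x \<le> ennreal (cmod (g x))}"
      have "ennreal (1/K) * ext_norm M N (\<lambda>x. G x + H x) \<le> ext_norm M N H + N g"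
        unfolding ext_norm_def[of M N H]
      proof (rule le_INF_add)
        fix h assume "h \<in> {g \<in> borel_measurable M. AE x in M. H x \<le> ennreal (cmod (g x))}"
        then show "ennreal (1/K) * ext_norm M N (\<lambda>x. G x + H x) \<le> N h + N g"
          using *[of g h] g by (simp add: div add.commute)
      qed
      then show "ennreal (1/K) * ext_norm M N (\<lambda>x. G x + H x) \<le> N g + ext_norm M N H"
        by (simp add: add.commute)
    qed
  qed
  with K that show thesis by blast
qed

section \<open>Best approximation and the theorem of Lorentz and Luxemburg\<close>

lemma integrable_bounded_finite_support:
  fixes g :: "'a \<Rightarrow> real"
  assumes "g \<in> borel_measurable M" "B \<in> sets M" "emeasure M B < \<infinity>"
    and "\<And>x. \<bar>g x\<bar> \<le> m * indicator B x"
  shows "integrable M g"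
proof (rule Bochner_Integration.integrable_bound)
  show "integrable M (\<lambda>x. m * indicator B x)"
    using assms(2,3) by (intro integrable_mult_right integrable_real_indicator) auto
  show "AE x in M. norm (g x) \<le> norm (m * indicator B x)"
    using assms(4) by (intro AE_I2) (metis abs_ge_self order.trans real_norm_def)
qed (fact assms(1))

text \<open>
  Existence of a point of best approximation to \<open>u\<close> in a midpoint convex set \<open>S\<close> of functions between
  \<open>0\<close> and \<open>u\<close>. By the parallelogram law a minimizing sequence is Cauchy in \<open>L\<^sup>2\<close>, hence in \<open>L\<^sup>1\<close>
  because everything lives on the set \<open>B\<close> of finite measure, and a subsequence converges almost
  everywhere. So the minimizer is an almost everywhere limit of members of \<open>S\<close>; the norm balls to
  which this is applied contain such limits by the Fatou property.
\<close>

lemma L2_minimizer: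
  fixes u :: "'a \<Rightarrow> real" and S :: "('a \<Rightarrow> real) set"
  assumes B: "B \<in> sets M" "emeasure M B < \<infinity>"
    and u: "u \<in> borel_measurable M" "\<And>x. 0 \<le> u x" "\<And>x. u x \<le> m * indicator B x"
    and S: "\<And>v. v \<in> S \<Longrightarrow> v \<in> borel_measurable M" "\<And>v x. v \<in> S \<Longrightarrow> 0 \<le> v x"
      "\<And>v x. v \<in> S \<Longrightarrow> v x \<le> u x"
    and "S \<noteq> {}"
    and mid: "\<And>v w. v \<in> S \<Longrightarrow> w \<in> S \<Longrightarrow> (\<lambda>x. (v x + w x) / 2) \<in> S"
  obtains v V where "v \<in> borel_measurable M" "\<And>x. 0 \<le> v x" "\<And>x. v x \<le> u x"
    "\<And>n::nat. V n \<in> S" "AE x in M. (\<lambda>n. V n x) \<longlonglongrightarrow> v x"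
    "\<And>w. w \<in> S \<Longrightarrow> (\<integral>x. (u x - v x)\<^sup>2 \<partial>M) \<le> (\<integral>x. (u x - w x)\<^sup>2 \<partial>M)"
proof -
  note [measurable] = u(1) S(1) B(1)
  have bnd: "\<bar>a - b\<bar> \<le> u x" if "0 \<le> a" "a \<le> u x" "0 \<le> b" "b \<le> u x" for a b x
    using that by linarith
  have sq: "(a - b)\<^sup>2 \<le> m\<^sup>2 * indicator B x" if "0 \<le> a" "a \<le> u x" "0 \<le> b" "b \<le> u x" for a b x
  proof -
    have "\<bar>a - b\<bar> \<le> m * indicator B x" using bnd[OF that] u(3)[of x] by linarith
    then have "\<bar>a - b\<bar>\<^sup>2 \<le> (m * indicator B x)\<^sup>2" by (intro power_mono) auto
    then show ?thesis by (auto simp: power_mult_distrib indicator_def split: if_splits)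
  qed
  have int2: "integrable M (\<lambda>x. (f x - g x)\<^sup>2)"
    if "f \<in> borel_measurable M" "g \<in> borel_measurable M"
      "\<And>x. 0 \<le> f x" "\<And>x. f x \<le> u x" "\<And>x. 0 \<le> g x" "\<And>x. g x \<le> u x" for f g
    using that by (intro integrable_bounded_finite_support[OF _ B, of _ "m\<^sup>2"]) (auto intro: sq)
  define J where "J w = (\<integral>x. (u x - w x)\<^sup>2 \<partial>M)" for w
  define d where "d = (INF w\<in>S. J w)"
  have bdd: "bdd_below (J ` S)"
    by (intro bdd_belowI[of _ 0]) (auto simp: J_def)
  have d_le: "d \<le> J w" if "w \<in> S" for w
    unfolding d_def using bdd that by (rule cINF_lower)
  have "\<exists>v\<in>S. J v < d + 1 / Suc n" for n
  proof -
    have "Inf (J ` S) < d + 1 / Suc n" by (simp add: d_def)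
    then show ?thesis using \<open>S \<noteq> {}\<close> bdd by (subst (asm) cInf_less_iff) auto
  qed
  then obtain V where V: "\<And>n. V n \<in> S" "\<And>n. J (V n) < d + 1 / Suc n" by metis
  note [measurable] = S(1)[OF V(1)]
  have diff: "(\<integral>x. (V i x - V j x)\<^sup>2 \<partial>M) \<le> 2 / Suc i + 2 / Suc j" for i j
  proof -
    let ?w = "\<lambda>x. (V i x + V j x) / 2"
    have "(\<integral>x. (V i x - V j x)\<^sup>2 \<partial>M) =
        (\<integral>x. 2 * (u x - V i x)\<^sup>2 + 2 * (u x - V j x)\<^sup>2 - 4 * (u x - ?w x)\<^sup>2 \<partial>M)"
      by (intro Bochner_Integration.integral_cong) (auto simp: power2_eq_square field_simps)
    also have "\<dots> = 2 * J (V i) + 2 * J (V j) - 4 * J ?w"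
    proof -
      have [simp]: "integrable M (\<lambda>x. (u x - w x)\<^sup>2)" if "w \<in> S" for w
        by (rule int2) (use that S u in auto)
      show ?thesis unfolding J_def
        by (subst Bochner_Integration.integral_diff Bochner_Integration.integral_add;
            (intro Bochner_Integration.integrable_add integrable_mult_right)?; simp add: V mid)+
    qed
    also have "\<dots> \<le> 2 / Suc i + 2 / Suc j"
      using V(2)[of i] V(2)[of j] d_le[OF mid[OF V(1)[of i] V(1)[of j]]] by simp
    finally show ?thesis .
  qed
  obtain r where r: "strict_mono r" "AE x in M. Cauchy (\<lambda>i. V (r i) x)"
  proof (rule cauchy_L1_AE_cauchy_subseq)
    show "integrable M (V n)" for n
      by (intro integrable_bounded_finite_support[OF _ B, of _ m])
         (use S V u(3) in \<open>auto simp: abs_of_nonneg intro: order.trans[OF S(3)]\<close>)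
    fix e :: real assume "0 < e"
    \<comment> \<open>from \<open>L\<^sup>2\<close> to \<open>L\<^sup>1\<close> by \<open>\<bar>a\<bar> \<le> \<delta> + a\<^sup>2 / \<delta>\<close>, with the first summand integrated over \<open>B\<close> only\<close>
    define \<delta> where "\<delta> = e / (2 * (measure M B + 1))"
    have "0 < \<delta>" unfolding \<delta>_def using \<open>0 < e\<close> by (simp add: add_nonneg_pos)
    obtain n0 :: nat where n0: "8 / (\<delta> * e) < n0" using reals_Archimedean2 by blast
    have "(\<integral>x. norm (V i x - V j x) \<partial>M) < e" if ij: "n0 \<le> i" "n0 \<le> j" for i j
    proof -
      have "(\<integral>x. norm (V i x - V j x) \<partial>M) \<le> (\<integral>x. \<delta> * indicator B x + (1/\<delta>) * (V i x - V j x)\<^sup>2 \<partial>M)"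
      proof (rule integral_mono)
        have b: "\<bar>V i x - V j x\<bar> \<le> m * indicator B x" for x
          using bnd[of "V i x" x "V j x"] S V u(3)[of x] by (meson order.trans)
        show "integrable M (\<lambda>x. norm (V i x - V j x))"
          using b by (intro integrable_bounded_finite_support[OF _ B, of _ m]) auto
        show "integrable M (\<lambda>x. \<delta> * indicator B x + (1/\<delta>) * (V i x - V j x)\<^sup>2)"
          using B by (intro Bochner_Integration.integrable_add integrable_mult_right int2
              integrable_real_indicator) (use S V in auto)
        fix x
        let ?a = "V i x - V j x"
        show "norm ?a \<le> \<delta> * indicator B x + (1/\<delta>) * ?a\<^sup>2"
        proof (cases "x \<in> B")
          case True
          show ?thesis
          proof (cases "\<bar>?a\<bar> \<le> \<delta>")
            case False
            then have "\<bar>?a\<bar> * \<delta> \<le> \<bar>?a\<bar> * \<bar>?a\<bar>" by (intro mult_left_mono) auto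
            then have "\<bar>?a\<bar> \<le> (1/\<delta>) * ?a\<^sup>2"
              using \<open>0 < \<delta>\<close> by (simp add: field_simps power2_eq_square)
            then show ?thesis using \<open>0 < \<delta>\<close> True by simp
          qed (use True \<open>0 < \<delta>\<close> in \<open>auto intro: add_increasing2\<close>)
        qed (use b[of x] \<open>0 < \<delta>\<close> in auto)
      qed
      also have "\<dots> = \<delta> * measure M B + (1/\<delta>) * (\<integral>x. (V i x - V j x)\<^sup>2 \<partial>M)"
      proof -
        have "integrable M (\<lambda>x. (V i x - V j x)\<^sup>2)" by (rule int2) (use S V in auto)
        moreover have "integrable M (\<lambda>x. \<delta> * indicator B x)"
          using B by (intro integrable_mult_right integrable_real_indicator)
        ultimately show ?thesis
          using B by (simp add: sets.Int_space_eq2)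
      qed
      also have "\<dots> < e / 2 + e / 2"
      proof (rule add_le_less_mono)
        show "\<delta> * measure M B \<le> e / 2"
          using \<open>0 < e\<close> measure_nonneg[of M B] unfolding \<delta>_def
          by (simp add: divide_le_eq mult_left_mono add_nonneg_pos)
        have "(\<integral>x. (V i x - V j x)\<^sup>2 \<partial>M) \<le> 2 / Suc n0 + 2 / Suc n0"
          using ij by (intro order.trans[OF diff] add_mono divide_left_mono) auto
        also have "\<dots> < \<delta> * (e / 2)"
        proof -
          have "8 < real (Suc n0) * (\<delta> * e)"
            using n0 \<open>0 < e\<close> \<open>0 < \<delta>\<close> by (simp add: divide_less_eq algebra_simps add_pos_pos add_strict_increasing)
          then have "8 / real (Suc n0) < \<delta> * e" by (simp add: divide_less_eq mult.commute)
          then show ?thesis by simp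
        qed
        finally show "(1/\<delta>) * (\<integral>x. (V i x - V j x)\<^sup>2 \<partial>M) < e / 2"
          using \<open>0 < \<delta>\<close> by (simp add: field_simps)
      qed
      finally show ?thesis by simp
    qed
    then show "\<exists>n. \<forall>i\<ge>n. \<forall>j\<ge>n. (\<integral>x. norm (V i x - V j x) \<partial>M) < e" by blast
  qed
  define v where "v x = max 0 (min (u x) (lim (\<lambda>i. V (r i) x)))" for x
  have [measurable]: "v \<in> borel_measurable M" unfolding v_def by measurable
  have v: "0 \<le> v x" "v x \<le> u x" for x using u(2)[of x] by (auto simp: v_def)
  have conv: "AE x in M. (\<lambda>i. V (r i) x) \<longlonglongrightarrow> v x"
    using r(2)
  proof eventually_elim
    case (elim x)
    then obtain l where l: "(\<lambda>i. V (r i) x) \<longlonglongrightarrow> l" by (auto simp: Cauchy_convergent_iff convergent_def)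
    have "0 \<le> l" "l \<le> u x"
      using S V by (auto intro: LIMSEQ_le_const[OF l] LIMSEQ_le_const2[OF l])
    with l show ?case by (simp add: v_def limI)
  qed
  have "J v \<le> d"
  proof (rule LIMSEQ_le)
    show "(\<lambda>i. J (V (r i))) \<longlonglongrightarrow> J v"
      unfolding J_def
    proof (rule integral_dominated_convergence)
      show "integrable M (\<lambda>x. m\<^sup>2 * indicator B x)"
        using B by (intro integrable_mult_right integrable_real_indicator)
      show "AE x in M. (\<lambda>i. (u x - V (r i) x)\<^sup>2) \<longlonglongrightarrow> (u x - v x)\<^sup>2"
        using conv by eventually_elim (intro tendsto_intros)
      show "AE x in M. norm ((u x - V (r i) x)\<^sup>2) \<le> m\<^sup>2 * indicator B x" for i
        using S V u by (auto intro!: sq)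
    qed measurable
    show "(\<lambda>i. d + 1 / Suc i) \<longlonglongrightarrow> d"
      using tendsto_add[OF tendsto_const[of d] LIMSEQ_inverse_real_of_nat] by (simp add: inverse_eq_divide)
    have "J (V (r i)) \<le> d + 1 / Suc i" for i
    proof -
      have "i \<le> r i" using r(1) by (rule seq_suble)
      then have "d + 1 / Suc (r i) \<le> d + 1 / Suc i" by (intro add_left_mono divide_left_mono) auto
      then show ?thesis using V(2)[of "r i"] by linarith
    qed
    then show "\<exists>N. \<forall>n\<ge>N. J (V (r n)) \<le> d + 1 / Suc n" by blast
  qed
  then have "J v \<le> J w" if "w \<in> S" for w using d_le[OF that] by linarith
  then show thesis
    using that[of v "\<lambda>i. V (r i)"] v conv V(1) by (auto simp: J_def)
qed

lemma ball_quasi_Banach_mono_conv: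
  fixes F :: "nat \<Rightarrow> 'a \<Rightarrow> real"
  assumes "ball_quasi_Banach M rho N" "\<And>m. F m \<in> borel_measurable M" "f \<in> borel_measurable M"
    and "AE x in M. 0 \<le> F 0 x \<and> incseq (\<lambda>m. F m x) \<and> (\<lambda>m. F m x) \<longlonglongrightarrow> f x"
  shows "(\<lambda>m. N (\<lambda>x. complex_of_real (F m x))) \<longlonglongrightarrow> N (\<lambda>x. complex_of_real (f x))"
  using assms unfolding ball_quasi_Banach_def by blast

text \<open>
  The infima of the tails of the sequence increase to the limit, so that the monotone
  convergence property of the quasi-norm applies to them.
\<close>

lemma ball_quasi_Banach_Fatou:
  fixes V :: "nat \<Rightarrow> 'a \<Rightarrow> real"
  assumes N: "ball_quasi_Banach M rho N"
    and V: "\<And>n. V n \<in> borel_measurable M" "\<And>n x. 0 \<le> V n x"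
    and v: "v \<in> borel_measurable M" "AE x in M. (\<lambda>n. V n x) \<longlonglongrightarrow> v x"
    and le: "\<And>n. N (\<lambda>x. complex_of_real (V n x)) \<le> c"
  shows "N (\<lambda>x. complex_of_real (v x)) \<le> c"
proof -
  note [measurable] = V(1) v(1)
  define F where "F k x = (INF j\<in>{k..}. V j x)" for k x
  have bdd: "bdd_below ((\<lambda>j. V j x) ` A)" for A x
    using V(2) by (intro bdd_belowI[of _ 0]) auto
  have [measurable]: "F k \<in> borel_measurable M" for k
    unfolding F_def using bdd by (intro borel_measurable_cINF) auto
  have F_le: "F k x \<le> V j x" if "k \<le> j" for k j x
    unfolding F_def using bdd that by (intro cINF_lower) auto
  have F_ge: "a \<le> F k x" if "\<And>j. k \<le> j \<Longrightarrow> a \<le> V j x" for a k x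
    unfolding F_def using that by (intro cINF_greatest) auto
  have "(\<lambda>m. N (\<lambda>x. complex_of_real (F m x))) \<longlonglongrightarrow> N (\<lambda>x. complex_of_real (v x))"
  proof (rule ball_quasi_Banach_mono_conv[OF N])
    show "AE x in M. 0 \<le> F 0 x \<and> incseq (\<lambda>m. F m x) \<and> (\<lambda>m. F m x) \<longlonglongrightarrow> v x"
      using v(2)
    proof eventually_elim
      case (elim x)
      have "(\<lambda>m. F m x) \<longlonglongrightarrow> v x"
      proof (rule LIMSEQ_I)
        fix e :: real assume "0 < e"
        then obtain n0 where n0: "\<And>n. n \<ge> n0 \<Longrightarrow> norm (V n x - v x) < e / 2"
          using LIMSEQ_D[OF elim, of "e / 2"] by auto
        have "norm (F n x - v x) < e" if n: "n \<ge> n0" for n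
        proof -
          have "v x - e / 2 \<le> F n x"
          proof (rule F_ge)
            fix j assume "n \<le> j"
            then show "v x - e / 2 \<le> V j x" using n0[of j] n unfolding real_norm_def by linarith
          qed
          moreover have "F n x \<le> V n x" by (rule F_le) simp
          ultimately show ?thesis using n0[OF n] \<open>0 < e\<close> unfolding real_norm_def by linarith
        qed
        then show "\<exists>n0. \<forall>n\<ge>n0. norm (F n x - v x) < e" by blast
      qed
      moreover have "incseq (\<lambda>m. F m x)"
        by (intro incseq_SucI F_ge F_le) auto
      ultimately show ?case using F_ge[of 0 0] V(2) by auto
    qed
  qed measurable
  moreover have "N (\<lambda>x. complex_of_real (F m x)) \<le> c" for m
  proof -
    have "N (\<lambda>x. complex_of_real (F m x)) \<le> N (\<lambda>x. complex_of_real (V m x))"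
      using F_ge[of m 0] V(2) F_le[of m m]
      by (intro ball_quasi_Banach_mono[OF N]) (auto simp: abs_of_nonneg)
    also note le
    finally show ?thesis .
  qed
  ultimately show ?thesis by (intro LIMSEQ_le_const2) auto
qed

lemma ball_Banach_convex:
  assumes Z: "ball_Banach M rho Z"
    and f: "f \<in> borel_measurable M" "Z f \<le> ennreal c"
    and g: "g \<in> borel_measurable M" "Z g \<le> ennreal c"
    and t: "0 \<le> t" "t \<le> 1"
  shows "Z (\<lambda>x. complex_of_real (1 - t) * f x + complex_of_real t * g x) \<le> ennreal c"
proof -
  have homog: "Z (\<lambda>x. d * g x) = ennreal (cmod d) * Z g" if "g \<in> fun_space M Z" for g d
    using Z that unfolding ball_Banach_def ball_quasi_Banach_def quasi_Banach_fun_space_def by auto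
  have tri: "Z (\<lambda>x. f x + g x) \<le> Z f + Z g" if "f \<in> fun_space M Z" "g \<in> fun_space M Z" for f g
    using Z that unfolding ball_Banach_def by auto
  have mem: "f \<in> fun_space M Z" "g \<in> fun_space M Z"
    using f g by (auto simp: fun_space_def intro: le_less_trans)
  have mem': "(\<lambda>x. d * f x) \<in> fun_space M Z" if "f \<in> fun_space M Z" for f d
    using homog[OF that] that by (auto simp: fun_space_def ennreal_mult_less_top)
  have "Z (\<lambda>x. complex_of_real (1 - t) * f x + complex_of_real t * g x)
      \<le> ennreal (1 - t) * Z f + ennreal t * Z g"
    using tri[OF mem'[OF mem(1), of "complex_of_real (1 - t)"] mem'[OF mem(2), of "complex_of_real t"]]
      homog[OF mem(1)] homog[OF mem(2)] t by (simp del: of_real_diff)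
  also have "\<dots> \<le> ennreal (1 - t) * ennreal c + ennreal t * ennreal c"
    using f g by (intro add_mono mult_left_mono) auto
  also have "\<dots> = ennreal c"
    using t by (simp flip: distrib_right ennreal_plus)
  finally show ?thesis .
qed

text \<open>
  The functional is integration against \<open>h = u - v\<close>, where \<open>v\<close> is the best \<open>L\<^sup>2\<close> approximation to \<open>u\<close>
  among the functions between \<open>0\<close> and \<open>u\<close> with norm at most \<open>c\<close>. Moving from \<open>v\<close> towards a nonnegative
  \<open>w\<close> of norm at most \<open>c\<close> cannot decrease the distance to \<open>u\<close>. The point reached may exceed \<open>u\<close>, but
  cutting it off at \<open>u\<close> decreases both its norm and its distance to \<open>u\<close>. Hence the
  integral of \<open>h w\<close> is at most that of \<open>h v\<close>, whereas the integral of \<open>h u\<close> exceeds it by the squared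
  distance from \<open>u\<close> to \<open>v\<close>, which is positive as \<open>u\<close> lies outside the ball.
\<close>

lemma norm_ball_separation:
  fixes u :: "'a \<Rightarrow> real"
  assumes Z: "ball_Banach M rho Z"
    and B: "B \<in> sets M" "emeasure M B < \<infinity>"
    and u: "u \<in> borel_measurable M" "\<And>x. 0 \<le> u x" "\<And>x. u x \<le> m * indicator B x"
    and c: "0 < c" "ennreal c < Z (\<lambda>x. complex_of_real (u x))"
  obtains h \<gamma> where "h \<in> borel_measurable M" "\<And>x. 0 \<le> h x" "0 \<le> \<gamma>"
    "\<And>w. w \<in> borel_measurable M \<Longrightarrow> Z w \<le> 1 \<Longrightarrow>
       ennreal c * (\<integral>\<^sup>+x. ennreal (h x * cmod (w x)) \<partial>M) \<le> ennreal \<gamma>"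
    "ennreal \<gamma> < (\<integral>\<^sup>+x. ennreal (u x * h x) \<partial>M)"
proof -
  have Z': "ball_quasi_Banach M rho Z" using Z by (simp add: ball_Banach_def)
  note [measurable] = u(1) B(1)
  define S where "S = {v \<in> borel_measurable M. (\<forall>x. 0 \<le> v x \<and> v x \<le> u x) \<and>
    Z (\<lambda>x. complex_of_real (v x)) \<le> ennreal c}"
  have conv: "(\<lambda>x. min ((1 - t) * v x + t * w x) (u x)) \<in> S"
    if v: "v \<in> S" and w: "w \<in> borel_measurable M" "\<And>x. 0 \<le> w x" "Z (\<lambda>x. complex_of_real (w x)) \<le> ennreal c"
      and t: "0 \<le> t" "t \<le> 1" for v w t
  proof -
    have [measurable]: "v \<in> borel_measurable M" using v by (simp add: S_def)
    note [measurable] = w(1)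
    have v0: "0 \<le> v x" for x using v by (simp add: S_def)
    have nn: "0 \<le> (1 - t) * v x + t * w x" for x
      using t v0 w(2) by (intro add_nonneg_nonneg mult_nonneg_nonneg) auto
    have "Z (\<lambda>x. complex_of_real (min ((1 - t) * v x + t * w x) (u x)))
      \<le> Z (\<lambda>x. complex_of_real (1 - t) * complex_of_real (v x) + complex_of_real t * complex_of_real (w x))"
    proof (rule ball_quasi_Banach_mono[OF Z'])
      show "AE x in M. cmod (complex_of_real (min ((1 - t) * v x + t * w x) (u x)))
        \<le> cmod (complex_of_real (1 - t) * complex_of_real (v x) + complex_of_real t * complex_of_real (w x))"
      proof (rule AE_I2)
        fix x
        have "complex_of_real (1 - t) * complex_of_real (v x) + complex_of_real t * complex_of_real (w x)
            = complex_of_real ((1 - t) * v x + t * w x)" by simp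
        then show "cmod (complex_of_real (min ((1 - t) * v x + t * w x) (u x)))
          \<le> cmod (complex_of_real (1 - t) * complex_of_real (v x) + complex_of_real t * complex_of_real (w x))"
          using nn[of x] u(2)[of x] by (simp only: norm_of_real)
      qed
    qed measurable
    also have "\<dots> \<le> ennreal c"
      using v w t by (intro ball_Banach_convex[OF Z]) (auto simp: S_def)
    finally show ?thesis
      using nn u(2) unfolding S_def by (auto simp: min_def)
  qed
  have zero: "(\<lambda>x. 0) \<in> S"
  proof -
    have "Z (\<lambda>x. 0) = 0"
      using ball_quasi_Banach_eq_0_iff[OF Z', of "\<lambda>x. 0"] by simp
    then show ?thesis using u(2) by (simp add: S_def)
  qed
  have S_dest: "v \<in> borel_measurable M" "0 \<le> v x" "v x \<le> u x" if "v \<in> S" for v x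
    using that by (simp_all add: S_def)
  have mid: "(\<lambda>x. (v x + w x) / 2) \<in> S" if "v \<in> S" "w \<in> S" for v w
  proof -
    have "(\<lambda>x. min ((1 - 1/2) * v x + 1/2 * w x) (u x)) \<in> S"
      using that by (intro conv) (auto simp: S_def)
    moreover have "(\<lambda>x. min ((1 - 1/2) * v x + 1/2 * w x) (u x)) = (\<lambda>x. (v x + w x) / 2)"
    proof
      fix x
      have "v x \<le> u x" "w x \<le> u x" using that by (auto simp: S_def)
      then show "min ((1 - 1/2) * v x + 1/2 * w x) (u x) = (v x + w x) / 2" by (simp add: min_def)
    qed
    ultimately show ?thesis by (simp only:)
  qed
  have "S \<noteq> {}" using zero by auto
  obtain v V where v: "v \<in> borel_measurable M" "\<And>x. 0 \<le> v x" "\<And>x. v x \<le> u x"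
    and V: "\<And>n::nat. V n \<in> S" "AE x in M. (\<lambda>n. V n x) \<longlonglongrightarrow> v x"
    and v_min: "\<And>w. w \<in> S \<Longrightarrow> (\<integral>x. (u x - v x)\<^sup>2 \<partial>M) \<le> (\<integral>x. (u x - w x)\<^sup>2 \<partial>M)"
  proof (rule L2_minimizer[where S = S and u = u and B = B and m = m and M = M])
    show "B \<in> sets M" "emeasure M B < \<infinity>" "u \<in> borel_measurable M" "S \<noteq> {}" by fact+
    show "0 \<le> u x" "u x \<le> m * indicator B x" for x by (fact u)+
    show "v \<in> borel_measurable M" if "v \<in> S" for v using that by (rule S_dest)
    show "0 \<le> v x" "v x \<le> u x" if "v \<in> S" for v x using that by (rule S_dest)+
    show "(\<lambda>x. (v x + w x) / 2) \<in> S" if "v \<in> S" "w \<in> S" for v w using that by (rule mid)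
    fix v V
    assume "v \<in> borel_measurable M" "\<And>x. 0 \<le> v x" "\<And>x. v x \<le> u x"
      "\<And>n::nat. V n \<in> S" "AE x in M. (\<lambda>n. V n x) \<longlonglongrightarrow> v x"
      "\<And>w. w \<in> S \<Longrightarrow> (\<integral>x. (u x - v x)\<^sup>2 \<partial>M) \<le> (\<integral>x. (u x - w x)\<^sup>2 \<partial>M)"
    then show thesis by (rule that[of v V])
  qed
  note [measurable] = v(1)
  have "Z (\<lambda>x. complex_of_real (v x)) \<le> ennreal c"
  proof (rule ball_quasi_Banach_Fatou[OF Z'])
    show "V n \<in> borel_measurable M" "0 \<le> V n x" for n x using S_dest V(1) by blast+
    show "Z (\<lambda>x. complex_of_real (V n x)) \<le> ennreal c" for n using V(1)[of n] by (simp add: S_def)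
  qed (fact V(2) v(1))+
  with v have vS: "v \<in> S" unfolding S_def by blast
  define h where "h x = u x - v x" for x
  have h[measurable]: "h \<in> borel_measurable M" unfolding h_def by measurable
  have h0: "0 \<le> h x" and hu: "h x \<le> m * indicator B x" for x
    using v(2,3)[of x] u(3)[of x] unfolding h_def by linarith+
  have int: "integrable M (\<lambda>x. f x * g x)"
    if "f \<in> borel_measurable M" "g \<in> borel_measurable M" "\<And>x. \<bar>f x\<bar> \<le> a * indicator B x" "\<And>x. \<bar>g x\<bar> \<le> b * indicator B x"
    for f g :: "'a \<Rightarrow> real" and a b
  proof (rule integrable_bounded_finite_support[OF _ B, of _ "a * b"])
    show "(\<lambda>x. f x * g x) \<in> borel_measurable M" using that by measurable
    fix x
    have "\<bar>f x\<bar> * \<bar>g x\<bar> \<le> (a * indicator B x) * (b * indicator B x)"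
      using that(3)[of x] that(4)[of x] by (intro mult_mono) auto
    then show "\<bar>f x * g x\<bar> \<le> a * b * indicator B x"
      by (auto simp: abs_mult indicator_def split: if_splits)
  qed
  have vB: "\<bar>v x\<bar> \<le> m * indicator B x" and hB: "\<bar>h x\<bar> \<le> m * indicator B x"
    and uB: "\<bar>u x\<bar> \<le> m * indicator B x" for x
    using v(2,3)[of x] u(2,3)[of x] h0[of x] hu[of x] by auto
  define \<gamma> where "\<gamma> = (\<integral>x. h x * v x \<partial>M)"
  \<comment> \<open>at \<open>v\<close>, the squared distance to \<open>u\<close> has a nonnegative derivative in the direction of \<open>w\<close>\<close>
  have var: "(\<integral>x. h x * w x \<partial>M) \<le> \<gamma>"
    if w: "w \<in> borel_measurable M" "\<And>x. 0 \<le> w x" "\<And>x. w x \<le> b * indicator B x"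
      "Z (\<lambda>x. complex_of_real (w x)) \<le> ennreal c" for w b
  proof -
    note [measurable] = w(1)
    have wB: "\<bar>w x\<bar> \<le> b * indicator B x" for x using w(2,3)[of x] by auto
    have dB: "\<bar>w x - v x\<bar> \<le> (b + m) * indicator B x" for x
      using wB[of x] vB[of x] by (auto simp: algebra_simps abs_le_iff)
    define D where "D = (\<integral>x. (w x - v x) * (w x - v x) \<partial>M)"
    define I where "I = (\<integral>x. h x * (w x - v x) \<partial>M)"
    have ints: "integrable M (\<lambda>x. h x * h x)" "integrable M (\<lambda>x. h x * (w x - v x))"
      "integrable M (\<lambda>x. (w x - v x) * (w x - v x))"
      by (rule int[OF _ _ hB hB] int[OF _ _ hB dB] int[OF _ _ dB dB]; measurable)+
    have le: "2 * I \<le> t * D" if t: "0 < t" "t \<le> 1" for t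
    proof -
      let ?w = "\<lambda>x. min ((1 - t) * v x + t * w x) (u x)"
      have "?w \<in> S" using t w by (intro conv vS) auto
      then have w1: "?w \<in> borel_measurable M" "\<And>x. 0 \<le> ?w x" "\<And>x. ?w x \<le> u x"
        unfolding S_def by blast+
      have "(\<integral>x. h x * h x \<partial>M) \<le> (\<integral>x. (u x - ?w x)\<^sup>2 \<partial>M)"
        using v_min[OF \<open>?w \<in> S\<close>] by (simp add: h_def power2_eq_square)
      also have "\<dots> \<le> (\<integral>x. h x * h x - 2 * t * (h x * (w x - v x)) + t\<^sup>2 * ((w x - v x) * (w x - v x)) \<partial>M)"
      proof (rule integral_mono)
        show "integrable M (\<lambda>x. (u x - ?w x)\<^sup>2)"
          unfolding power2_eq_square
        proof (rule int[where a = m and b = m])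
          show "\<bar>u x - ?w x\<bar> \<le> m * indicator B x" for x
            using w1(2)[of x] w1(3)[of x] u(3)[of x] by linarith
          then show "\<bar>u x - ?w x\<bar> \<le> m * indicator B x" for x .
        qed (use w1 in measurable)
        show "integrable M (\<lambda>x. h x * h x - 2 * t * (h x * (w x - v x)) + t\<^sup>2 * ((w x - v x) * (w x - v x)))"
          using ints by (intro Bochner_Integration.integrable_add Bochner_Integration.integrable_diff integrable_mult_right)
        fix x
        have "(u x - ?w x)\<^sup>2 \<le> (h x - t * (w x - v x))\<^sup>2"
        proof (cases "(1 - t) * v x + t * w x \<le> u x")
          case True
          then have "u x - ?w x = h x - t * (w x - v x)" by (simp add: h_def algebra_simps)
          then show ?thesis by simp
        next
          case False
          then have "u x - ?w x = 0" by simp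
          then show ?thesis by simp
        qed
        also have "\<dots> = h x * h x - 2 * t * (h x * (w x - v x)) + t\<^sup>2 * ((w x - v x) * (w x - v x))"
          by (simp add: power2_eq_square algebra_simps)
        finally show "(u x - ?w x)\<^sup>2 \<le> \<dots>" .
      qed
      also have "\<dots> = (\<integral>x. h x * h x \<partial>M) - 2 * t * I + t\<^sup>2 * D"
        unfolding I_def D_def using ints
        by (subst Bochner_Integration.integral_add Bochner_Integration.integral_diff;
            (intro Bochner_Integration.integrable_diff integrable_mult_right)?; simp)+
      finally have "t * (2 * I) \<le> t * (t * D)" by (simp add: power2_eq_square algebra_simps)
      then show ?thesis using t by simp
    qed
    have "I \<le> 0"
    proof (rule ccontr)
      assume "\<not> I \<le> 0"
      then have "0 < I" by simp
      have "0 \<le> D" unfolding D_def by (intro integral_nonneg_AE) auto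
      define t where "t = min 1 (I / (D + 1))"
      have "0 < t" "t \<le> 1" using \<open>0 < I\<close> \<open>0 \<le> D\<close> by (auto simp: t_def)
      have "t * D \<le> I / (D + 1) * D" using \<open>0 \<le> D\<close> by (intro mult_right_mono) (auto simp: t_def)
      also have "\<dots> \<le> I" using \<open>0 < I\<close> \<open>0 \<le> D\<close> by (simp add: divide_le_eq mult_left_mono)
      finally show False using le[OF \<open>0 < t\<close> \<open>t \<le> 1\<close>] \<open>0 < I\<close> by linarith
    qed
    moreover have "I = (\<integral>x. h x * w x \<partial>M) - \<gamma>"
      unfolding I_def \<gamma>_def using int[OF _ _ hB wB] int[OF _ _ hB vB]
      by (subst Bochner_Integration.integral_diff[symmetric]) (auto simp: algebra_simps)
    ultimately show ?thesis by simp
  qed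
  have \<gamma>0: "0 \<le> \<gamma>" unfolding \<gamma>_def using h0 v by (intro integral_nonneg_AE) auto
  have bound: "ennreal c * (\<integral>\<^sup>+x. ennreal (h x * cmod (w x)) \<partial>M) \<le> ennreal \<gamma>"
    if w[measurable]: "w \<in> borel_measurable M" and "Z w \<le> 1" for w
  proof -
    define W where "W k x = min (c * cmod (w x)) (real k) * indicator B x" for k x
    have Wm[measurable]: "W k \<in> borel_measurable M" for k unfolding W_def by measurable
    have W0: "0 \<le> W k x" for k x using c by (auto simp: W_def)
    have le: "(\<integral>\<^sup>+x. ennreal (h x * W k x) \<partial>M) \<le> ennreal \<gamma>" for k
    proof -
      have "Z (\<lambda>x. complex_of_real (W k x)) \<le> Z (\<lambda>x. complex_of_real c * w x)"
        using c by (intro ball_quasi_Banach_mono[OF Z']) (auto simp: W_def norm_mult indicator_def)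
      also have "\<dots> = ennreal c * Z w" using c by (intro ball_quasi_Banach_scale[OF Z']) auto
      also have "\<dots> \<le> ennreal c" using \<open>Z w \<le> 1\<close> by (metis mult.right_neutral mult_left_mono zero_le)
      finally have "(\<integral>x. h x * W k x \<partial>M) \<le> \<gamma>"
        using W0 by (intro var[of _ "real k"]) (auto simp: W_def indicator_def)
      moreover have "integrable M (\<lambda>x. h x * W k x)"
        using W0 by (intro int[OF _ _ hB, of _ "real k"]) (auto simp: W_def indicator_def)
      ultimately show ?thesis
        using h0 W0 by (subst nn_integral_eq_integral) (auto intro: ennreal_leI)
    qed
    have "(\<integral>\<^sup>+x. (SUP k. ennreal (h x * W k x)) \<partial>M) = (SUP k. \<integral>\<^sup>+x. ennreal (h x * W k x) \<partial>M)"
    proof (rule nn_integral_monotone_convergence_SUP)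
      show "incseq (\<lambda>k x. ennreal (h x * W k x))"
        using h0 by (auto intro!: incseq_SucI le_funI ennreal_leI mult_left_mono mult_right_mono simp: W_def)
    qed measurable
    moreover have "ennreal (c * (h x * cmod (w x))) \<le> (SUP k. ennreal (h x * W k x))" for x
    proof -
      obtain k :: nat where k: "c * cmod (w x) \<le> k" using real_arch_simple by blast
      have "h x * W k x = c * (h x * cmod (w x))"
      proof (cases "x \<in> B")
        case False
        then have "h x = 0" using hB[of x] by simp
        then show ?thesis by simp
      qed (use k in \<open>simp add: W_def\<close>)
      then show ?thesis by (metis SUP_upper UNIV_I)
    qed
    ultimately have "(\<integral>\<^sup>+x. ennreal (c * (h x * cmod (w x))) \<partial>M) \<le> (SUP k. \<integral>\<^sup>+x. ennreal (h x * W k x) \<partial>M)"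
      by (metis (no_types, lifting) nn_integral_mono)
    also have "\<dots> \<le> ennreal \<gamma>" by (intro SUP_least le)
    finally have "(\<integral>\<^sup>+x. ennreal (c * (h x * cmod (w x))) \<partial>M) \<le> ennreal \<gamma>" .
    then show ?thesis
      using c h0 by (simp add: ennreal_mult nn_integral_cmult)
  qed
  have "\<gamma> < (\<integral>x. u x * h x \<partial>M)"
  proof -
    have "(\<integral>x. u x * h x \<partial>M) = \<gamma> + (\<integral>x. h x * h x \<partial>M)"
      unfolding \<gamma>_def using int[OF _ _ hB hB] int[OF _ _ hB vB]
      by (subst Bochner_Integration.integral_add[symmetric]) (auto simp: h_def algebra_simps)
    moreover have "(\<integral>x. h x * h x \<partial>M) \<noteq> 0"
    proof
      assume "(\<integral>x. h x * h x \<partial>M) = 0"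
      then have "AE x in M. h x * h x = 0"
        using int[OF _ _ hB hB] by (subst (asm) integral_nonneg_eq_0_iff_AE) auto
      then have "AE x in M. cmod (complex_of_real (u x)) = cmod (complex_of_real (v x))"
        by eventually_elim (simp add: h_def)
      then have "Z (\<lambda>x. complex_of_real (u x)) = Z (\<lambda>x. complex_of_real (v x))"
        by (intro ball_quasi_Banach_cong[OF Z']) auto
      moreover have "Z (\<lambda>x. complex_of_real (v x)) \<le> ennreal c" using vS by (simp add: S_def)
      ultimately show False using c(2) by (simp add: leD)
    qed
    moreover have "0 \<le> (\<integral>x. h x * h x \<partial>M)" by (intro integral_nonneg_AE) auto
    ultimately show ?thesis by linarith
  qed
  then have "ennreal \<gamma> < (\<integral>\<^sup>+x. ennreal (u x * h x) \<partial>M)"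
    using \<gamma>0 u(2) h0 int[OF _ _ uB hB]
    by (subst nn_integral_eq_integral) (auto simp: ennreal_less_iff)
  from that[OF h h0 \<gamma>0 bound this] show thesis .
qed

lemma assoc_norm_Hoelder:
  assumes Z: "ball_quasi_Banach M rho Z"
    and w: "w \<in> borel_measurable M" "Z w < \<infinity>" and g: "g \<in> borel_measurable M"
  shows "(\<integral>\<^sup>+x. ennreal (cmod (w x)) * ennreal (cmod (g x)) \<partial>M) \<le> Z w * assoc_norm M Z g"
proof -
  note [measurable] = w(1) g
  obtain r where r: "0 \<le> r" "Z w = ennreal r" using w(2) by (cases "Z w") auto
  show ?thesis
  proof (cases "r = 0")
    case True
    then have "AE x in M. w x = 0" using ball_quasi_Banach_eq_0_iff[OF Z w(1)] r by simp
    then have "(\<integral>\<^sup>+x. ennreal (cmod (w x)) * ennreal (cmod (g x)) \<partial>M) = (\<integral>\<^sup>+x. 0 \<partial>M)"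
      by (intro nn_integral_cong_AE) (auto elim!: AE_mp)
    then show ?thesis by simp
  next
    case False
    with r have "0 < r" by simp
    let ?w = "\<lambda>x. complex_of_real (1 / r) * w x"
    have "Z ?w = ennreal (1 / r) * ennreal r"
      using ball_quasi_Banach_scale[OF Z w(1), of "1 / r"] \<open>0 < r\<close> r by simp
    also have "\<dots> = 1" using \<open>0 < r\<close> by (simp flip: ennreal_mult)
    finally have "(\<integral>\<^sup>+x. ennreal (cmod (g x * ?w x)) \<partial>M) \<le> assoc_norm M Z g"
      unfolding assoc_norm_def by (intro SUP_upper) auto
    also have "(\<integral>\<^sup>+x. ennreal (cmod (g x * ?w x)) \<partial>M) =
        (\<integral>\<^sup>+x. ennreal (1 / r) * (ennreal (cmod (w x)) * ennreal (cmod (g x))) \<partial>M)"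
      using \<open>0 < r\<close> by (intro nn_integral_cong) (simp add: norm_mult norm_divide mult_ac flip: ennreal_mult)
    also have "\<dots> = ennreal (1 / r) * (\<integral>\<^sup>+x. ennreal (cmod (w x)) * ennreal (cmod (g x)) \<partial>M)"
      by (intro nn_integral_cmult) measurable
    finally show ?thesis using \<open>0 < r\<close> r by (simp add: le_ennreal_mult_iff)
  qed
qed

text \<open>
  The nontrivial half of the theorem of Lorentz and Luxemburg: the second associate norm dominates the
  norm. The truncations of \<open>u\<close> to bounded functions supported in balls have norm at most \<open>c\<close>, since
  otherwise a separating \<open>h\<close> would violate the hypothesis. Testing with indicators of balls, which have finite
  associate norm by local integrability, shows that \<open>u\<close> is finite almost everywhere, so that the
  truncations increase to a function with finite values.
\<close>

lemma ext_norm_le_by_duality: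
  fixes u :: "'a \<Rightarrow> ennreal"
  assumes Z: "ball_Banach M rho Z"
    and B: "\<And>k::nat. B k \<in> sets M" "\<And>k. emeasure M (B k) < \<infinity>" "\<And>k. B k \<in> qballs M rho"
      "incseq B" "space M \<subseteq> (\<Union>k. B k)"
    and u: "u \<in> borel_measurable M" and "0 < c"
    and dual: "\<And>h. h \<in> borel_measurable M \<Longrightarrow> assoc_norm M Z h < \<infinity> \<Longrightarrow>
       (\<integral>\<^sup>+x. u x * ennreal (cmod (h x)) \<partial>M) \<le> ennreal c * assoc_norm M Z h"
  shows "ext_norm M Z u \<le> ennreal c"
proof -
  have Z': "ball_quasi_Banach M rho Z" using Z by (simp add: ball_Banach_def)
  note [measurable] = u B(1)
  define U where "U k x = enn2real (min (u x) (ennreal (real k))) * indicator (B k) x" for k x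
  have Um[measurable]: "U k \<in> borel_measurable M" for k unfolding U_def by measurable
  have fin: "min (u x) (ennreal (real k)) < \<infinity>" for x k by (auto simp: min_less_iff_disj)
  have U0: "0 \<le> U k x" for k x by (simp add: U_def)
  have Uk: "U k x \<le> real k * indicator (B k) x" for k x
    unfolding U_def by (intro mult_right_mono) (auto intro: enn2real_leI)
  have Uu: "ennreal (U k x) \<le> u x" for k x
    using fin[of x k] by (auto simp: U_def indicator_def ennreal_enn2real)
  have UZ: "Z (\<lambda>x. complex_of_real (U k x)) \<le> ennreal c" for k
  proof (rule ccontr)
    assume "\<not> ?thesis"
    then have "ennreal c < Z (\<lambda>x. complex_of_real (U k x))" by simp
    note sep = norm_ball_separation[OF Z B(1) B(2) Um U0 Uk \<open>0 < c\<close> this]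
    obtain h \<gamma> where h[measurable]: "h \<in> borel_measurable M" and h0: "\<And>x. 0 \<le> h x" and "0 \<le> \<gamma>"
      and sep: "\<And>w. w \<in> borel_measurable M \<Longrightarrow> Z w \<le> 1 \<Longrightarrow>
         ennreal c * (\<integral>\<^sup>+x. ennreal (h x * cmod (w x)) \<partial>M) \<le> ennreal \<gamma>"
      and less: "ennreal \<gamma> < (\<integral>\<^sup>+x. ennreal (U k x * h x) \<partial>M)"
    proof (rule sep)
      fix h \<gamma>
      assume "h \<in> borel_measurable M" "\<And>x. 0 \<le> h x" "0 \<le> \<gamma>"
        "\<And>w. w \<in> borel_measurable M \<Longrightarrow> Z w \<le> 1 \<Longrightarrow>
           ennreal c * (\<integral>\<^sup>+x. ennreal (h x * cmod (w x)) \<partial>M) \<le> ennreal \<gamma>"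
        "ennreal \<gamma> < (\<integral>\<^sup>+x. ennreal (U k x * h x) \<partial>M)"
      then show thesis by (rule that)
    qed
    let ?h = "\<lambda>x. complex_of_real (h x)"
    have "assoc_norm M Z ?h \<le> ennreal (1 / c) * ennreal \<gamma>"
      unfolding assoc_norm_def
    proof (rule SUP_least)
      fix w assume "w \<in> {g \<in> borel_measurable M. Z g \<le> 1}"
      then have "ennreal c * (\<integral>\<^sup>+x. ennreal (h x * cmod (w x)) \<partial>M) \<le> ennreal \<gamma>" by (intro sep) auto
      then show "(\<integral>\<^sup>+x. ennreal (cmod (?h x * w x)) \<partial>M) \<le> ennreal (1 / c) * ennreal \<gamma>"
        using h0 \<open>0 < c\<close> by (subst le_ennreal_mult_iff) (auto simp: norm_mult)
    qed
    then have 1: "ennreal c * assoc_norm M Z ?h \<le> ennreal \<gamma>"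
      using \<open>0 < c\<close> le_ennreal_mult_iff[of "1 / c" "assoc_norm M Z ?h" "ennreal \<gamma>"] by simp
    have 2: "assoc_norm M Z ?h < \<infinity>"
      using \<open>assoc_norm M Z ?h \<le> _\<close> by (auto intro: le_less_trans simp: ennreal_mult_less_top)
    have "(\<integral>\<^sup>+x. ennreal (U k x * h x) \<partial>M) \<le> (\<integral>\<^sup>+x. u x * ennreal (cmod (?h x)) \<partial>M)"
      using U0 h0 by (intro nn_integral_mono) (auto simp: ennreal_mult intro!: mult_right_mono Uu)
    also have "\<dots> \<le> ennreal c * assoc_norm M Z ?h" by (intro dual 2) auto
    finally show False using 1 less by (meson leD order.trans)
  qed
  have "AE x in M. u x * indicator (B k) x \<noteq> \<infinity>" for k
  proof (rule nn_integral_noteq_infinite)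
    let ?h = "indicator (B k) :: 'a \<Rightarrow> complex"
    obtain C where C: "C > 0" "\<And>f. f \<in> fun_space M Z \<Longrightarrow> (\<integral>\<^sup>+x\<in>B k. ennreal (cmod (f x)) \<partial>M) \<le> ennreal C * Z f"
      using Z B(3) unfolding ball_Banach_def by metis
    have "assoc_norm M Z ?h \<le> ennreal C"
      unfolding assoc_norm_def
    proof (rule SUP_least)
      fix g assume g: "g \<in> {g \<in> borel_measurable M. Z g \<le> 1}"
      have "(\<integral>\<^sup>+x. ennreal (cmod (?h x * g x)) \<partial>M) = (\<integral>\<^sup>+x\<in>B k. ennreal (cmod (g x)) \<partial>M)"
        by (intro nn_integral_cong) (auto simp: indicator_def)
      also have "\<dots> \<le> ennreal C * Z g"
        using g by (intro C) (auto simp: fun_space_def intro: le_less_trans)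
      also have "\<dots> \<le> ennreal C * 1" using g by (intro mult_left_mono) auto
      finally show "(\<integral>\<^sup>+x. ennreal (cmod (?h x * g x)) \<partial>M) \<le> ennreal C" by simp
    qed
    then have fin: "assoc_norm M Z ?h < \<infinity>" by (auto intro: le_less_trans)
    have "(\<integral>\<^sup>+x. u x * indicator (B k) x \<partial>M) = (\<integral>\<^sup>+x. u x * ennreal (cmod (?h x)) \<partial>M)"
      by (intro nn_integral_cong) (auto simp: indicator_def)
    also have "\<dots> \<le> ennreal c * assoc_norm M Z ?h" by (intro dual fin) auto
    also have "\<dots> < \<infinity>" using fin by (simp add: ennreal_mult_less_top)
    finally show "(\<integral>\<^sup>+x. u x * indicator (B k) x \<partial>M) \<noteq> \<infinity>" by simp
  qed measurable
  then have "AE x in M. \<forall>k. u x * indicator (B k) x \<noteq> \<infinity>" by (simp add: AE_all_countable)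
  then have ufin: "AE x in M. u x < \<infinity>"
    using AE_space
  proof eventually_elim
    case (elim x)
    then obtain k where "x \<in> B k" using B(5) by auto
    then show ?case using elim(1) by (auto simp: top.not_eq_extremum dest!: spec[of _ k])
  qed
  have "(\<lambda>k. Z (\<lambda>x. complex_of_real (U k x))) \<longlonglongrightarrow> Z (\<lambda>x. complex_of_real (enn2real (u x)))"
  proof (rule ball_quasi_Banach_mono_conv[OF Z'])
    show "AE x in M. 0 \<le> U 0 x \<and> incseq (\<lambda>m. U m x) \<and> (\<lambda>m. U m x) \<longlonglongrightarrow> enn2real (u x)"
      using ufin AE_space
    proof eventually_elim
      case (elim x)
      have "incseq (\<lambda>m. U m x)"
      proof (rule incseq_SucI)
        fix m
        have "B m \<subseteq> B (Suc m)" using B(4) by (auto simp: incseq_def)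
        moreover have "enn2real (min (u x) (ennreal (real m))) \<le> enn2real (min (u x) (ennreal (real (Suc m))))"
          using fin[of x "Suc m"] by (intro enn2real_mono min.mono order.refl ennreal_leI) auto
        ultimately show "U m x \<le> U (Suc m) x"
          unfolding U_def by (auto simp: indicator_def)
      qed
      moreover have "(\<lambda>m. U m x) \<longlonglongrightarrow> enn2real (u x)"
      proof (rule tendsto_eventually)
        obtain k where k: "x \<in> B k" using B(5) elim by auto
        obtain n :: nat where n: "enn2real (u x) \<le> n" using real_arch_simple by blast
        have "U m x = enn2real (u x)" if "m \<ge> max k n" for m
        proof -
          have "x \<in> B m" using k B(4) that by (auto simp: incseq_def)
          moreover have "u x \<le> ennreal (real m)"
            using n that elim(1) by (metis ennreal_enn2real ennreal_leI infinity_ennreal_def max.bounded_iff of_nat_le_iff order.trans)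
          ultimately show ?thesis by (simp add: U_def min_def)
        qed
        then show "\<forall>\<^sub>F m in sequentially. U m x = enn2real (u x)"
          unfolding eventually_sequentially by blast
      qed
      ultimately show ?case using U0 by auto
    qed
  qed measurable
  then have "Z (\<lambda>x. complex_of_real (enn2real (u x))) \<le> ennreal c"
    using UZ by (intro LIMSEQ_le_const2) auto
  moreover have "ext_norm M Z u \<le> Z (\<lambda>x. complex_of_real (enn2real (u x)))"
  proof (rule ext_norm_le)
    show "AE x in M. u x \<le> ennreal (cmod (complex_of_real (enn2real (u x))))"
      using ufin by eventually_elim simp
  qed measurable
  ultimately show ?thesis by (rule order.trans[rotated])
qed

section \<open>Nets in doubling spaces\<close>

lemma le_two_power_nat_ceiling: "a \<le> 2 ^ nat \<lceil>a::real\<rceil>"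
proof -
  have "a \<le> real (nat \<lceil>a\<rceil>)" by linarith
  also have "\<dots> \<le> 2 ^ nat \<lceil>a\<rceil>" using of_nat_less_two_power[of "nat \<lceil>a\<rceil>", where ?'a = real] by linarith
  finally show ?thesis .
qed

lemma borel_measurable_nn_integral_count_space:
  assumes "countable I" and f: "\<And>i. i \<in> I \<Longrightarrow> f i \<in> borel_measurable M"
  shows "(\<lambda>x. \<integral>\<^sup>+i. f i x \<partial>count_space I) \<in> borel_measurable M"
proof (cases "finite I")
  case True
  then show ?thesis using f by (simp add: nn_integral_count_space_finite)
next
  case False
  have eq: "(\<integral>\<^sup>+i. f i x \<partial>count_space I) = (\<Sum>n. f (from_nat_into I n) x)" for x
    using nn_integral_bij_count_space[OF bij_betw_from_nat_into[OF assms(1) False], of "\<lambda>i. f i x"]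
    by (simp add: nn_integral_count_space_nat)
  have "f (from_nat_into I n) \<in> borel_measurable M" for n
    using False by (intro f from_nat_into) auto
  then show ?thesis unfolding eq by measurable
qed

text \<open>
  A space of homogeneous type with its quasi-metric constant \<open>K\<close> and its doubling constant \<open>L\<close> fixed.
\<close>

locale doubling_space =
  fixes M :: "'a measure" and rho :: "'a \<Rightarrow> 'a \<Rightarrow> real" and K L :: real
  assumes space_ne: "space M \<noteq> {}"
    and rho_nonneg: "x \<in> space M \<Longrightarrow> y \<in> space M \<Longrightarrow> 0 \<le> rho x y"
    and rho_eq_0_iff: "x \<in> space M \<Longrightarrow> y \<in> space M \<Longrightarrow> rho x y = 0 \<longleftrightarrow> x = y"
    and rho_sym: "x \<in> space M \<Longrightarrow> y \<in> space M \<Longrightarrow> rho x y = rho y x"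
    and K_ge_1: "1 \<le> K"
    and rho_triangle: "x \<in> space M \<Longrightarrow> y \<in> space M \<Longrightarrow> z \<in> space M \<Longrightarrow>
      rho x z \<le> K * (rho x y + rho y z)"
    and qballs_sets: "qballs M rho \<subseteq> sets M"
    and L_ge_1: "1 \<le> L"
    and doubling: "x \<in> space M \<Longrightarrow> 0 < r \<Longrightarrow>
        0 < emeasure M (qball M rho x (2 * r)) \<and>
        emeasure M (qball M rho x (2 * r)) \<le> ennreal L * emeasure M (qball M rho x r) \<and>
        ennreal L * emeasure M (qball M rho x r) < \<infinity>"
begin

abbreviation Q :: "'a \<Rightarrow> real \<Rightarrow> 'a set" where "Q x r \<equiv> qball M rho x r"

definition V :: "'a \<Rightarrow> real \<Rightarrow> real" where "V x r = measure M (Q x r)"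

lemma Q_sets [measurable]: "x \<in> space M \<Longrightarrow> Q x r \<in> sets M"
proof (cases "0 < r")
  case False
  assume "x \<in> space M"
  then have "Q x r = {}" using False rho_nonneg[of x] by (force simp: qball_def)
  then show ?thesis by simp
qed (use qballs_sets in \<open>auto simp: qballs_def\<close>)

lemma emeasure_Q_finite: "x \<in> space M \<Longrightarrow> 0 < r \<Longrightarrow> emeasure M (Q x r) < \<infinity>"
  using doubling[of x r] L_ge_1 by (auto simp: ennreal_mult_less_top)

lemma emeasure_Q: "x \<in> space M \<Longrightarrow> 0 < r \<Longrightarrow> emeasure M (Q x r) = ennreal (V x r)"
  unfolding V_def using emeasure_Q_finite[of x r] by (intro emeasure_eq_ennreal_measure) auto

lemma V_pos: "x \<in> space M \<Longrightarrow> 0 < r \<Longrightarrow> 0 < V x r"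
  using doubling[of x "r/2"] by (simp add: emeasure_Q)

lemma V_double: "x \<in> space M \<Longrightarrow> 0 < r \<Longrightarrow> V x (2 * r) \<le> L * V x r"
  using doubling[of x r] emeasure_Q[of x r] emeasure_Q[of x "2*r"] L_ge_1 V_pos[of x r]
  by (auto simp flip: ennreal_mult)

lemma V_double_power: "x \<in> space M \<Longrightarrow> 0 < r \<Longrightarrow> V x (2 ^ m * r) \<le> L ^ m * V x r"
proof (induction m)
  case (Suc m)
  have "V x (2 ^ Suc m * r) \<le> L * V x (2 ^ m * r)"
    using V_double[of x "2 ^ m * r"] Suc by (simp add: mult.assoc)
  also have "\<dots> \<le> L * (L ^ m * V x r)" using Suc L_ge_1 by (intro mult_left_mono) auto
  finally show ?case by simp
qed simp

lemma Q_subset: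
  assumes "x \<in> space M" "z \<in> space M" "K * (rho z x + r) \<le> R"
  shows "Q x r \<subseteq> Q z R"
proof
  fix y assume y: "y \<in> Q x r"
  then have "rho z y \<le> K * (rho z x + rho x y)"
    using assms by (intro rho_triangle) (auto simp: qball_def)
  also have "\<dots> < K * (rho z x + r)"
    using y K_ge_1 by (intro mult_strict_left_mono) (auto simp: qball_def)
  finally show "y \<in> Q z R" using y assms by (auto simp: qball_def)
qed

lemma V_mono:
  assumes "x \<in> space M" "z \<in> space M" "Q x r \<subseteq> Q z R" "0 < R"
  shows "V x r \<le> V z R"
  unfolding V_def using assms emeasure_Q_finite[of z R]
  by (intro measure_mono_fmeasurable) (auto simp: fmeasurable_def)

lemma V_compare:
  assumes "x \<in> space M" "z \<in> space M" "0 < r" "K * (rho z x + R) \<le> 2 ^ m * r"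
  shows "V x R \<le> L ^ m * V z r"
  using V_mono[OF assms(1,2) Q_subset[OF assms(1,2,4)]] V_double_power[of z r m] assms by simp

definition separated :: "real \<Rightarrow> 'a set \<Rightarrow> bool" where
  "separated r E \<longleftrightarrow> E \<subseteq> space M \<and> (\<forall>z\<in>E. \<forall>w\<in>E. z \<noteq> w \<longrightarrow> r \<le> rho z w)"

text \<open>
  Packing: the balls of radius \<open>r / (2 K)\<close> around the points of \<open>E\<close> are disjoint and lie in one ball
  of radius \<open>K (a + 1) r\<close>, while by doubling each of them has at least the fraction \<open>1 / L ^ m\<close> of the measure
  of that ball.
\<close>

lemma separated_card:
  assumes E: "separated r E" and "0 < r" "x \<in> space M" "0 \<le> a"
    and m: "2 * K * (K * (a + K * (a + 1))) \<le> 2 ^ m"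
  shows "finite {z \<in> E. rho x z < a * r}" "card {z \<in> E. rho x z < a * r} \<le> L ^ m"
proof -
  have *: "card F \<le> L ^ m" if F: "F \<subseteq> {z \<in> E. rho x z < a * r}" "finite F" for F
  proof -
    let ?R = "K * (a + 1) * r" and ?r = "r / (2 * K)"
    have pos: "0 < ?R" "0 < ?r" using K_ge_1 assms by auto
    have FE: "z \<in> space M" "rho x z < a * r" "z \<in> E" if "z \<in> F" for z
      using that F E by (auto simp: separated_def)
    have disj: "disjoint_family_on (\<lambda>z. Q z ?r) F"
      unfolding disjoint_family_on_def
    proof (intro ballI impI, rule ccontr)
      fix z w assume zw: "z \<in> F" "w \<in> F" "z \<noteq> w" "Q z ?r \<inter> Q w ?r \<noteq> {}"
      then obtain y where y: "y \<in> space M" "rho z y < ?r" "rho w y < ?r" by (auto simp: qball_def)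
      have "rho z w \<le> K * (rho z y + rho y w)" using zw y FE by (intro rho_triangle) auto
      also have "\<dots> < K * (?r + ?r)"
        using y zw FE rho_sym[of y w] K_ge_1 by (intro mult_strict_left_mono) auto
      also have "\<dots> = r" using K_ge_1 by simp
      finally have "rho z w < r" .
      moreover have "r \<le> rho z w" using E zw FE(3) unfolding separated_def by blast
      ultimately show False by simp
    qed
    have sub: "Q z ?r \<subseteq> Q x ?R" if "z \<in> F" for z
    proof (rule Q_subset)
      have "?r \<le> r / 1" using K_ge_1 \<open>0 < r\<close> by (intro divide_left_mono) auto
      then have "K * (rho x z + ?r) \<le> K * (a * r + r)"
        unfolding div_by_1 using FE[OF that] K_ge_1 by (intro mult_left_mono add_mono) auto
      then show "K * (rho x z + ?r) \<le> ?R" by (simp add: algebra_simps)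
    qed (use FE[OF that] assms in auto)
    have V_ge: "V x ?R \<le> L ^ m * V z ?r" if "z \<in> F" for z
    proof (rule V_compare)
      have "K * (rho z x + ?R) \<le> K * (a * r + ?R)"
        using FE[OF that] assms rho_sym[of z x] K_ge_1 by (intro mult_left_mono) auto
      also have "\<dots> = 2 * K * (K * (a + K * (a + 1))) * ?r"
        using K_ge_1 by (simp add: algebra_simps)
      also have "\<dots> \<le> 2 ^ m * ?r" using m pos by (intro mult_right_mono) auto
      finally show "K * (rho z x + ?R) \<le> 2 ^ m * ?r" .
    qed (use FE[OF that] assms pos in auto)
    have fm: "Q z s \<in> fmeasurable M" if "z \<in> space M" "0 < s" for z s
      using that emeasure_Q_finite[of z s] by (auto simp: fmeasurable_def)
    have "(\<Sum>z\<in>F. V z ?r) = measure M (\<Union>z\<in>F. Q z ?r)"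
      unfolding V_def using F disj FE pos by (intro measure_finite_Union[symmetric])
        (auto simp: image_subset_iff emeasure_Q)
    also have "\<dots> \<le> V x ?R"
      unfolding V_def using sub F FE assms(3) pos by (intro measure_mono_fmeasurable fm sets.finite_UN) auto
    finally have "(\<Sum>z\<in>F. V z ?r) \<le> V x ?R" .
    then have "(\<Sum>z\<in>F. V x ?R / L ^ m) \<le> V x ?R"
    proof (rule order.trans[rotated])
      show "(\<Sum>z\<in>F. V x ?R / L ^ m) \<le> (\<Sum>z\<in>F. V z ?r)"
        using V_ge L_ge_1 by (intro sum_mono) (simp add: divide_le_eq mult.commute)
    qed
    then have "real (card F) * V x ?R \<le> L ^ m * V x ?R" using L_ge_1 by (simp add: divide_le_eq mult.commute)
    then show ?thesis using V_pos[of x ?R] pos assms(3) by simp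
  qed
  have "finite {z \<in> E. rho x z < a * r} \<and> card {z \<in> E. rho x z < a * r} \<le> nat \<lfloor>L ^ m\<rfloor>"
    using * by (intro finite_if_finite_subsets_card_bdd) (auto simp: le_nat_floor)
  then show fin: "finite {z \<in> E. rho x z < a * r}" by simp
  from *[OF order.refl fin] show "card {z \<in> E. rho x z < a * r} \<le> L ^ m" .
qed

lemma maximal_separated_exists:
  assumes "0 < r"
  shows "\<exists>E. separated r E \<and> (\<forall>x\<in>space M. \<exists>z\<in>E. rho x z < r)"
proof -
  have "\<exists>E\<in>{E. separated r E}. \<forall>X\<in>{E. separated r E}. E \<subseteq> X \<longrightarrow> X = E"
  proof (rule subset_Zorn')
    fix C assume C: "subset.chain {E. separated r E} C"
    then have sep: "separated r E" if "E \<in> C" for E using that by (auto simp: subset.chain_def)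
    have "r \<le> rho z w" if "z \<in> E" "E \<in> C" "w \<in> F" "F \<in> C" "z \<noteq> w" for z w E F
    proof -
      have "E \<subseteq> F \<or> F \<subseteq> E" using C that by (auto simp: subset.chain_def)
      then show ?thesis using sep[OF that(2)] sep[OF that(4)] that unfolding separated_def by blast
    qed
    then show "\<Union>C \<in> {E. separated r E}" using sep unfolding separated_def by blast
  qed
  then obtain E where E: "separated r E" "\<And>X. separated r X \<Longrightarrow> E \<subseteq> X \<Longrightarrow> X = E" by blast
  have "\<exists>z\<in>E. rho x z < r" if x: "x \<in> space M" for x
  proof (rule ccontr)
    assume far: "\<not> (\<exists>z\<in>E. rho x z < r)"
    have 1: "r \<le> rho x z" if "z \<in> E" for z using far that by (meson not_le)
    moreover have "rho z x = rho x z" if "z \<in> E" for z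
      using that E(1) x by (intro rho_sym) (auto simp: separated_def)
    ultimately have "separated r (insert x E)"
      using E(1) x unfolding separated_def by simp
    then have "insert x E = E" by (intro E(2)) auto
    then have "r \<le> rho x x" by (intro 1) auto
    with x rho_eq_0_iff[of x x] assms show False by simp
  qed
  with E(1) show ?thesis by blast
qed

definition net :: "real \<Rightarrow> 'a set" where
  "net r = (SOME E. separated r E \<and> (\<forall>x\<in>space M. \<exists>z\<in>E. rho x z < r))"

lemma net:
  assumes "0 < r"
  shows "separated r (net r)" "\<And>x. x \<in> space M \<Longrightarrow> \<exists>z\<in>net r. rho x z < r"
  using someI_ex[OF maximal_separated_exists[OF assms]] unfolding net_def by blast+

lemma net_space: "0 < r \<Longrightarrow> z \<in> net r \<Longrightarrow> z \<in> space M"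
  using net(1)[of r] by (auto simp: separated_def)

lemma countable_net:
  assumes "0 < r"
  shows "countable (net r)"
proof -
  obtain x0 where x0: "x0 \<in> space M" using space_ne by auto
  have "net r \<subseteq> (\<Union>n::nat. {z \<in> net r. rho x0 z < real n * r})"
  proof
    fix z assume z: "z \<in> net r"
    obtain n :: nat where "rho x0 z / r < n" using reals_Archimedean2 by blast
    then have "rho x0 z < real n * r" using assms by (simp add: divide_less_eq)
    with z show "z \<in> (\<Union>n::nat. {z \<in> net r. rho x0 z < real n * r})" by auto
  qed
  moreover have "countable {z \<in> net r. rho x0 z < real n * r}" for n :: nat
    by (rule countable_finite, rule separated_card(1)[OF net(1)[OF assms] assms x0 _ le_two_power_nat_ceiling]) simp
  ultimately show ?thesis by (meson countable_UN countableI_type countable_subset)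
qed

text \<open>
  The packing bound for a ball whose radius is \<open>4 K\<close> times the separation. The same power of
  \<open>L\<close> compares the balls of the averaging kernels below with smaller balls nearby.
\<close>

definition overlap_const :: real where
  "overlap_const = L ^ nat \<lceil>2 * K * (K * (4 * K + K * (4 * K + 1)))\<rceil>"

lemma overlap_const_ge_1: "1 \<le> overlap_const"
  unfolding overlap_const_def using L_ge_1 by (rule one_le_power)

lemma net_overlap:
  assumes "0 < r" "x \<in> space M"
  shows "finite {z \<in> net r. x \<in> Q z (4 * K * r)}" "card {z \<in> net r. x \<in> Q z (4 * K * r)} \<le> overlap_const"
proof -
  have eq: "{z \<in> net r. x \<in> Q z (4 * K * r)} = {z \<in> net r. rho x z < 4 * K * r}"
    using net_space[OF assms(1)] assms(2) rho_sym by (auto simp: qball_def)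
  show "finite {z \<in> net r. x \<in> Q z (4 * K * r)}" "card {z \<in> net r. x \<in> Q z (4 * K * r)} \<le> overlap_const"
    unfolding eq overlap_const_def using K_ge_1
    by (simp_all add: separated_card[OF net(1)[OF assms(1)] assms _ le_two_power_nat_ceiling])
qed

lemma V_compare_overlap:
  assumes "x \<in> space M" "z \<in> space M" "0 < r" "rho z x \<le> 4 * K * r"
  shows "V x (4 * K * r) \<le> overlap_const * V z r"
  unfolding overlap_const_def
proof (rule V_compare)
  have "K * (rho z x + 4 * K * r) \<le> K * (4 * K * r + 4 * K * r)"
    using assms K_ge_1 by (intro mult_left_mono) auto
  also have "\<dots> = 8 * K\<^sup>2 * r" by (simp add: power2_eq_square)
  also have "\<dots> \<le> 2 * K * (K * (4 * K + K * (4 * K + 1))) * r"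
  proof (rule mult_right_mono)
    have "0 \<le> K * (4 * K + 1)" using K_ge_1 by simp
    then have "4 \<le> 4 * K + K * (4 * K + 1)" using K_ge_1 by linarith
    then have "2 * K\<^sup>2 * 4 \<le> 2 * K\<^sup>2 * (4 * K + K * (4 * K + 1))"
      by (intro mult_left_mono) auto
    then show "8 * K\<^sup>2 \<le> 2 * K * (K * (4 * K + K * (4 * K + 1)))" by (simp add: power2_eq_square mult.assoc)
  qed (use assms in auto)
  also have "\<dots> \<le> 2 ^ nat \<lceil>2 * K * (K * (4 * K + K * (4 * K + 1)))\<rceil> * r"
    using assms by (intro mult_right_mono le_two_power_nat_ceiling) auto
  finally show "K * (rho z x + 4 * K * r) \<le> 2 ^ nat \<lceil>2 * K * (K * (4 * K + K * (4 * K + 1)))\<rceil> * r" .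
qed (use assms in auto)

end

section \<open>A measurable kernel dominating the weight at distance at least one\<close>

lemma suminf_geometric_powr:
  assumes "1 < b" "0 < \<sigma>"
  shows "(\<Sum>k. ennreal (b powr (- (real k * \<sigma>)))) = ennreal (1 / (1 - b powr (- \<sigma>)))"
    "1 / (\<sigma> * ln b) \<le> 1 / (1 - b powr (- \<sigma>))"
    "1 / (1 - b powr (- \<sigma>)) \<le> b powr \<sigma> / (\<sigma> * ln b)"
proof -
  define t where "t = \<sigma> * ln b"
  have t: "0 < t" using assms by (simp add: t_def)
  have e: "b powr (- \<sigma>) = exp (- t)" "b powr \<sigma> = exp t"
    using assms by (simp_all add: powr_def t_def)
  have pw: "b powr (- (real k * \<sigma>)) = exp (- t) ^ k" for k
    using assms by (simp add: powr_def t_def exp_of_nat_mult[symmetric] algebra_simps)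
  have "(\<lambda>k. exp (- t) ^ k) sums (1 / (1 - exp (- t)))"
    using t by (intro geometric_sums) auto
  then show "(\<Sum>k. ennreal (b powr (- (real k * \<sigma>)))) = ennreal (1 / (1 - b powr (- \<sigma>)))"
    unfolding pw e by (intro suminf_ennreal_eq) auto
  have pos: "0 < 1 - exp (- t)" using t by simp
  have "1 - exp (- t) \<le> t" using exp_ge_add_one_self[of "- t"] by simp
  then show "1 / (\<sigma> * ln b) \<le> 1 / (1 - b powr (- \<sigma>))"
    unfolding e t_def[symmetric] using pos by (intro divide_left_mono) auto
  have "exp (- t) * t \<le> exp (- t) * (exp t - 1)"
  proof (rule mult_left_mono)
    show "t \<le> exp t - 1" using exp_ge_add_one_self[of t] by linarith
  qed simp
  also have "\<dots> = 1 - exp (- t)" by (simp add: right_diff_distrib flip: exp_add)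
  finally have "1 / (1 - exp (- t)) \<le> 1 / (exp (- t) * t)"
    using pos t by (intro divide_left_mono) auto
  also have "\<dots> = exp t / t" by (simp add: exp_minus field_simps)
  finally show "1 / (1 - b powr (- \<sigma>)) \<le> b powr \<sigma> / (\<sigma> * ln b)"
    unfolding e t_def[symmetric] .
qed

context doubling_space
begin

text \<open>
  Integration against \<open>cover_ker r x\<close> adds up the averages over those balls of radius \<open>4 K r\<close>, centred in the
  net, which contain \<open>x\<close>. The radius is chosen such that any two points at distance
  less than \<open>2 r\<close> lie in a common ball of this family.
\<close>

definition cover_ker :: "real \<Rightarrow> 'a \<Rightarrow> 'a \<Rightarrow> ennreal" where
  "cover_ker r x y = (\<integral>\<^sup>+z. indicator (Q z (4 * K * r)) x * indicator (Q z (4 * K * r)) y *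
      ennreal (1 / V z (4 * K * r)) \<partial>count_space (net r))"

definition far_ker :: "real \<Rightarrow> 'a \<Rightarrow> 'a \<Rightarrow> ennreal" where
  "far_ker \<sigma> x y = (\<Sum>k. ennreal (2 powr (- (real k * \<sigma>))) * cover_ker (2 ^ k) x y)"

lemma cover_ker_sym: "cover_ker r x y = cover_ker r y x"
  unfolding cover_ker_def by (simp add: mult_ac)

lemma far_ker_sym: "far_ker \<sigma> x y = far_ker \<sigma> y x"
  unfolding far_ker_def by (simp add: cover_ker_sym)

lemma cover_ker_measurable:
  assumes "0 < r"
  shows "case_prod (cover_ker r) \<in> borel_measurable (M \<Otimes>\<^sub>M M)"
proof -
  have [measurable]: "Q z (4 * K * r) \<in> sets M" if "z \<in> net r" for z
    using net_space[OF assms that] by (rule Q_sets)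
  show ?thesis
    unfolding cover_ker_def split_beta'
    by (intro borel_measurable_nn_integral_count_space countable_net assms) measurable
qed

lemma far_ker_measurable [measurable]: "case_prod (far_ker \<sigma>) \<in> borel_measurable (M \<Otimes>\<^sub>M M)"
proof -
  have [measurable]: "case_prod (cover_ker (2 ^ k)) \<in> borel_measurable (M \<Otimes>\<^sub>M M)" for k
    by (rule cover_ker_measurable) simp
  have "(\<lambda>p. \<Sum>k. ennreal (2 powr (- (real k * \<sigma>))) * case_prod (cover_ker (2 ^ k)) p)
      \<in> borel_measurable (M \<Otimes>\<^sub>M M)"
    by measurable
  then show ?thesis by (simp add: far_ker_def split_beta')
qed

lemma qU_eq:
  assumes "x \<in> space M" "y \<in> space M" "x \<noteq> y"
  shows "qU M rho x y = ennreal (min (V x (rho x y)) (V y (rho x y)))"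
    "0 < min (V x (rho x y)) (V y (rho x y))"
proof -
  have "0 < rho x y" using assms rho_nonneg[of x y] rho_eq_0_iff[of x y] by auto
  then show "0 < min (V x (rho x y)) (V y (rho x y))"
    using assms V_pos by simp
  show "qU M rho x y = ennreal (min (V x (rho x y)) (V y (rho x y)))"
    using assms \<open>0 < rho x y\<close> V_pos[of x "rho x y"] V_pos[of y "rho x y"]
    by (simp add: qU_def emeasure_Q min_def)
qed

lemma inverse_U_powr:
  assumes "x \<in> space M" "y \<in> space M" "x \<noteq> y"
  shows "inverse (qU M rho x y * ennreal (rho x y powr \<sigma>)) =
    ennreal (rho x y powr (- \<sigma>)) * ennreal (1 / min (V x (rho x y)) (V y (rho x y)))"
proof -
  have "rho x y \<noteq> 0" using assms rho_eq_0_iff by simp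
  then have "0 < rho x y powr \<sigma>" by simp
  moreover have "inverse (ennreal a * ennreal b) = ennreal (1 / b) * ennreal (1 / a)"
    if "0 < a" "0 < b" for a b
    using that by (simp add: ennreal_inverse_mult inverse_ennreal inverse_eq_divide mult.commute)
  ultimately show ?thesis
    using qU_eq[OF assms] by (simp only: powr_minus inverse_eq_divide)
qed

text \<open>
  A net point \<open>z\<close> within distance \<open>r\<close> of \<open>x\<close> has a ball containing both \<open>x\<close> and \<open>y\<close>, and by doubling the
  measure of this ball is at most a constant times the measure of the balls of radius \<open>r\<close>
  around \<open>x\<close> and around \<open>y\<close>.
\<close>

lemma inverse_U_le_cover_ker:
  assumes x: "x \<in> space M" and y: "y \<in> space M" and r: "0 < r" "r \<le> rho x y" "rho x y < 2 * r"
  shows "ennreal (1 / min (V x (rho x y)) (V y (rho x y))) \<le> ennreal overlap_const * cover_ker r x y"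
proof -
  obtain z where z: "z \<in> net r" "rho x z < r" using net(2)[OF r(1) x] by auto
  have zs: "z \<in> space M" using net_space[OF r(1) z(1)] .
  have "r < 4 * K * r" using K_ge_1 r by simp
  then have xz4: "rho x z \<le> 4 * K * r" using z by linarith
  have zx: "rho z x < r" using z rho_sym[OF zs x] by simp
  then have zx4: "rho z x < 4 * K * r" using \<open>r < 4 * K * r\<close> by linarith
  have "rho z y \<le> K * (rho z x + rho x y)" using x y zs by (intro rho_triangle)
  also have "\<dots> \<le> K * (r + 2 * r)" using zx r K_ge_1 by (intro mult_left_mono) auto
  also have "\<dots> = 3 * (K * r)" by simp
  also have "\<dots> < 4 * (K * r)" using K_ge_1 r by simp
  finally have zy: "rho z y < 4 * K * r" by simp
  have mem: "x \<in> Q z (4 * K * r)" "y \<in> Q z (4 * K * r)"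
    using x y zx4 zy by (simp_all add: qball_def)
  have U: "V z (4 * K * r) \<le> overlap_const * min (V x (rho x y)) (V y (rho x y))"
  proof -
    have "V z (4 * K * r) \<le> overlap_const * V x r"
      using x zs r xz4 by (intro V_compare_overlap)
    moreover have "V z (4 * K * r) \<le> overlap_const * V y r"
      using y zs r zy rho_sym[OF y zs] by (intro V_compare_overlap) simp_all
    moreover have "V x r \<le> V x (rho x y)" "V y r \<le> V y (rho x y)"
      using x y r by (auto intro!: V_mono simp: qball_def)
    ultimately show ?thesis
      using overlap_const_ge_1 by (auto simp: min_def intro: order.trans[OF _ mult_left_mono])
  qed
  have pos: "0 < V z (4 * K * r)" using zs K_ge_1 r by (intro V_pos) auto
  have xy: "x \<noteq> y" using r rho_eq_0_iff[OF x y] by auto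
  have "1 / min (V x (rho x y)) (V y (rho x y)) \<le> overlap_const * (1 / V z (4 * K * r))"
    using U pos qU_eq(2)[OF x y xy] by (simp add: field_simps)
  then have "ennreal (1 / min (V x (rho x y)) (V y (rho x y))) \<le> ennreal overlap_const * ennreal (1 / V z (4 * K * r))"
    using overlap_const_ge_1 pos by (simp add: ennreal_leI flip: ennreal_mult)
  also have "\<dots> \<le> ennreal overlap_const * cover_ker r x y"
  proof (rule mult_left_mono)
    show "ennreal (1 / V z (4 * K * r)) \<le> cover_ker r x y"
      unfolding cover_ker_def using mem z(1)
      by (intro order.trans[OF _ nn_integral_ge_point[of z]]) auto
  qed simp
  finally show ?thesis .
qed

lemma inverse_U_powr_le_far_ker:
  assumes x: "x \<in> space M" and y: "y \<in> space M" and "1 \<le> rho x y" "0 \<le> \<sigma>"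
  shows "inverse (qU M rho x y * ennreal (rho x y powr \<sigma>)) \<le> ennreal overlap_const * far_ker \<sigma> x y"
proof -
  define k where "k = nat \<lfloor>log 2 (rho x y)\<rfloor>"
  have "0 \<le> log 2 (rho x y)" using assms by (simp add: zero_le_log_cancel_iff)
  then have k: "real k \<le> log 2 (rho x y)" "log 2 (rho x y) < real k + 1"
    unfolding k_def by linarith+
  have lo: "2 ^ k \<le> rho x y" using k(1) assms by (simp add: le_log_iff powr_realpow)
  have hi: "rho x y < 2 * 2 ^ k" using k(2) assms by (simp add: log_less_iff powr_add powr_realpow)
  let ?m = "min (V x (rho x y)) (V y (rho x y))"
  have xy: "x \<noteq> y" using assms rho_eq_0_iff[OF x y] by auto
  have "rho x y powr (- \<sigma>) \<le> (2 ^ k) powr (- \<sigma>)" using lo assms by (intro powr_mono2') auto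
  also have "\<dots> = 2 powr (- (real k * \<sigma>))" by (simp add: powr_powr flip: powr_realpow)
  finally have 1: "rho x y powr (- \<sigma>) \<le> 2 powr (- (real k * \<sigma>))" .
  have "inverse (qU M rho x y * ennreal (rho x y powr \<sigma>)) = ennreal (rho x y powr (- \<sigma>)) * ennreal (1 / ?m)"
    by (rule inverse_U_powr[OF x y xy])
  also have "\<dots> \<le> ennreal (2 powr (- (real k * \<sigma>))) * (ennreal overlap_const * cover_ker (2 ^ k) x y)"
    using 1 lo hi x y by (intro mult_mono ennreal_leI inverse_U_le_cover_ker) auto
  also have "\<dots> = ennreal overlap_const * (ennreal (2 powr (- (real k * \<sigma>))) * cover_ker (2 ^ k) x y)"
    by (simp add: mult_ac)
  also have "\<dots> \<le> ennreal overlap_const * far_ker \<sigma> x y"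
    unfolding far_ker_def
    using sum_le_suminf[of "\<lambda>k. ennreal (2 powr (- (real k * \<sigma>))) * cover_ker (2 ^ k) x y" "{k}"]
    by (intro mult_left_mono) auto
  finally show ?thesis .
qed

lemma nn_integral_cover_ker_le:
  assumes r: "0 < r" and x: "x \<in> space M" and [measurable]: "\<phi> \<in> borel_measurable M"
    and avg: "\<And>z. z \<in> space M \<Longrightarrow> x \<in> Q z (4 * K * r) \<Longrightarrow>
      (\<integral>\<^sup>+y\<in>Q z (4 * K * r). \<phi> y \<partial>M) \<le> A * emeasure M (Q z (4 * K * r))"
  shows "(\<integral>\<^sup>+y. cover_ker r x y * \<phi> y \<partial>M) \<le> ennreal overlap_const * A"
proof -
  let ?R = "4 * K * r"
  have R: "0 < ?R" using K_ge_1 r by simp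
  have [measurable]: "Q z ?R \<in> sets M" if "z \<in> net r" for z
    using net_space[OF r that] by (rule Q_sets)
  let ?F = "{z \<in> net r. x \<in> Q z ?R}"
  have "(\<integral>\<^sup>+y. cover_ker r x y * \<phi> y \<partial>M) =
      (\<integral>\<^sup>+y. \<integral>\<^sup>+z. indicator (Q z ?R) x * ennreal (1 / V z ?R) * (\<phi> y * indicator (Q z ?R) y) \<partial>count_space (net r) \<partial>M)"
    unfolding cover_ker_def by (subst nn_integral_multc[symmetric]) (auto simp: mult_ac)
  also have "\<dots> = (\<integral>\<^sup>+z. \<integral>\<^sup>+y. indicator (Q z ?R) x * ennreal (1 / V z ?R) * (\<phi> y * indicator (Q z ?R) y) \<partial>M \<partial>count_space (net r))"
    using countable_net[OF r] by (intro nn_integral_count_space_nn_integral) auto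
  also have "\<dots> = (\<integral>\<^sup>+z. indicator (Q z ?R) x * ennreal (1 / V z ?R) * (\<integral>\<^sup>+y\<in>Q z ?R. \<phi> y \<partial>M) \<partial>count_space (net r))"
    by (intro nn_integral_cong nn_integral_cmult) auto
  also have "\<dots> \<le> (\<integral>\<^sup>+z. A * indicator ?F z \<partial>count_space (net r))"
  proof (intro nn_integral_mono)
    fix z assume "z \<in> space (count_space (net r))"
    then have z: "z \<in> net r" "z \<in> space M" using net_space[OF r] by auto
    show "indicator (Q z ?R) x * ennreal (1 / V z ?R) * (\<integral>\<^sup>+y\<in>Q z ?R. \<phi> y \<partial>M) \<le> A * indicator ?F z"
    proof (cases "x \<in> Q z ?R")
      case True
      have "ennreal (1 / V z ?R) * (\<integral>\<^sup>+y\<in>Q z ?R. \<phi> y \<partial>M) \<le> ennreal (1 / V z ?R) * (A * emeasure M (Q z ?R))"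
        by (intro mult_left_mono avg z True) simp
      also have "\<dots> = A"
        using V_pos[OF z(2) R] by (simp add: emeasure_Q[OF z(2) R] mult.left_commute flip: ennreal_mult)
      finally show ?thesis using True z by simp
    qed simp
  qed
  also have "\<dots> = A * of_nat (card ?F)"
  proof -
    have "(\<integral>\<^sup>+z. A * indicator ?F z \<partial>count_space (net r)) = A * emeasure (count_space (net r)) ?F"
      by (intro nn_integral_cmult_indicator) auto
    then show ?thesis using net_overlap(1)[OF r x] by (simp add: emeasure_count_space_finite)
  qed
  also have "\<dots> \<le> ennreal overlap_const * A"
  proof -
    have "of_nat (card ?F) \<le> ennreal overlap_const"
      using net_overlap(2)[OF r x] by (metis ennreal_leI ennreal_of_nat_eq_real_of_nat)
    then show ?thesis by (metis mult.commute mult_right_mono zero_le)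
  qed
  finally show ?thesis .
qed

text \<open>
  The overlap bound times a bound, uniform for \<open>s\<close> between \<open>0\<close> and \<open>1\<close>, of \<open>s\<close> times the sum of the geometric series
  with ratio \<open>2 powr (- s q)\<close>.
\<close>

definition far_const :: "real \<Rightarrow> real" where
  "far_const q = overlap_const * (2 powr q / (q * ln 2))"

lemma far_const_pos: "0 < q \<Longrightarrow> 0 < far_const q"
  unfolding far_const_def using overlap_const_ge_1 by simp

text \<open>
  If every ball containing \<open>x\<close> has average at most \<open>A\<close>, the scale \<open>2 ^ k\<close> contributes at most
  \<open>overlap_const * A\<close> times \<open>2 powr (- k s q)\<close>. This is used with the maximal function and with \<open>A = 1\<close>.
\<close>

lemma nn_integral_far_ker_le:
  assumes s: "0 < s" "s < 1" and "0 < q" and x: "x \<in> space M" and [measurable]: "\<phi> \<in> borel_measurable M"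
    and avg: "\<And>z r. z \<in> space M \<Longrightarrow> 0 < r \<Longrightarrow> x \<in> Q z r \<Longrightarrow>
      (\<integral>\<^sup>+y\<in>Q z r. \<phi> y \<partial>M) \<le> A * emeasure M (Q z r)"
  shows "ennreal s * (\<integral>\<^sup>+y. far_ker (s * q) x y * \<phi> y \<partial>M) \<le> ennreal (far_const q) * A"
proof -
  have [measurable]: "(\<lambda>y. cover_ker (2 ^ k) x y) \<in> borel_measurable M" for k
    using cover_ker_measurable[of "2 ^ k"] x by simp
  have "(\<integral>\<^sup>+y. far_ker (s * q) x y * \<phi> y \<partial>M) =
      (\<integral>\<^sup>+y. (\<Sum>k. ennreal (2 powr (- (real k * (s * q)))) * (cover_ker (2 ^ k) x y * \<phi> y)) \<partial>M)"
    unfolding far_ker_def by (simp add: ennreal_suminf_multc[symmetric] mult.assoc)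
  also have "\<dots> = (\<Sum>k. \<integral>\<^sup>+y. ennreal (2 powr (- (real k * (s * q)))) * (cover_ker (2 ^ k) x y * \<phi> y) \<partial>M)"
    by (intro nn_integral_suminf) measurable
  also have "\<dots> = (\<Sum>k. ennreal (2 powr (- (real k * (s * q)))) * (\<integral>\<^sup>+y. cover_ker (2 ^ k) x y * \<phi> y \<partial>M))"
    by (intro suminf_cong nn_integral_cmult) measurable
  also have "\<dots> \<le> (\<Sum>k. ennreal (2 powr (- (real k * (s * q)))) * (ennreal overlap_const * A))"
    using K_ge_1 by (intro suminf_le mult_left_mono nn_integral_cover_ker_le x avg) auto
  also have "\<dots> = (\<Sum>k. ennreal (2 powr (- (real k * (s * q))))) * (ennreal overlap_const * A)"
    by (rule ennreal_suminf_multc)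
  also have "\<dots> = ennreal (1 / (1 - 2 powr (- (s * q)))) * (ennreal overlap_const * A)"
    using s \<open>0 < q\<close> by (subst suminf_geometric_powr) auto
  finally have "ennreal s * (\<integral>\<^sup>+y. far_ker (s * q) x y * \<phi> y \<partial>M) \<le>
      ennreal s * (ennreal (1 / (1 - 2 powr (- (s * q)))) * (ennreal overlap_const * A))"
    by (rule mult_left_mono) simp
  also have "\<dots> = ennreal (s * (1 / (1 - 2 powr (- (s * q)))) * overlap_const) * A"
  proof -
    define a where "a = 1 / (1 - 2 powr (- (s * q)))"
    have "0 \<le> 1 / (s * q * ln 2)" using s \<open>0 < q\<close> by simp
    also have "\<dots> \<le> a" unfolding a_def using s \<open>0 < q\<close> by (intro suminf_geometric_powr) auto
    finally show ?thesis
      unfolding a_def[symmetric] using s overlap_const_ge_1 by (simp add: ennreal_mult mult.assoc)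
  qed
  also have "\<dots> \<le> ennreal (far_const q) * A"
  proof (intro mult_right_mono ennreal_leI)
    have "s * (1 / (1 - 2 powr (- (s * q)))) \<le> s * (2 powr (s * q) / (s * q * ln 2))"
      using s \<open>0 < q\<close> by (intro mult_left_mono suminf_geometric_powr) auto
    also have "\<dots> = 2 powr (s * q) / (q * ln 2)" using s by simp
    also have "\<dots> \<le> 2 powr q / (q * ln 2)"
      using s \<open>0 < q\<close> by (intro divide_right_mono powr_mono) auto
    finally show "s * (1 / (1 - 2 powr (- (s * q)))) * overlap_const \<le> far_const q"
      unfolding far_const_def using overlap_const_ge_1 by (subst mult.commute) (intro mult_left_mono; simp)
  qed simp
  finally show ?thesis .
qed

lemma qball_sequence:
  assumes "x0 \<in> space M"
  defines "B \<equiv> \<lambda>k. Q x0 (real (Suc k))"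
  shows "B k \<in> sets M" "emeasure M (B k) < \<infinity>" "B k \<in> qballs M rho" "incseq B" "space M \<subseteq> (\<Union>k. B k)"
proof -
  show "B k \<in> sets M" "emeasure M (B k) < \<infinity>"
    using assms(1) emeasure_Q_finite[of x0 "real (Suc k)"] by (auto simp: B_def)
  have "0 < real (Suc k)" by simp
  then show "B k \<in> qballs M rho" unfolding B_def qballs_def using assms(1) by blast
  show "incseq B" by (intro incseq_SucI) (auto simp: B_def qball_def)
  show "space M \<subseteq> (\<Union>k. B k)"
  proof
    fix x assume "x \<in> space M"
    moreover obtain n :: nat where "rho x0 x < n" using reals_Archimedean2 by blast
    ultimately have "x \<in> B n" by (auto simp: B_def qball_def)
    then show "x \<in> (\<Union>k. B k)" by auto
  qed
qed

lemma sigma_finite: "sigma_finite_measure M"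
proof
  obtain x0 where x0: "x0 \<in> space M" using space_ne by auto
  show "\<exists>A. countable A \<and> A \<subseteq> sets M \<and> \<Union>A = space M \<and> (\<forall>a\<in>A. emeasure M a \<noteq> \<infinity>)"
  proof (intro exI conjI)
    let ?A = "range (\<lambda>k. Q x0 (real (Suc k)))"
    show "countable ?A" "?A \<subseteq> sets M" "\<forall>a\<in>?A. emeasure M a \<noteq> \<infinity>"
      using qball_sequence[OF x0] by (auto simp: top.not_eq_extremum)
    show "\<Union>?A = space M" using qball_sequence(5)[OF x0] by (auto simp: qball_def)
  qed
qed

sublocale sigma_finite_measure M by (rule sigma_finite)
sublocale pair_sigma_finite M M by standard

section \<open>Boundedness of the averaging operator\<close>

definition far_op :: "real \<Rightarrow> ('a \<Rightarrow> ennreal) \<Rightarrow> 'a \<Rightarrow> ennreal" where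
  "far_op \<sigma> \<phi> x = (\<integral>\<^sup>+y. far_ker \<sigma> x y * \<phi> y \<partial>M)"

lemma far_op_measurable [measurable]:
  assumes [measurable]: "\<phi> \<in> borel_measurable M"
  shows "far_op \<sigma> \<phi> \<in> borel_measurable M"
  unfolding far_op_def by measurable

lemma far_op_symmetric:
  assumes [measurable]: "\<phi> \<in> borel_measurable M" "\<psi> \<in> borel_measurable M"
  shows "(\<integral>\<^sup>+x. far_op \<sigma> \<phi> x * \<psi> x \<partial>M) = (\<integral>\<^sup>+y. \<phi> y * far_op \<sigma> \<psi> y \<partial>M)"
proof -
  have [measurable]: "(\<lambda>y. far_ker \<sigma> x y) \<in> borel_measurable M" if "x \<in> space M" for x
    using far_ker_measurable[of \<sigma>] that by simp
  have "(\<integral>\<^sup>+x. far_op \<sigma> \<phi> x * \<psi> x \<partial>M) = (\<integral>\<^sup>+x. \<integral>\<^sup>+y. far_ker \<sigma> x y * \<phi> y * \<psi> x \<partial>M \<partial>M)"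
    unfolding far_op_def by (intro nn_integral_cong nn_integral_multc[symmetric]) measurable
  also have "\<dots> = (\<integral>\<^sup>+y. \<integral>\<^sup>+x. far_ker \<sigma> x y * \<phi> y * \<psi> x \<partial>M \<partial>M)"
    by (rule Fubini'[symmetric]) measurable
  also have "\<dots> = (\<integral>\<^sup>+y. \<integral>\<^sup>+x. \<phi> y * (far_ker \<sigma> y x * \<psi> x) \<partial>M \<partial>M)"
    by (intro nn_integral_cong) (simp add: far_ker_sym mult_ac)
  also have "\<dots> = (\<integral>\<^sup>+y. \<phi> y * far_op \<sigma> \<psi> y \<partial>M)"
    unfolding far_op_def by (intro nn_integral_cong nn_integral_cmult) measurable
  finally show ?thesis .
qed

end

lemma ext_norm_scale_eq:
  assumes N: "ball_quasi_Banach M rho N" and c: "0 < c"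
  shows "ext_norm M N (\<lambda>x. ennreal c * G x) = ennreal c * ext_norm M N G"
proof (rule antisym[OF ext_norm_scale[OF N c]])
  have "(\<lambda>x. ennreal (1/c) * (ennreal c * G x)) = G"
    using c by (simp add: mult.assoc[symmetric] flip: ennreal_mult)
  then have "ext_norm M N G \<le> ennreal (1/c) * ext_norm M N (\<lambda>x. ennreal c * G x)"
    using ext_norm_scale[OF N, of "1/c" "\<lambda>x. ennreal c * G x"] c by simp
  then show "ennreal c * ext_norm M N G \<le> ext_norm M N (\<lambda>x. ennreal c * G x)"
    using c le_ennreal_mult_iff[of "1/c"] by simp
qed

lemma ext_norm_ennreal_cmod:
  assumes "ball_quasi_Banach M rho N" "f \<in> borel_measurable M"
  shows "ext_norm M N (\<lambda>x. ennreal (cmod (f x))) = N f"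
  using assms by (intro ext_norm_eq) auto

lemma power_norm_cmod_powr:
  assumes N: "ball_quasi_Banach M rho N" and [measurable]: "f \<in> borel_measurable M" and "0 < p"
  shows "power_norm N (1 / p) (\<lambda>x. complex_of_real (cmod (f x) powr p)) = epowr (N f) p"
proof -
  have "N (\<lambda>x. complex_of_real (cmod (f x))) = N f"
    by (rule ball_quasi_Banach_cong[OF N]) auto
  then show ?thesis using \<open>0 < p\<close> by (simp add: power_norm_def powr_powr)
qed

text \<open>
  A majorant \<open>v\<close> of \<open>u\<close> gives the majorant \<open>(cmod v) powr (1 / p)\<close> of the \<open>p\<close>-th root of \<open>u\<close>.
\<close>

lemma epowr_ext_norm_le:
  assumes "0 < p"
  shows "epowr (ext_norm M N (\<lambda>x. epowr (u x) (1 / p))) p \<le> ext_norm M (power_norm N (1 / p)) u"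
  unfolding ext_norm_def[of M "power_norm N (1 / p)"]
proof (rule INF_greatest)
  fix v assume "v \<in> {g \<in> borel_measurable M. AE x in M. u x \<le> ennreal (cmod (g x))}"
  then have [measurable]: "v \<in> borel_measurable M" and le: "AE x in M. u x \<le> ennreal (cmod (v x))" by auto
  have "ext_norm M N (\<lambda>x. epowr (u x) (1 / p)) \<le> N (\<lambda>x. complex_of_real (cmod (v x) powr (1 / p)))"
  proof (rule ext_norm_le)
    show "AE x in M. epowr (u x) (1 / p) \<le> ennreal (cmod (complex_of_real (cmod (v x) powr (1 / p))))"
      using le
    proof eventually_elim
      case (elim x)
      have "epowr (u x) (1 / p) \<le> epowr (ennreal (cmod (v x))) (1 / p)"
        using elim \<open>0 < p\<close> by (intro epowr_mono) auto
      then show ?case by simp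
    qed
  qed measurable
  then show "epowr (ext_norm M N (\<lambda>x. epowr (u x) (1 / p))) p \<le> power_norm N (1 / p) v"
    unfolding power_norm_def using \<open>0 < p\<close> by (auto intro: epowr_mono)
qed

lemma powr_le_powr_add:
  fixes a t :: real
  assumes "0 \<le> a" "0 < t" "0 < q" "q \<le> p"
  shows "a powr q \<le> t powr q + t powr (q - p) * a powr p"
proof (cases "a \<le> t")
  case True
  then have "a powr q \<le> t powr q" using assms by (intro powr_mono2) auto
  then show ?thesis by (simp add: add_increasing2)
next
  case False
  have "a powr q = a powr (q - p) * a powr p" using False assms by (simp flip: powr_add)
  also have "\<dots> \<le> t powr (q - p) * a powr p"
    using False assms by (intro mult_right_mono powr_mono2') auto
  finally show ?thesis by (simp add: add_increasing)
qed

text \<open>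
  Jensen's inequality with an unspecific constant: integrate \<open>a powr q \<le> t powr q + t powr (q - p) * a powr p\<close>
  and take for \<open>t\<close> the right-hand power mean, for which both terms have the order of its \<open>q\<close>-th power.
\<close>

lemma nn_integral_power_mean_le:
  fixes a :: "'a \<Rightarrow> real"
  assumes [measurable]: "\<kappa> \<in> borel_measurable M" "a \<in> borel_measurable M" and a: "\<And>x. 0 \<le> a x"
    and pq: "0 < q" "q \<le> p" and A: "0 \<le> A" "(\<integral>\<^sup>+y. \<kappa> y \<partial>M) \<le> ennreal A"
  shows "epowr (\<integral>\<^sup>+y. \<kappa> y * ennreal (a y powr q) \<partial>M) (1 / q)
    \<le> ennreal ((A + 1) powr (1 / q)) * epowr (\<integral>\<^sup>+y. \<kappa> y * ennreal (a y powr p) \<partial>M) (1 / p)"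
    (is "epowr ?I _ \<le> _ * epowr ?B _")
proof (cases "?B = top \<or> ?B = 0")
  case True
  then show ?thesis
  proof
    assume "?B = top"
    then show ?thesis using A by (simp add: ennreal_mult_top)
  next
    assume B0: "?B = 0"
    then have "AE y in M. \<kappa> y * ennreal (a y powr p) = 0"
      by (subst (asm) nn_integral_0_iff_AE) measurable
    then have "AE y in M. \<kappa> y * ennreal (a y powr q) = 0"
      by eventually_elim auto
    then have "?I = 0" by (subst nn_integral_0_iff_AE) measurable
    then show ?thesis by simp
  qed
next
  case False
  then obtain b where b: "?B = ennreal b" "0 < b" by (cases ?B) (auto simp: less_le)
  define t where "t = b powr (1 / p)"
  have t: "0 < t" using b by (simp add: t_def)
  have "?I \<le> (\<integral>\<^sup>+y. ennreal (t powr q) * \<kappa> y + ennreal (t powr (q - p)) * (\<kappa> y * ennreal (a y powr p)) \<partial>M)"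
  proof (rule nn_integral_mono)
    fix y
    have "\<kappa> y * ennreal (a y powr q) \<le> \<kappa> y * ennreal (t powr q + t powr (q - p) * a y powr p)"
      using powr_le_powr_add[OF a t pq] by (intro mult_left_mono ennreal_leI) auto
    also have "\<dots> = ennreal (t powr q) * \<kappa> y + ennreal (t powr (q - p)) * (\<kappa> y * ennreal (a y powr p))"
      by (simp add: ennreal_plus ennreal_mult distrib_left mult_ac)
    finally show "\<kappa> y * ennreal (a y powr q) \<le> \<dots>" .
  qed
  also have "\<dots> = ennreal (t powr q) * (\<integral>\<^sup>+y. \<kappa> y \<partial>M) + ennreal (t powr (q - p)) * ?B"
    by (simp add: nn_integral_add nn_integral_cmult)
  also have "\<dots> \<le> ennreal (t powr q) * ennreal A + ennreal (t powr (q - p)) * ennreal b"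
    using A b by (intro add_mono mult_left_mono) auto
  also have "\<dots> = ennreal (t powr q * A + t powr (q - p) * b)"
    using A b by (simp add: ennreal_mult ennreal_plus)
  also have "t powr q * A + t powr (q - p) * b = b powr (q / p) * (A + 1)"
  proof -
    have "t powr (q - p) * b = b powr ((q - p) / p) * b powr 1"
      using b by (simp add: t_def powr_powr)
    also have "\<dots> = b powr (q / p)"
      using pq unfolding powr_add[symmetric] by (simp add: field_simps)
    finally show ?thesis by (simp add: t_def powr_powr distrib_left)
  qed
  finally have "epowr ?I (1 / q) \<le> epowr (ennreal (b powr (q / p) * (A + 1))) (1 / q)"
    using pq by (intro epowr_mono) auto
  also have "\<dots> = ennreal ((A + 1) powr (1 / q)) * epowr ?B (1 / p)"
  proof -
    have "epowr (ennreal (b powr (q / p) * (A + 1))) (1 / q) = ennreal ((b powr (q / p) * (A + 1)) powr (1 / q))"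
      using A by (intro epowr_ennreal mult_nonneg_nonneg) auto
    also have "(b powr (q / p) * (A + 1)) powr (1 / q) = (A + 1) powr (1 / q) * b powr (1 / p)"
      using b A pq by (simp add: powr_mult powr_powr)
    finally show ?thesis using b by (simp add: ennreal_mult)
  qed
  finally show ?thesis .
qed

text \<open>
  For arbitrary \<open>f\<close> the integral is a lower integral, which in general is not subadditive in the
  integrand; it is subadditive for a splitting along a measurable set. This is how the
  Gagliardo integrand, possibly not measurable in the second variable, is cut at distance one.
\<close>

lemma nn_integral_split_le:
  assumes [measurable]: "B \<in> sets M"
  shows "(\<integral>\<^sup>+x. f x \<partial>M) \<le> (\<integral>\<^sup>+x\<in>B. f x \<partial>M) + (\<integral>\<^sup>+x\<in>space M - B. f x \<partial>M)"
  unfolding nn_integral_def[of M f]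
proof (rule SUP_least)
  fix g assume "g \<in> {g. simple_function M g \<and> g \<le> f}"
  then have g: "simple_function M g" "\<And>x. g x \<le> f x" by (auto simp: le_fun_def)
  have [measurable]: "g \<in> borel_measurable M" using g(1) by (rule borel_measurable_simple_function)
  have "integral\<^sup>S M g = (\<integral>\<^sup>+x. g x \<partial>M)" using nn_integral_eq_simple_integral[OF g(1)] by simp
  also have "\<dots> = (\<integral>\<^sup>+x. g x * indicator B x + g x * indicator (space M - B) x \<partial>M)"
    by (intro nn_integral_cong) (auto simp: indicator_def)
  also have "\<dots> = (\<integral>\<^sup>+x\<in>B. g x \<partial>M) + (\<integral>\<^sup>+x\<in>space M - B. g x \<partial>M)"
    by (intro nn_integral_add) measurable
  also have "\<dots> \<le> (\<integral>\<^sup>+x\<in>B. f x \<partial>M) + (\<integral>\<^sup>+x\<in>space M - B. f x \<partial>M)"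
    using g(2) by (intro add_mono nn_integral_mono mult_right_mono) auto
  finally show "integral\<^sup>S M g \<le> (\<integral>\<^sup>+x\<in>B. f x \<partial>M) + (\<integral>\<^sup>+x\<in>space M - B. f x \<partial>M)" .
qed

lemma powr_cmod_triangle:
  assumes "0 < q"
  shows "ennreal (cmod (a + b) powr q) \<le> ennreal (2 powr q) * (ennreal (cmod a powr q) + ennreal (cmod b powr q))"
proof -
  have "epowr (ennreal (cmod (a + b))) q \<le> epowr (ennreal (cmod a) + ennreal (cmod b)) q"
    using assms norm_triangle_ineq[of a b] by (intro epowr_mono) (auto simp flip: ennreal_plus intro: ennreal_leI)
  also have "\<dots> \<le> ennreal (2 powr q) * (epowr (ennreal (cmod a)) q + epowr (ennreal (cmod b)) q)"
    using assms by (intro epowr_add_le) auto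
  finally show ?thesis by simp
qed

context doubling_space
begin

lemma far_op_maximal:
  assumes s: "0 < s" "s < 1" and "0 < q" and x: "x \<in> space M" and [measurable]: "h \<in> borel_measurable M"
  shows "ennreal s * far_op (s * q) (\<lambda>y. ennreal (cmod (h y))) x \<le> ennreal (far_const q) * maximal_fun M rho h x"
  unfolding far_op_def
proof (rule nn_integral_far_ker_le[OF s \<open>0 < q\<close> x])
  fix z r assume z: "z \<in> space M" and r: "0 < r" and "x \<in> Q z r"
  then have "Q z r \<in> {B \<in> qballs M rho. x \<in> B}" by (auto simp: qballs_def)
  then have "(\<integral>\<^sup>+y\<in>Q z r. ennreal (cmod (h y)) \<partial>M) / emeasure M (Q z r) \<le> maximal_fun M rho h x"
    unfolding maximal_fun_def by (rule SUP_upper)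
  then have "(\<integral>\<^sup>+y\<in>Q z r. ennreal (cmod (h y)) \<partial>M) / emeasure M (Q z r) * emeasure M (Q z r)
      \<le> maximal_fun M rho h x * emeasure M (Q z r)"
    by (rule mult_right_mono) simp
  moreover have "emeasure M (Q z r) / emeasure M (Q z r) = 1"
    using V_pos[OF z r] by (simp add: emeasure_Q[OF z r] divide_ennreal)
  ultimately show "(\<integral>\<^sup>+y\<in>Q z r. ennreal (cmod (h y)) \<partial>M) \<le> maximal_fun M rho h x * emeasure M (Q z r)"
    by (simp add: ennreal_divide_times)
qed measurable

lemma far_op_one_le:
  assumes s: "0 < s" "s < 1" and "0 < q" and x: "x \<in> space M"
  shows "ennreal s * (\<integral>\<^sup>+y. far_ker (s * q) x y \<partial>M) \<le> ennreal (far_const q)"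
proof -
  have "ennreal s * (\<integral>\<^sup>+y. far_ker (s * q) x y * 1 \<partial>M) \<le> ennreal (far_const q) * 1"
    by (rule nn_integral_far_ker_le[OF s \<open>0 < q\<close> x]) (auto simp: Q_sets)
  then show ?thesis by simp
qed

text \<open>
  Symmetry moves the operator to the test function \<open>h\<close>, where the maximal function dominates it;
  Hoelder's inequality and the boundedness of the maximal operator on the associate space give the
  bound for the pairing with \<open>h\<close>, and duality turns it into a bound of the norm.
\<close>

lemma far_op_bounded:
  assumes Z: "ball_Banach M rho Z" and max: "maximal_bounded M rho (assoc_norm M Z)" and "0 < q"
  obtains C where "0 < C" "\<And>s w. 0 < s \<Longrightarrow> s < 1 \<Longrightarrow> w \<in> borel_measurable M \<Longrightarrow>
    ext_norm M Z (\<lambda>x. ennreal s * far_op (s * q) (\<lambda>y. ennreal (cmod (w y))) x) \<le> ennreal C * Z w"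
proof -
  have Z': "ball_quasi_Banach M rho Z" using Z by (simp add: ball_Banach_def)
  obtain C1 where C1: "0 < C1" "\<And>h. h \<in> fun_space M (assoc_norm M Z) \<Longrightarrow>
      ext_norm M (assoc_norm M Z) (maximal_fun M rho h) \<le> ennreal C1 * assoc_norm M Z h"
    using max unfolding maximal_bounded_def by auto
  obtain x0 where x0: "x0 \<in> space M" using space_ne by auto
  define A where "A = far_const q"
  have A: "0 < A" unfolding A_def using \<open>0 < q\<close> by (rule far_const_pos)
  have main: "ext_norm M Z (\<lambda>x. ennreal s * far_op (s * q) (\<lambda>y. ennreal (cmod (w y))) x) \<le> ennreal (A * C1) * Z w"
    if s: "0 < s" "s < 1" and w[measurable]: "w \<in> borel_measurable M" for s w
  proof (cases "Z w < \<infinity>")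
    case False
    then show ?thesis using A C1 by (simp add: not_less top_unique ennreal_mult_top)
  next
    case True
    let ?u = "\<lambda>x. ennreal s * far_op (s * q) (\<lambda>y. ennreal (cmod (w y))) x"
    have dual: "(\<integral>\<^sup>+x. ?u x * ennreal (cmod (h x)) \<partial>M) \<le> ennreal (A * C1) * Z w * assoc_norm M Z h"
      if h[measurable]: "h \<in> borel_measurable M" and hfin: "assoc_norm M Z h < \<infinity>" for h
    proof -
      let ?I = "\<integral>\<^sup>+x. ?u x * ennreal (cmod (h x)) \<partial>M"
      have "?I = (\<integral>\<^sup>+x. ennreal s * (far_op (s * q) (\<lambda>y. ennreal (cmod (w y))) x * ennreal (cmod (h x))) \<partial>M)"
        by (simp add: mult.assoc)
      also have "\<dots> = ennreal s * (\<integral>\<^sup>+x. far_op (s * q) (\<lambda>y. ennreal (cmod (w y))) x * ennreal (cmod (h x)) \<partial>M)"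
        by (intro nn_integral_cmult) measurable
      also have "\<dots> = ennreal s * (\<integral>\<^sup>+y. ennreal (cmod (w y)) * far_op (s * q) (\<lambda>y. ennreal (cmod (h y))) y \<partial>M)"
        by (subst far_op_symmetric) auto
      also have "\<dots> = (\<integral>\<^sup>+y. ennreal s * (ennreal (cmod (w y)) * far_op (s * q) (\<lambda>y. ennreal (cmod (h y))) y) \<partial>M)"
        by (intro nn_integral_cmult[symmetric]) measurable
      also have "\<dots> = (\<integral>\<^sup>+y. ennreal (cmod (w y)) * (ennreal s * far_op (s * q) (\<lambda>y. ennreal (cmod (h y))) y) \<partial>M)"
        by (simp add: mult.left_commute)
      finally have I: "?I = \<dots>" .
      have "?I \<le> ennreal A * Z w * assoc_norm M Z g"
        if g: "g \<in> borel_measurable M" "AE x in M. maximal_fun M rho h x \<le> ennreal (cmod (g x))" for g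
      proof -
        note [measurable] = g(1)
        have "?I \<le> (\<integral>\<^sup>+y. ennreal A * (ennreal (cmod (w y)) * ennreal (cmod (g y))) \<partial>M)"
          unfolding I
        proof (rule nn_integral_mono_AE)
          show "AE y in M. ennreal (cmod (w y)) * (ennreal s * far_op (s * q) (\<lambda>y. ennreal (cmod (h y))) y)
            \<le> ennreal A * (ennreal (cmod (w y)) * ennreal (cmod (g y)))"
            using g(2) AE_space
          proof eventually_elim
            case (elim y)
            have "ennreal s * far_op (s * q) (\<lambda>y. ennreal (cmod (h y))) y \<le> ennreal A * maximal_fun M rho h y"
              unfolding A_def using s \<open>0 < q\<close> elim(2) h by (intro far_op_maximal)
            also have "\<dots> \<le> ennreal A * ennreal (cmod (g y))"
              using elim(1) by (rule mult_left_mono) simp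
            finally have "ennreal (cmod (w y)) * (ennreal s * far_op (s * q) (\<lambda>y. ennreal (cmod (h y))) y)
              \<le> ennreal (cmod (w y)) * (ennreal A * ennreal (cmod (g y)))"
              by (rule mult_left_mono) simp
            then show ?case by (simp only: mult.left_commute)
          qed
        qed
        also have "\<dots> = ennreal A * (\<integral>\<^sup>+y. ennreal (cmod (w y)) * ennreal (cmod (g y)) \<partial>M)"
          by (intro nn_integral_cmult) measurable
        also have "\<dots> \<le> ennreal A * (Z w * assoc_norm M Z g)"
          using True by (intro mult_left_mono assoc_norm_Hoelder[OF Z'] w g) auto
        finally show ?thesis by (simp add: mult.assoc)
      qed
      moreover obtain z where z: "0 \<le> z" "Z w = ennreal z" using True by (cases "Z w") auto
      ultimately have le: "?I \<le> ennreal (A * z) * assoc_norm M Z g"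
        if "g \<in> borel_measurable M" "AE x in M. maximal_fun M rho h x \<le> ennreal (cmod (g x))" for g
        using that A by (simp add: ennreal_mult)
      have "?I \<le> ennreal (A * z) * ext_norm M (assoc_norm M Z) (maximal_fun M rho h)"
      proof (cases "z = 0")
        case True
        then have "AE x in M. w x = 0"
          using ball_quasi_Banach_eq_0_iff[OF Z' w] z by simp
        then have "(\<integral>\<^sup>+y. ennreal (cmod (w y)) * (ennreal s * far_op (s * q) (\<lambda>y. ennreal (cmod (h y))) y) \<partial>M)
          = (\<integral>\<^sup>+y. 0 \<partial>M)" by (intro nn_integral_cong_AE) (auto elim!: eventually_mono)
        then show ?thesis unfolding I by simp
      next
        case False
        then show ?thesis unfolding ext_norm_def using z A le by (intro le_ennreal_mult_INF) auto
      qed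
      also have "\<dots> \<le> ennreal (A * z) * (ennreal C1 * assoc_norm M Z h)"
        using h hfin by (intro mult_left_mono C1) (auto simp: fun_space_def)
      also have "\<dots> = ennreal (A * C1) * Z w * assoc_norm M Z h"
        using A C1 z by (simp add: ennreal_mult mult_ac)
      finally show ?thesis .
    qed
    show ?thesis
    \<comment> \<open>the duality lemma wants a positive bound, but \<open>Z w\<close> may vanish\<close>
    proof (rule ennreal_le_epsilon)
      fix e :: real assume "0 < e"
      obtain z where z: "0 \<le> z" "Z w = ennreal z" using True by (cases "Z w") auto
      have eq: "ennreal (A * C1) * Z w + ennreal e = ennreal (A * C1 * z + e)"
        using z A C1 \<open>0 < e\<close> by (simp add: ennreal_mult ennreal_plus)
      show "ext_norm M Z ?u \<le> ennreal (A * C1) * Z w + ennreal e"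
        unfolding eq
      proof (rule ext_norm_le_by_duality[OF Z qball_sequence[OF x0]])
        show "0 < A * C1 * z + e" using z A C1 \<open>0 < e\<close> by (simp add: add_nonneg_pos)
        fix h assume h: "h \<in> borel_measurable M" "assoc_norm M Z h < \<infinity>"
        have "(\<integral>\<^sup>+x. ?u x * ennreal (cmod (h x)) \<partial>M) \<le> ennreal (A * C1) * Z w * assoc_norm M Z h"
          by (rule dual[OF h])
        also have "\<dots> \<le> (ennreal (A * C1) * Z w + ennreal e) * assoc_norm M Z h"
          by (intro mult_right_mono) auto
        finally show "(\<integral>\<^sup>+x. ?u x * ennreal (cmod (h x)) \<partial>M) \<le> ennreal (A * C1 * z + e) * assoc_norm M Z h"
          unfolding eq .
      qed measurable
    qed
  qed
  show thesis
    by (rule that[OF _ main]) (use A C1 in auto)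
qed

text \<open>
  The bound on \<open>Z\<close> applied to the \<open>p\<close>-th power of the modulus of \<open>h\<close>; the power mean inequality replaces the exponent
  \<open>p\<close> by \<open>q\<close>, because \<open>s * far_ker\<close> has total mass at most \<open>far_const q\<close>.
\<close>

lemma far_op_power_bounded:
  assumes N: "ball_quasi_Banach M rho N" and pq: "0 < q" "q \<le> p"
    and Z: "ball_Banach M rho (power_norm N (1 / p))"
    and max: "maximal_bounded M rho (assoc_norm M (power_norm N (1 / p)))"
  obtains C where "0 < C" "\<And>s h. 0 < s \<Longrightarrow> s < 1 \<Longrightarrow> h \<in> borel_measurable M \<Longrightarrow>
    ext_norm M N (\<lambda>x. epowr (ennreal s * far_op (s * q) (\<lambda>y. ennreal (cmod (h y) powr q)) x) (1 / q)) \<le> ennreal C * N h"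
proof -
  obtain C1 where C1: "0 < C1" "\<And>s w. 0 < s \<Longrightarrow> s < 1 \<Longrightarrow> w \<in> borel_measurable M \<Longrightarrow>
    ext_norm M (power_norm N (1 / p)) (\<lambda>x. ennreal s * far_op (s * q) (\<lambda>y. ennreal (cmod (w y))) x)
      \<le> ennreal C1 * power_norm N (1 / p) w"
    using far_op_bounded[OF Z max pq(1)] by blast
  define A where "A = (far_const q + 1) powr (1 / q)"
  have A: "0 < A" unfolding A_def using far_const_pos[OF pq(1)] by simp
  have "ext_norm M N (\<lambda>x. epowr (ennreal s * far_op (s * q) (\<lambda>y. ennreal (cmod (h y) powr q)) x) (1 / q))
      \<le> ennreal (A * C1 powr (1 / p)) * N h"
    if s: "0 < s" "s < 1" and h[measurable]: "h \<in> borel_measurable M" for s h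
  proof -
    let ?u = "\<lambda>r x. ennreal s * far_op (s * q) (\<lambda>y. ennreal (cmod (h y) powr r)) x"
    have "epowr (?u q x) (1 / q) \<le> ennreal A * epowr (?u p x) (1 / p)" if x: "x \<in> space M" for x
    proof -
      have [measurable]: "(\<lambda>y. far_ker (s * q) x y) \<in> borel_measurable M"
        using far_ker_measurable[of "s * q"] x by simp
      have u: "?u r x = (\<integral>\<^sup>+y. (ennreal s * far_ker (s * q) x y) * ennreal (cmod (h y) powr r) \<partial>M)" for r
        unfolding far_op_def by (subst nn_integral_cmult[symmetric]) (auto simp: mult.assoc)
      show ?thesis
        unfolding u A_def
      proof (rule nn_integral_power_mean_le)
        show "(\<integral>\<^sup>+y. ennreal s * far_ker (s * q) x y \<partial>M) \<le> ennreal (far_const q)"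
          using far_op_one_le[OF s pq(1) x] by (subst nn_integral_cmult) auto
      qed (use pq far_const_pos[OF pq(1)] in auto)
    qed
    then have "ext_norm M N (\<lambda>x. epowr (?u q x) (1 / q)) \<le> ext_norm M N (\<lambda>x. ennreal A * epowr (?u p x) (1 / p))"
      by (intro ext_norm_mono) auto
    also have "\<dots> \<le> ennreal A * ext_norm M N (\<lambda>x. epowr (?u p x) (1 / p))" (is "_ \<le> _ * ?E")
      by (rule ext_norm_scale[OF N A])
    also have "?E \<le> ennreal (C1 powr (1 / p)) * N h"
    proof -
      have "epowr ?E p \<le> ext_norm M (power_norm N (1 / p)) (?u p)"
        using pq by (intro epowr_ext_norm_le) auto
      also have "\<dots> \<le> ennreal C1 * power_norm N (1 / p) (\<lambda>y. complex_of_real (cmod (h y) powr p))"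
        using C1(2)[OF s, of "\<lambda>y. complex_of_real (cmod (h y) powr p)"] by simp
      also have "\<dots> = ennreal C1 * epowr (N h) p"
        using pq by (subst power_norm_cmod_powr[OF N h]) auto
      finally have "epowr (epowr ?E p) (1 / p) \<le> epowr (ennreal C1 * epowr (N h) p) (1 / p)"
        using pq by (intro epowr_mono) auto
      then show ?thesis using pq C1 by (simp add: epowr_epowr epowr_mult)
    qed
    finally show ?thesis using A C1 by (simp add: ennreal_mult mult.assoc mult_left_mono)
  qed
  then show thesis using that[of "A * C1 powr (1 / p)"] A C1 by auto
qed

end

section \<open>The upper estimate\<close>

lemma epowr_add_mult_add_le:
  assumes "0 \<le> t"
  shows "epowr (a + m * (c + e)) t \<le>
    ennreal (2 powr t) * (epowr a t + epowr m t * (ennreal (2 powr t) * (epowr c t + epowr e t)))"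
proof -
  have "epowr (a + m * (c + e)) t \<le> ennreal (2 powr t) * (epowr a t + epowr m t * epowr (c + e) t)"
    using epowr_add_le[OF assms, of a "m * (c + e)"] by (simp add: epowr_mult)
  also have "\<dots> \<le> ennreal (2 powr t) * (epowr a t + epowr m t * (ennreal (2 powr t) * (epowr c t + epowr e t)))"
    by (intro mult_left_mono add_left_mono epowr_add_le assms) auto
  finally show ?thesis .
qed

context doubling_space
begin

text \<open>
  Near \<open>x\<close> the integrand grows with \<open>s\<close>; at distance at least one the weight is below \<open>far_ker\<close>, and
  \<open>\<bar>f x - f y\<bar> powr q\<close> is split.
\<close>

lemma frac_integral_upper:
  assumes s: "0 < s" "s \<le> s0" and "0 < q" and x: "x \<in> space M" and f[measurable]: "f \<in> borel_measurable M"
  shows "frac_integral M rho q s f x \<le> frac_integral M rho q s0 f x +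
    ennreal (2 powr q * overlap_const) * (ennreal (cmod (f x) powr q) * (\<integral>\<^sup>+y. far_ker (s * q) x y \<partial>M)
      + far_op (s * q) (\<lambda>y. ennreal (cmod (f y) powr q)) x)"
proof -
  define F where "F t y = (if y = x then 0 else ennreal (cmod (f x - f y) powr q) /
      (qU M rho x y * ennreal (rho x y powr (t * q))))" for t y
  have B[measurable]: "Q x 1 \<in> sets M" using x by (rule Q_sets)
  have [measurable]: "(\<lambda>y. far_ker (s * q) x y) \<in> borel_measurable M"
    using far_ker_measurable[of "s * q"] x by simp
  have "frac_integral M rho q s f x = (\<integral>\<^sup>+y. F s y \<partial>M)"
    by (simp add: frac_integral_def F_def)
  also have "\<dots> \<le> (\<integral>\<^sup>+y\<in>Q x 1. F s y \<partial>M) + (\<integral>\<^sup>+y\<in>space M - Q x 1. F s y \<partial>M)"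
    by (rule nn_integral_split_le) measurable
  also have "\<dots> \<le> frac_integral M rho q s0 f x + (\<integral>\<^sup>+y. ennreal (2 powr q * overlap_const) *
      (ennreal (cmod (f x) powr q) * far_ker (s * q) x y + far_ker (s * q) x y * ennreal (cmod (f y) powr q)) \<partial>M)"
  proof (rule add_mono)
    have "F s y * indicator (Q x 1) y \<le> F s0 y" if y: "y \<in> space M" for y
    proof (cases "y \<in> Q x 1 \<and> y \<noteq> x")
      case True
      then have "rho x y < 1" "0 < rho x y"
        using x y rho_nonneg[OF x y] rho_eq_0_iff[OF x y] by (auto simp: qball_def less_le)
      then have "rho x y powr (- (s * q)) \<le> rho x y powr (- (s0 * q))"
        using s \<open>0 < q\<close> by (intro powr_mono') (auto intro: mult_right_mono)
      then have "F s y \<le> F s0 y"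
        using True inverse_U_powr[OF x y]
        by (auto simp: F_def divide_ennreal_def intro!: mult_left_mono mult_right_mono ennreal_leI)
      then show ?thesis using True by simp
    qed (auto simp: F_def indicator_def)
    then show "(\<integral>\<^sup>+y\<in>Q x 1. F s y \<partial>M) \<le> frac_integral M rho q s0 f x"
      unfolding frac_integral_def F_def[symmetric] by (rule nn_integral_mono)
    have "F s y * indicator (space M - Q x 1) y \<le> ennreal (2 powr q * overlap_const) *
      (ennreal (cmod (f x) powr q) * far_ker (s * q) x y + far_ker (s * q) x y * ennreal (cmod (f y) powr q))"
      if y: "y \<in> space M" for y
    proof (cases "y \<in> Q x 1")
      case False
      then have rho: "1 \<le> rho x y" using y by (auto simp: qball_def)
      then have "y \<noteq> x" using rho_eq_0_iff[OF x y] by auto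
      then have "F s y = ennreal (cmod (f x - f y) powr q) * inverse (qU M rho x y * ennreal (rho x y powr (s * q)))"
        by (simp add: F_def divide_ennreal_def)
      also have "\<dots> \<le> (ennreal (2 powr q) * (ennreal (cmod (f x) powr q) + ennreal (cmod (f y) powr q))) *
          (ennreal overlap_const * far_ker (s * q) x y)"
        using powr_cmod_triangle[OF \<open>0 < q\<close>, of "f x" "- f y"] s \<open>0 < q\<close>
        by (intro mult_mono inverse_U_powr_le_far_ker x y rho) auto
      also have "\<dots> = ennreal (2 powr q * overlap_const) *
        (ennreal (cmod (f x) powr q) * far_ker (s * q) x y + far_ker (s * q) x y * ennreal (cmod (f y) powr q))"
        using overlap_const_ge_1 by (simp add: ennreal_mult distrib_left distrib_right mult_ac)
      finally show ?thesis using False y by simp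
    qed simp
    then show "(\<integral>\<^sup>+y\<in>space M - Q x 1. F s y \<partial>M) \<le> (\<integral>\<^sup>+y. ennreal (2 powr q * overlap_const) *
      (ennreal (cmod (f x) powr q) * far_ker (s * q) x y + far_ker (s * q) x y * ennreal (cmod (f y) powr q)) \<partial>M)"
      by (rule nn_integral_mono)
  qed
  also have "(\<integral>\<^sup>+y. ennreal (2 powr q * overlap_const) *
      (ennreal (cmod (f x) powr q) * far_ker (s * q) x y + far_ker (s * q) x y * ennreal (cmod (f y) powr q)) \<partial>M)
    = ennreal (2 powr q * overlap_const) * (ennreal (cmod (f x) powr q) * (\<integral>\<^sup>+y. far_ker (s * q) x y \<partial>M)
      + far_op (s * q) (\<lambda>y. ennreal (cmod (f y) powr q)) x)"
    unfolding far_op_def by (simp add: nn_integral_cmult nn_integral_add)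
  finally show ?thesis .
qed

text \<open>
  After multiplication by \<open>s powr (1 / q)\<close> the two far terms are bounded by \<open>N f\<close> uniformly in
  \<open>s\<close>, and the near term is \<open>s powr (1 / q)\<close> times the fixed finite seminorm at level \<open>s0\<close>.
\<close>

lemma Limsup_frac_seminorm_le:
  assumes N: "ball_quasi_Banach M rho N" and pq: "0 < q" "q \<le> p"
    and Z: "ball_Banach M rho (power_norm N (1 / p))"
    and max: "maximal_bounded M rho (assoc_norm M (power_norm N (1 / p)))"
  obtains C where "0 < C" "\<And>f s0. f \<in> borel_measurable M \<Longrightarrow> 0 < s0 \<Longrightarrow> s0 < 1 \<Longrightarrow>
    frac_seminorm M rho N q s0 f < \<infinity> \<Longrightarrow>
    Limsup (at_right 0) (\<lambda>s. ennreal (s powr (1 / q)) * frac_seminorm M rho N q s f) \<le> ennreal C * N f"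
proof -
  obtain C1 where C1: "0 < C1" "\<And>s h. 0 < s \<Longrightarrow> s < 1 \<Longrightarrow> h \<in> borel_measurable M \<Longrightarrow>
    ext_norm M N (\<lambda>x. epowr (ennreal s * far_op (s * q) (\<lambda>y. ennreal (cmod (h y) powr q)) x) (1 / q)) \<le> ennreal C1 * N h"
    using far_op_power_bounded[OF N pq Z max] by blast
  obtain K1 where K1: "1 \<le> K1"
    "\<And>G H. ext_norm M N (\<lambda>x. G x + H x) \<le> ennreal K1 * (ext_norm M N G + ext_norm M N H)"
    using ext_norm_triangle[OF N] by blast
  define b where "b = (2::real) powr (1 / q)"
  define d where "d = (2 powr q * overlap_const) powr (1 / q)"
  define A where "A = far_const q powr (1 / q)"
  have pos: "0 < b" "0 < d" "0 < A"
    using overlap_const_ge_1 far_const_pos[OF pq(1)] by (auto simp: b_def d_def A_def)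
  define C where "C = b * K1 * (d * (b * (K1 * (A + C1))))"
  have C: "0 < C" unfolding C_def using pos K1 C1 by simp
  have main: "Limsup (at_right 0) (\<lambda>s. ennreal (s powr (1 / q)) * frac_seminorm M rho N q s f) \<le> ennreal C * N f"
    if f[measurable]: "f \<in> borel_measurable M" and s0: "0 < s0" "s0 < 1" and fin: "frac_seminorm M rho N q s0 f < \<infinity>"
    for f s0
  proof -
    let ?W = "frac_seminorm M rho N q s0 f"
    have bound: "ennreal (s powr (1 / q)) * frac_seminorm M rho N q s f
        \<le> ennreal (b * K1) * (ennreal (s powr (1 / q)) * ?W) + ennreal C * N f" if s: "0 < s" "s < s0" for s
    proof -
      have s1: "s < 1" using s s0 by simp
      let ?g0 = "\<lambda>x. epowr (frac_integral M rho q s0 f x) (1 / q)"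
      let ?T = "\<lambda>x. epowr (ennreal s * far_op (s * q) (\<lambda>y. ennreal (cmod (f y) powr q)) x) (1 / q)"
      let ?H = "\<lambda>x. ennreal A * ennreal (cmod (f x)) + ?T x"
      let ?R = "\<lambda>x. ennreal b * (ennreal (s powr (1 / q)) * ?g0 x + ennreal d * (ennreal b * ?H x))"
      have pt: "ennreal (s powr (1 / q)) * epowr (frac_integral M rho q s f x) (1 / q) \<le> ?R x"
        if x: "x \<in> space M" for x
      proof -
        have "ennreal s * frac_integral M rho q s f x \<le> ennreal s * (frac_integral M rho q s0 f x +
          ennreal (2 powr q * overlap_const) * (ennreal (cmod (f x) powr q) * (\<integral>\<^sup>+y. far_ker (s * q) x y \<partial>M)
          + far_op (s * q) (\<lambda>y. ennreal (cmod (f y) powr q)) x))"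
          using s pq by (intro mult_left_mono frac_integral_upper x f) auto
        also have "\<dots> = ennreal s * frac_integral M rho q s0 f x + ennreal (2 powr q * overlap_const) *
          ((ennreal s * (\<integral>\<^sup>+y. far_ker (s * q) x y \<partial>M)) * ennreal (cmod (f x) powr q)
          + ennreal s * far_op (s * q) (\<lambda>y. ennreal (cmod (f y) powr q)) x)"
          by (simp add: distrib_left mult_ac)
        also have "\<dots> \<le> ennreal s * frac_integral M rho q s0 f x + ennreal (2 powr q * overlap_const) *
          (ennreal (far_const q) * ennreal (cmod (f x) powr q)
          + ennreal s * far_op (s * q) (\<lambda>y. ennreal (cmod (f y) powr q)) x)"
          using far_op_one_le[OF s(1) s1 pq(1) x]
          by (intro add_mono mult_left_mono mult_right_mono) auto
        finally have "epowr (ennreal s * frac_integral M rho q s f x) (1 / q) \<le> epowr \<dots> (1 / q)"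
          using pq by (intro epowr_mono) auto
        also have "\<dots> \<le> ennreal b * (epowr (ennreal s * frac_integral M rho q s0 f x) (1 / q) +
          epowr (ennreal (2 powr q * overlap_const)) (1 / q) *
            (ennreal b * (epowr (ennreal (far_const q) * ennreal (cmod (f x) powr q)) (1 / q) + ?T x)))"
          unfolding b_def using pq by (intro epowr_add_mult_add_le) auto
        also have "epowr (ennreal (2 powr q * overlap_const)) (1 / q) = ennreal d"
          unfolding d_def using overlap_const_ge_1 by (intro epowr_ennreal) auto
        also have "epowr (ennreal (far_const q) * ennreal (cmod (f x) powr q)) (1 / q) = ennreal A * ennreal (cmod (f x))"
          using pq far_const_pos[OF pq(1)] by (simp add: epowr_mult powr_powr A_def)
        also have "epowr (ennreal s * frac_integral M rho q s0 f x) (1 / q) = ennreal (s powr (1 / q)) * ?g0 x"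
          using s by (simp add: epowr_mult)
        finally show ?thesis using s by (simp add: epowr_mult)
      qed
      have "ennreal (s powr (1 / q)) * frac_seminorm M rho N q s f =
          ext_norm M N (\<lambda>x. ennreal (s powr (1 / q)) * epowr (frac_integral M rho q s f x) (1 / q))"
        unfolding frac_seminorm_def using s by (subst ext_norm_scale_eq[OF N]) auto
      also have "\<dots> \<le> ext_norm M N ?R"
        using pt by (intro ext_norm_mono) auto
      also have "\<dots> \<le> ennreal b * ext_norm M N (\<lambda>x. ennreal (s powr (1 / q)) * ?g0 x + ennreal d * (ennreal b * ?H x))"
        by (rule ext_norm_scale[OF N pos(1)])
      also have "\<dots> \<le> ennreal b * (ennreal K1 * (ennreal (s powr (1 / q)) * ?W
          + ennreal d * (ennreal b * (ennreal (K1 * (A + C1)) * N f))))"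
      proof (rule mult_left_mono)
        have "ext_norm M N ?H \<le> ennreal K1 * (ext_norm M N (\<lambda>x. ennreal A * ennreal (cmod (f x))) + ext_norm M N ?T)"
          by (rule K1)
        also have "\<dots> \<le> ennreal K1 * (ennreal A * N f + ennreal C1 * N f)"
        proof (intro mult_left_mono add_mono)
          show "ext_norm M N (\<lambda>x. ennreal A * ennreal (cmod (f x))) \<le> ennreal A * N f"
            using ext_norm_scale[OF N pos(3)] ext_norm_ennreal_cmod[OF N f] by metis
          show "ext_norm M N ?T \<le> ennreal C1 * N f" by (intro C1 s(1) s1 f)
        qed simp
        also have "\<dots> = ennreal (K1 * (A + C1)) * N f"
          using K1(1) C1(1) pos by (simp add: ennreal_mult ennreal_plus distrib_left distrib_right mult.assoc)
        finally have H: "ext_norm M N ?H \<le> ennreal (K1 * (A + C1)) * N f" .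
        have "ext_norm M N (\<lambda>x. ennreal (s powr (1 / q)) * ?g0 x + ennreal d * (ennreal b * ?H x))
          \<le> ennreal K1 * (ext_norm M N (\<lambda>x. ennreal (s powr (1 / q)) * ?g0 x) + ext_norm M N (\<lambda>x. ennreal d * (ennreal b * ?H x)))"
          by (rule K1)
        also have "\<dots> = ennreal K1 * (ennreal (s powr (1 / q)) * ?W + ennreal d * (ennreal b * ext_norm M N ?H))"
          using s by (simp add: frac_seminorm_def ext_norm_scale_eq[OF N] pos)
        also have "\<dots> \<le> ennreal K1 * (ennreal (s powr (1 / q)) * ?W + ennreal d * (ennreal b * (ennreal (K1 * (A + C1)) * N f)))"
          by (intro mult_left_mono add_mono H) auto
        finally show "ext_norm M N (\<lambda>x. ennreal (s powr (1 / q)) * ?g0 x + ennreal d * (ennreal b * ?H x)) \<le> \<dots>" .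
      qed simp
      also have "\<dots> = ennreal (b * K1) * (ennreal (s powr (1 / q)) * ?W) + ennreal C * N f"
      proof -
        define e where "e = K1 * (A + C1)"
        have "0 \<le> e" using K1(1) C1(1) pos by (simp add: e_def)
        then show ?thesis
          using K1(1) pos unfolding C_def e_def[symmetric]
          by (simp add: ennreal_mult distrib_left mult.assoc)
      qed
      finally show ?thesis .
    qed
    obtain w where w: "0 \<le> w" "?W = ennreal w" using fin by (cases ?W) auto
    let ?r = "\<lambda>s. ennreal (b * K1) * (ennreal (s powr (1 / q)) * ?W) + ennreal C * N f"
    have "((\<lambda>s::real. s powr (1 / q)) \<longlongrightarrow> 0) (at_right 0)"
    proof (rule tendsto_zero_powrI[where b = "1 / q"])
      show "\<forall>\<^sub>F s::real in at_right 0. 0 \<le> s"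
        using eventually_at_right_less[of "0::real"] by eventually_elim simp
    qed (use pq in \<open>auto intro!: tendsto_intros\<close>)
    then have "((\<lambda>s. b * K1 * (s powr (1 / q) * w)) \<longlongrightarrow> b * K1 * (0 * w)) (at_right 0)"
      by (intro tendsto_intros)
    then have "((\<lambda>s. ennreal (b * K1 * (s powr (1 / q) * w))) \<longlongrightarrow> ennreal (b * K1 * (0 * w))) (at_right 0)"
      by (rule tendsto_ennrealI)
    then have "((\<lambda>s. ennreal (b * K1) * (ennreal (s powr (1 / q)) * ?W)) \<longlongrightarrow> 0) (at_right 0)"
      using w pos K1 by (simp add: ennreal_mult)
    then have "(?r \<longlongrightarrow> 0 + ennreal C * N f) (at_right 0)"
      by (intro tendsto_add tendsto_const)
    then have "Limsup (at_right 0) ?r = ennreal C * N f"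
      by (intro lim_imp_Limsup) auto
    moreover have "Limsup (at_right 0) (\<lambda>s. ennreal (s powr (1 / q)) * frac_seminorm M rho N q s f) \<le> Limsup (at_right 0) ?r"
      using eventually_at_right_real[OF s0(1)] bound
      by (intro Limsup_mono) (auto elim!: eventually_mono)
    ultimately show ?thesis by simp
  qed
  show thesis by (rule that[OF C main])
qed

section \<open>The lower estimate\<close>

lemma reverse_doubling_eventually:
  assumes "weak_reverse_doubling M rho"
  obtains x0 l c R0 where "x0 \<in> space M" "1 < l" "1 < c"
    "\<And>r. R0 \<le> r \<Longrightarrow> 0 < r \<Longrightarrow> c * V x0 r \<le> V x0 (l * r)"
proof -
  obtain x0 l C where x0: "x0 \<in> space M" "1 < l" "1 < C"
    and lim: "ennreal C \<le> Liminf at_top (\<lambda>r::real. emeasure M (Q x0 (l * r)) / emeasure M (Q x0 r))"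
    using assms unfolding weak_reverse_doubling_def by auto
  define c where "c = (1 + C) / 2"
  have c: "1 < c" "c < C" using x0 by (auto simp: c_def)
  then have "ennreal c < ennreal C" by (simp add: ennreal_lessI)
  also note lim
  finally have "eventually (\<lambda>r::real. ennreal c < emeasure M (Q x0 (l * r)) / emeasure M (Q x0 r)) at_top"
    by (rule less_LiminfD)
  then obtain R0 where R0: "\<And>r. R0 \<le> r \<Longrightarrow> ennreal c < emeasure M (Q x0 (l * r)) / emeasure M (Q x0 r)"
    by (auto simp: eventually_at_top_linorder)
  have "c * V x0 r \<le> V x0 (l * r)" if r: "R0 \<le> r" "0 < r" for r
  proof -
    have "0 < l * r" using x0 r by simp
    then have "ennreal c < ennreal (V x0 (l * r) / V x0 r)"
      using R0[OF r(1)] V_pos[OF x0(1) r(2)] V_pos[OF x0(1) \<open>0 < l * r\<close>]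
      by (simp add: emeasure_Q[OF x0(1)] r divide_ennreal)
    then have "c < V x0 (l * r) / V x0 r" using c by (simp add: ennreal_less_iff)
    then show ?thesis using V_pos[OF x0(1) r(2)] by (simp add: less_divide_eq)
  qed
  with x0 c(1) show thesis by (intro that)
qed

text \<open>
  The function \<open>a\<close> is a measurable minorant of the weight, the same for all \<open>x\<close> near \<open>x0\<close>. On the annulus around \<open>x0\<close> between the radii \<open>l ^ k * R\<close> and
  \<open>l ^ (k + 1) * R\<close> it is the constant \<open>w k\<close>, of the order of the inverse of the measure of the outer ball, times
  the decay \<open>(l ^ k) powr (- s q)\<close>. By reverse doubling the annulus has a fixed proportion of that
  measure, so the integral is at least a geometric series and of order \<open>1/s\<close>. The innermost radius \<open>R\<close> depends
  on \<open>n\<close>, but it enters only through a factor \<open>D powr (- s q)\<close>, which is at least \<open>1/2\<close> once \<open>s < s1\<close>; this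
  is where \<open>c\<close> becomes independent of \<open>n\<close>.
\<close>

lemma annular_kernel:
  assumes wrd: "weak_reverse_doubling M rho" and "0 < q"
  obtains x0 c where "x0 \<in> space M" "0 < c"
    "\<And>n. 0 \<le> n \<Longrightarrow> \<exists>s1>0. \<forall>s. 0 < s \<longrightarrow> s < s1 \<longrightarrow>
      (\<exists>a\<in>borel_measurable M. ennreal c \<le> ennreal s * (\<integral>\<^sup>+y. a y \<partial>M) \<and>
        (\<forall>x\<in>space M. \<forall>y\<in>space M. rho x0 x < n \<longrightarrow> a y \<noteq> 0 \<longrightarrow> n \<le> rho x0 y \<and> 1 \<le> rho x y \<and>
          a y \<le> inverse (qU M rho x y * ennreal (rho x y powr (s * q)))))"
proof -
  obtain x0 l c1 R0 where x0: "x0 \<in> space M" and l: "1 < l" and c1: "1 < c1"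
    and rd: "\<And>r. R0 \<le> r \<Longrightarrow> 0 < r \<Longrightarrow> c1 * V x0 r \<le> V x0 (l * r)"
    using reverse_doubling_eventually[OF wrd] by blast
  define m where "m = nat \<lceil>K * (1 + 2 * K)\<rceil>"
  define c0 where "c0 = (1 - 1 / c1) / L ^ m"
  have c0: "0 < c0" unfolding c0_def using c1 L_ge_1 by simp
  define c where "c = c0 / (q * ln l) / 2"
  have c: "0 < c" unfolding c_def using c0 \<open>0 < q\<close> l by simp
  have main: "\<exists>s1>0. \<forall>s. 0 < s \<longrightarrow> s < s1 \<longrightarrow>
      (\<exists>a\<in>borel_measurable M. ennreal c \<le> ennreal s * (\<integral>\<^sup>+y. a y \<partial>M) \<and>
        (\<forall>x\<in>space M. \<forall>y\<in>space M. rho x0 x < n \<longrightarrow> a y \<noteq> 0 \<longrightarrow> n \<le> rho x0 y \<and> 1 \<le> rho x y \<and>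
          a y \<le> inverse (qU M rho x y * ennreal (rho x y powr (s * q)))))" if "0 \<le> n" for n
  proof -
    \<comment> \<open>\<open>K * (n + 1)\<close> keeps the annuli at distance at least one from all \<open>x\<close> with \<open>rho x0 x < n\<close>\<close>
    define R where "R = max (max R0 1) (K * (n + 1))"
    have R: "R0 \<le> R" "1 \<le> R" "K * (n + 1) \<le> R" by (auto simp: R_def)
    have nR: "n + 1 \<le> R"
    proof -
      have "1 * (n + 1) \<le> K * (n + 1)" using K_ge_1 \<open>0 \<le> n\<close> by (intro mult_right_mono) auto
      also note R(3)
      finally show ?thesis by simp
    qed
    define D where "D = 2 * K * l * R"
    have D: "1 < D"
    proof -
      have "1 * 1 \<le> K * l" using K_ge_1 l by (intro mult_mono) auto
      then have "1 * 1 \<le> (K * l) * R" using R by (intro mult_mono) auto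
      then show ?thesis by (simp add: D_def)
    qed
    define S where "S k = Q x0 (l ^ k * R)" for k
    have rk: "R \<le> l ^ k * R" for k using l R mult_mono[of 1 "l ^ k" R R] by simp
    have rk0: "0 < l ^ k * R" for k using rk[of k] R by linarith
    have SM[measurable]: "S k \<in> sets M" for k unfolding S_def using x0 by (rule Q_sets)
    have eS: "emeasure M (S k) = ennreal (V x0 (l ^ k * R))" for k
      unfolding S_def using x0 rk0 by (rule emeasure_Q)
    have S_Suc: "S k \<subseteq> S (Suc k)" for k
    proof -
      have "l ^ k * R \<le> l ^ Suc k * R" using l R by (intro mult_right_mono power_increasing) auto
      then show ?thesis unfolding S_def qball_def by auto
    qed
    define A where "A k = S (Suc k) - S k" for k
    have AM[measurable]: "A k \<in> sets M" for k unfolding A_def by measurable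
    have disj: "disjoint_family A" unfolding A_def by (rule disjoint_family_Suc) (rule S_Suc)
    have eA: "ennreal ((1 - 1 / c1) * V x0 (l ^ Suc k * R)) \<le> emeasure M (A k)" for k
    proof -
      have "emeasure M (A k) = emeasure M (S (Suc k)) - emeasure M (S k)"
        unfolding A_def by (rule emeasure_Diff) (use eS S_Suc in auto)
      also have "\<dots> = ennreal (V x0 (l ^ Suc k * R) - V x0 (l ^ k * R))"
        unfolding eS using V_pos[OF x0 rk0[of k]] by (intro ennreal_minus) auto
      finally have eq: "emeasure M (A k) = \<dots>" .
      have "c1 * V x0 (l ^ k * R) \<le> V x0 (l * (l ^ k * R))"
        using order.trans[OF R(1) rk[of k]] rk0[of k] by (rule rd)
      then have "V x0 (l ^ k * R) \<le> V x0 (l ^ Suc k * R) / c1"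
        using c1 by (simp add: le_divide_eq mult_ac)
      then show ?thesis unfolding eq by (intro ennreal_leI) (simp add: algebra_simps)
    qed
    have "\<exists>a\<in>borel_measurable M. ennreal c \<le> ennreal s * (\<integral>\<^sup>+y. a y \<partial>M) \<and>
        (\<forall>x\<in>space M. \<forall>y\<in>space M. rho x0 x < n \<longrightarrow> a y \<noteq> 0 \<longrightarrow> n \<le> rho x0 y \<and> 1 \<le> rho x y \<and>
          a y \<le> inverse (qU M rho x y * ennreal (rho x y powr (s * q))))"
      if s: "0 < s" "s < ln 2 / (q * ln D)" for s
    proof -
      define \<sigma> where "\<sigma> = s * q"
      have \<sigma>: "0 < \<sigma>" unfolding \<sigma>_def using s \<open>0 < q\<close> by simp
      define P where "P k = 2 * K * (l ^ Suc k * R)" for k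
      define w where "w k = P k powr (- \<sigma>) / (L ^ m * V x0 (l ^ Suc k * R))" for k
      have Vk: "0 < V x0 (l ^ Suc k * R)" for k using V_pos[OF x0 rk0[of "Suc k"]] by simp
      have w0: "0 \<le> w k" for k unfolding w_def using Vk[of k] L_ge_1 by simp
      define a where "a y = (\<Sum>k. ennreal (w k) * indicator (A k) y)" for y
      have am[measurable]: "a \<in> borel_measurable M" unfolding a_def by measurable
      have a_eq: "a y = ennreal (w k)" if "y \<in> A k" for y k
        unfolding a_def using suminf_cmult_indicator[OF disj that, of "\<lambda>k. ennreal (w k)"] by simp
      have P_powr: "P k powr (- \<sigma>) = D powr (- \<sigma>) * l powr (- (real k * \<sigma>))" for k
      proof -
        have "P k = D * l powr (real k)" using l by (simp add: P_def D_def powr_realpow)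
        then show ?thesis using D l by (simp add: powr_mult powr_powr)
      qed
      have "ennreal (c0 * D powr (- \<sigma>) * (1 / (\<sigma> * ln l))) \<le> (\<integral>\<^sup>+y. a y \<partial>M)"
      proof -
        have "ennreal (c0 * D powr (- \<sigma>) * (1 / (\<sigma> * ln l)))
            \<le> ennreal (c0 * D powr (- \<sigma>)) * ennreal (1 / (1 - l powr (- \<sigma>)))"
        proof -
          have "ennreal (c0 * D powr (- \<sigma>) * (1 / (\<sigma> * ln l))) =
              ennreal (c0 * D powr (- \<sigma>)) * ennreal (1 / (\<sigma> * ln l))"
            using c0 l \<sigma> by (intro ennreal_mult) auto
          also have "\<dots> \<le> ennreal (c0 * D powr (- \<sigma>)) * ennreal (1 / (1 - l powr (- \<sigma>)))"
            by (intro mult_left_mono ennreal_leI suminf_geometric_powr(2)[OF l \<sigma>]) simp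
          finally show ?thesis .
        qed
        also have "\<dots> = (\<Sum>k. ennreal (c0 * D powr (- \<sigma>)) * ennreal (l powr (- (real k * \<sigma>))))"
          using suminf_geometric_powr(1)[OF l \<sigma>] by simp
        also have "\<dots> \<le> (\<Sum>k. ennreal (w k) * emeasure M (A k))"
        proof (intro suminf_le)
          fix k
          have "ennreal (c0 * D powr (- \<sigma>)) * ennreal (l powr (- (real k * \<sigma>))) = ennreal (c0 * P k powr (- \<sigma>))"
            unfolding P_powr using c0 by (simp add: ennreal_mult mult.assoc)
          also have "c0 * P k powr (- \<sigma>) = w k * ((1 - 1 / c1) * V x0 (l ^ Suc k * R))"
            unfolding w_def c0_def using Vk[of k] by simp
          also have "ennreal \<dots> = ennreal (w k) * ennreal ((1 - 1 / c1) * V x0 (l ^ Suc k * R))"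
            using w0 c1 Vk[of k] by (intro ennreal_mult) auto
          also have "\<dots> \<le> ennreal (w k) * emeasure M (A k)"
            by (intro mult_left_mono eA) simp
          finally show "ennreal (c0 * D powr (- \<sigma>)) * ennreal (l powr (- (real k * \<sigma>))) \<le> \<dots>" .
        qed auto
        also have "\<dots> = (\<integral>\<^sup>+y. a y \<partial>M)"
          unfolding a_def by (subst nn_integral_suminf) (auto simp: nn_integral_cmult_indicator)
        finally show ?thesis .
      qed
      then have "ennreal s * ennreal (c0 * D powr (- \<sigma>) * (1 / (\<sigma> * ln l))) \<le> ennreal s * (\<integral>\<^sup>+y. a y \<partial>M)"
        by (rule mult_left_mono) simp
      moreover have "ennreal c \<le> ennreal s * ennreal (c0 * D powr (- \<sigma>) * (1 / (\<sigma> * ln l)))"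
      proof -
        have "\<sigma> * ln D \<le> ln 2"
          using s \<open>0 < q\<close> D by (simp add: \<sigma>_def less_divide_eq mult_ac)
        then have "exp (- ln 2) \<le> exp (- (\<sigma> * ln D))" by simp
        then have D2: "1 / 2 \<le> D powr (- \<sigma>)" using D by (simp add: powr_def exp_minus inverse_eq_divide)
        have "c = c0 / (q * ln l) * (1 / 2)" by (simp add: c_def)
        also have "\<dots> \<le> c0 / (q * ln l) * D powr (- \<sigma>)"
          using c0 \<open>0 < q\<close> l by (intro mult_left_mono D2) auto
        also have "\<dots> = s * (c0 * D powr (- \<sigma>) * (1 / (\<sigma> * ln l)))"
          using s by (simp add: \<sigma>_def)
        finally show ?thesis
          using s by (simp add: ennreal_mult'[symmetric] ennreal_leI del: ennreal_mult'')
      qed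
      moreover have "n \<le> rho x0 y \<and> 1 \<le> rho x y \<and> a y \<le> inverse (qU M rho x y * ennreal (rho x y powr (s * q)))"
        if x: "x \<in> space M" and y: "y \<in> space M" and xn: "rho x0 x < n" and ay: "a y \<noteq> 0" for x y
      proof -
        have "\<exists>k. y \<in> A k"
        proof (rule ccontr)
          assume "\<nexists>k. y \<in> A k"
          then have "a y = 0" by (simp add: a_def)
          with ay show False by simp
        qed
        then obtain k where k: "y \<in> A k" by blast
        then have yk: "l ^ k * R \<le> rho x0 y" "rho x0 y < l ^ Suc k * R"
          using y by (auto simp: A_def S_def qball_def)
        have yR: "R \<le> rho x0 y" using yk(1) rk[of k] by linarith
        have "K * (n + 1) \<le> K * (rho x0 x + rho x y)"
          using R(3) yR rho_triangle[OF x0 x y] by linarith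
        then have "n + 1 \<le> rho x0 x + rho x y" using K_ge_1 by simp
        then have 1: "1 \<le> rho x y" using xn by simp
        have xRk: "rho x0 x \<le> l ^ Suc k * R" using xn nR rk[of "Suc k"] by linarith
        have "rho x y \<le> K * (rho x x0 + rho x0 y)" using x x0 y by (intro rho_triangle)
        also have "\<dots> \<le> K * (l ^ Suc k * R + l ^ Suc k * R)"
          using K_ge_1 yk(2) xRk rho_sym[OF x x0] by (intro mult_left_mono add_mono) auto
        also have "\<dots> = P k" by (simp add: P_def)
        finally have rP: "rho x y \<le> P k" .
        have VP: "V x (rho x y) \<le> L ^ m * V x0 (l ^ Suc k * R)"
        proof (rule V_compare[OF x x0 rk0])
          have "K * (rho x0 x + rho x y) \<le> K * (l ^ Suc k * R + P k)"
            using K_ge_1 rP xRk by (intro mult_left_mono add_mono) auto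
          also have "\<dots> = K * (1 + 2 * K) * (l ^ Suc k * R)" by (simp add: P_def algebra_simps)
          also have "\<dots> \<le> 2 ^ m * (l ^ Suc k * R)"
            unfolding m_def using rk0[of "Suc k"] by (intro mult_right_mono le_two_power_nat_ceiling) auto
          finally show "K * (rho x0 x + rho x y) \<le> 2 ^ m * (l ^ Suc k * R)" .
        qed
        have xy: "x \<noteq> y" using 1 rho_eq_0_iff[OF x y] by auto
        let ?v = "min (V x (rho x y)) (V y (rho x y))"
        have v: "0 < ?v" "?v \<le> L ^ m * V x0 (l ^ Suc k * R)" using qU_eq(2)[OF x y xy] VP by auto
        have "w k = P k powr (- \<sigma>) * (1 / (L ^ m * V x0 (l ^ Suc k * R)))" by (simp add: w_def)
        also have "\<dots> \<le> rho x y powr (- \<sigma>) * (1 / ?v)"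
        proof (rule mult_mono)
          show "P k powr (- \<sigma>) \<le> rho x y powr (- \<sigma>)" using rP 1 \<sigma> by (intro powr_mono2') auto
          show "1 / (L ^ m * V x0 (l ^ Suc k * R)) \<le> 1 / ?v"
            using v Vk[of k] L_ge_1 by (intro divide_left_mono mult_pos_pos) auto
        qed (use Vk[of k] L_ge_1 in auto)
        finally have "ennreal (w k) \<le> ennreal (rho x y powr (- \<sigma>) * (1 / ?v))" by (rule ennreal_leI)
        also have "\<dots> = inverse (qU M rho x y * ennreal (rho x y powr (s * q)))"
          unfolding inverse_U_powr[OF x y xy] \<sigma>_def[symmetric] using v(1) by (intro ennreal_mult) auto
        finally show ?thesis using a_eq[OF k] 1 yR nR by auto
      qed
      ultimately show ?thesis using am by (intro bexI[of _ a]) (auto intro: order.trans)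
    qed
    moreover have "0 < ln 2 / (q * ln D)" using \<open>0 < q\<close> D by simp
    ultimately show ?thesis by blast
  qed
  show thesis by (rule that[OF x0 c main])
qed

text \<open>
  For \<open>x\<close> outside the ball of radius \<open>n\<close> the last summand alone suffices. For \<open>x\<close> inside, integrate
  \<open>\<bar>f x\<bar> powr q\<close>, bounded by \<open>\<bar>f x - f y\<bar> powr q\<close> and \<open>\<bar>f y\<bar> powr q\<close>, against the minorant \<open>a\<close>: it lives where
  \<open>f\<close> coincides with its tail, and it is below the weight in the first term and below \<open>far_ker\<close> in the second.
\<close>

lemma frac_integral_lower:
  assumes wrd: "weak_reverse_doubling M rho" and q: "0 < q"
  obtains x0 c where "x0 \<in> space M" "0 < c"
    "\<And>f n. f \<in> borel_measurable M \<Longrightarrow> 0 \<le> n \<Longrightarrow> \<exists>s1>0. \<forall>s. 0 < s \<longrightarrow> s < s1 \<longrightarrow>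
      (\<forall>x\<in>space M. ennreal c * ennreal (cmod (f x) powr q) \<le>
         ennreal (2 powr q * overlap_const) * (ennreal s * frac_integral M rho q s f x +
           ennreal s * far_op (s * q) (\<lambda>y. ennreal (cmod (f y * indicator (space M - Q x0 n) y) powr q)) x)
         + ennreal c * ennreal (cmod (f x * indicator (space M - Q x0 n) x) powr q))"
proof -
  obtain x0 c where x0: "x0 \<in> space M" and c: "0 < c" and ker:
    "\<And>n. 0 \<le> n \<Longrightarrow> \<exists>s1>0. \<forall>s. 0 < s \<longrightarrow> s < s1 \<longrightarrow>
      (\<exists>a\<in>borel_measurable M. ennreal c \<le> ennreal s * (\<integral>\<^sup>+y. a y \<partial>M) \<and>
        (\<forall>x\<in>space M. \<forall>y\<in>space M. rho x0 x < n \<longrightarrow> a y \<noteq> 0 \<longrightarrow> n \<le> rho x0 y \<and> 1 \<le> rho x y \<and>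
          a y \<le> inverse (qU M rho x y * ennreal (rho x y powr (s * q)))))"
    using annular_kernel[OF wrd q] by blast
  have main: "\<exists>s1>0. \<forall>s. 0 < s \<longrightarrow> s < s1 \<longrightarrow>
      (\<forall>x\<in>space M. ennreal c * ennreal (cmod (f x) powr q) \<le>
         ennreal (2 powr q * overlap_const) * (ennreal s * frac_integral M rho q s f x +
           ennreal s * far_op (s * q) (\<lambda>y. ennreal (cmod (f y * indicator (space M - Q x0 n) y) powr q)) x)
         + ennreal c * ennreal (cmod (f x * indicator (space M - Q x0 n) x) powr q))"
    if f[measurable]: "f \<in> borel_measurable M" and "0 \<le> n" for f n
  proof -
    have [measurable]: "Q x0 n \<in> sets M" using x0 by (rule Q_sets)
    let ?h = "\<lambda>y. f y * indicator (space M - Q x0 n) y"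
    obtain s1 where s1: "0 < s1" and ker: "\<And>s. 0 < s \<Longrightarrow> s < s1 \<Longrightarrow>
      (\<exists>a\<in>borel_measurable M. ennreal c \<le> ennreal s * (\<integral>\<^sup>+y. a y \<partial>M) \<and>
        (\<forall>x\<in>space M. \<forall>y\<in>space M. rho x0 x < n \<longrightarrow> a y \<noteq> 0 \<longrightarrow> n \<le> rho x0 y \<and> 1 \<le> rho x y \<and>
          a y \<le> inverse (qU M rho x y * ennreal (rho x y powr (s * q)))))"
      using ker[OF \<open>0 \<le> n\<close>] by blast
    have "ennreal c * ennreal (cmod (f x) powr q) \<le>
         ennreal (2 powr q * overlap_const) * (ennreal s * frac_integral M rho q s f x +
           ennreal s * far_op (s * q) (\<lambda>y. ennreal (cmod (?h y) powr q)) x)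
         + ennreal c * ennreal (cmod (?h x) powr q)"
      if s: "0 < s" "s < s1" and x: "x \<in> space M" for s x
    proof (cases "rho x0 x < n")
      case False
      then have "?h x = f x" using x by (simp add: qball_def)
      then show ?thesis by (simp only:) (simp add: add_increasing)
    next
      case True
      obtain a where a[measurable]: "a \<in> borel_measurable M" and ac: "ennreal c \<le> ennreal s * (\<integral>\<^sup>+y. a y \<partial>M)"
        and aU: "\<And>y. y \<in> space M \<Longrightarrow> a y \<noteq> 0 \<Longrightarrow> n \<le> rho x0 y \<and> 1 \<le> rho x y \<and>
          a y \<le> inverse (qU M rho x y * ennreal (rho x y powr (s * q)))"
        using ker[OF s] x True by blast
      have [measurable]: "(\<lambda>y. far_ker (s * q) x y) \<in> borel_measurable M"
        using far_ker_measurable[of "s * q"] x by simp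
      have pt: "a y * ennreal (cmod (f x) powr q) \<le> ennreal (2 powr q) * (a y * ennreal (cmod (f x - f y) powr q)
          + ennreal overlap_const * (far_ker (s * q) x y * ennreal (cmod (?h y) powr q)))" if y: "y \<in> space M" for y
      proof (cases "a y = 0")
        case False
        note aU = aU[OF y False]
        have hy: "?h y = f y" using aU y by (simp add: qball_def)
        have "a y * ennreal (cmod (f x) powr q) \<le> a y * (ennreal (2 powr q) *
            (ennreal (cmod (f x - f y) powr q) + ennreal (cmod (f y) powr q)))"
          using powr_cmod_triangle[OF q, of "f x - f y" "f y"] by (intro mult_left_mono) auto
        also have "\<dots> = ennreal (2 powr q) * (a y * ennreal (cmod (f x - f y) powr q) + a y * ennreal (cmod (f y) powr q))"
          by (simp add: distrib_left mult_ac)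
        also have "\<dots> \<le> ennreal (2 powr q) * (a y * ennreal (cmod (f x - f y) powr q)
          + (ennreal overlap_const * far_ker (s * q) x y) * ennreal (cmod (f y) powr q))"
        proof (intro mult_left_mono add_left_mono mult_right_mono)
          have "a y \<le> inverse (qU M rho x y * ennreal (rho x y powr (s * q)))" using aU by simp
          also have "\<dots> \<le> ennreal overlap_const * far_ker (s * q) x y"
            using aU s q by (intro inverse_U_powr_le_far_ker x y) auto
          finally show "a y \<le> ennreal overlap_const * far_ker (s * q) x y" .
        qed auto
        finally show ?thesis by (simp only: hy mult.assoc)
      qed simp
      have le_frac: "(\<integral>\<^sup>+y. a y * ennreal (cmod (f x - f y) powr q) \<partial>M) \<le> frac_integral M rho q s f x"
        unfolding frac_integral_def
      proof (rule nn_integral_mono)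
        fix y assume y: "y \<in> space M"
        show "a y * ennreal (cmod (f x - f y) powr q) \<le> (if y = x then 0
             else ennreal (cmod (f x - f y) powr q) / (qU M rho x y * ennreal (rho x y powr (s * q))))"
        proof (cases "a y = 0 \<or> y = x")
          case False
          then have "a y \<le> inverse (qU M rho x y * ennreal (rho x y powr (s * q)))" using aU[OF y] by simp
          then have "a y * ennreal (cmod (f x - f y) powr q) \<le>
              inverse (qU M rho x y * ennreal (rho x y powr (s * q))) * ennreal (cmod (f x - f y) powr q)"
            by (rule mult_right_mono) simp
          then show ?thesis using False by (simp add: divide_ennreal_def mult.commute)
        qed (use q in auto)
      qed
      have "ennreal c * ennreal (cmod (f x) powr q) \<le> (ennreal s * (\<integral>\<^sup>+y. a y \<partial>M)) * ennreal (cmod (f x) powr q)"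
        by (intro mult_right_mono ac) simp
      also have "\<dots> = ennreal s * (\<integral>\<^sup>+y. a y * ennreal (cmod (f x) powr q) \<partial>M)"
        by (simp add: nn_integral_multc mult.assoc)
      also have "\<dots> \<le> ennreal s * (\<integral>\<^sup>+y. ennreal (2 powr q) * (a y * ennreal (cmod (f x - f y) powr q)
          + ennreal overlap_const * (far_ker (s * q) x y * ennreal (cmod (?h y) powr q))) \<partial>M)"
        by (intro mult_left_mono nn_integral_mono pt) auto
      also have "\<dots> = ennreal s * (ennreal (2 powr q) * ((\<integral>\<^sup>+y. a y * ennreal (cmod (f x - f y) powr q) \<partial>M)
          + ennreal overlap_const * far_op (s * q) (\<lambda>y. ennreal (cmod (?h y) powr q)) x))"
        unfolding far_op_def by (simp add: nn_integral_cmult nn_integral_add)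
      also have "\<dots> \<le> ennreal s * (ennreal (2 powr q) * (ennreal overlap_const * frac_integral M rho q s f x
          + ennreal overlap_const * far_op (s * q) (\<lambda>y. ennreal (cmod (?h y) powr q)) x))"
      proof (intro mult_left_mono add_right_mono)
        have "1 * frac_integral M rho q s f x \<le> ennreal overlap_const * frac_integral M rho q s f x"
          using overlap_const_ge_1 by (intro mult_right_mono) auto
        then show "(\<integral>\<^sup>+y. a y * ennreal (cmod (f x - f y) powr q) \<partial>M) \<le> ennreal overlap_const * frac_integral M rho q s f x"
          using le_frac by simp
      qed auto
      also have "\<dots> = ennreal (2 powr q * overlap_const) * (ennreal s * frac_integral M rho q s f x +
           ennreal s * far_op (s * q) (\<lambda>y. ennreal (cmod (?h y) powr q)) x)"
        using overlap_const_ge_1 by (simp add: ennreal_mult distrib_left mult_ac)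
      finally show ?thesis by (simp add: add_increasing2)
    qed
    then show ?thesis using s1 by blast
  qed
  show thesis by (rule that[OF x0 c main])
qed

text \<open>
  The constant does not depend on the radius \<open>n\<close>, so that \<open>n\<close> may afterwards tend to infinity.
\<close>

lemma norm_le_Liminf_frac_seminorm:
  assumes wrd: "weak_reverse_doubling M rho"
    and N: "ball_quasi_Banach M rho N" and pq: "0 < q" "q \<le> p"
    and Z: "ball_Banach M rho (power_norm N (1 / p))"
    and max: "maximal_bounded M rho (assoc_norm M (power_norm N (1 / p)))"
  obtains x0 C where "x0 \<in> space M" "0 < C" "\<And>f n. f \<in> borel_measurable M \<Longrightarrow> 0 \<le> n \<Longrightarrow>
    N f \<le> ennreal C * (Liminf (at_right 0) (\<lambda>s. ennreal (s powr (1 / q)) * frac_seminorm M rho N q s f)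
      + N (\<lambda>y. f y * indicator (space M - Q x0 n) y))"
proof -
  obtain C1 where C1: "0 < C1" "\<And>s h. 0 < s \<Longrightarrow> s < 1 \<Longrightarrow> h \<in> borel_measurable M \<Longrightarrow>
    ext_norm M N (\<lambda>x. epowr (ennreal s * far_op (s * q) (\<lambda>y. ennreal (cmod (h y) powr q)) x) (1 / q)) \<le> ennreal C1 * N h"
    using far_op_power_bounded[OF N pq Z max] by blast
  obtain K1 where K1: "1 \<le> K1"
    "\<And>G H. ext_norm M N (\<lambda>x. G x + H x) \<le> ennreal K1 * (ext_norm M N G + ext_norm M N H)"
    using ext_norm_triangle[OF N] by blast
  obtain x0 c where x0: "x0 \<in> space M" and c: "0 < c" and low:
    "\<And>f n. f \<in> borel_measurable M \<Longrightarrow> 0 \<le> n \<Longrightarrow> \<exists>s1>0. \<forall>s. 0 < s \<longrightarrow> s < s1 \<longrightarrow>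
      (\<forall>x\<in>space M. ennreal c * ennreal (cmod (f x) powr q) \<le>
         ennreal (2 powr q * overlap_const) * (ennreal s * frac_integral M rho q s f x +
           ennreal s * far_op (s * q) (\<lambda>y. ennreal (cmod (f y * indicator (space M - Q x0 n) y) powr q)) x)
         + ennreal c * ennreal (cmod (f x * indicator (space M - Q x0 n) x) powr q))"
    using frac_integral_lower[OF wrd pq(1)] by blast
  define b where "b = (2::real) powr (1 / q)"
  define d where "d = (2 powr q * overlap_const) powr (1 / q)"
  define e where "e = c powr (1 / q)"
  have pos: "0 < b" "0 < d" "0 < e"
    using overlap_const_ge_1 c by (auto simp: b_def d_def e_def)
  define C where "C = (1 / e) * (b * (K1 * (e + d * (b * (K1 * (1 + C1))))))"
  have C: "0 < C" unfolding C_def using pos K1(1) C1(1) by (intro mult_pos_pos add_pos_pos) auto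
  have main: "N f \<le> ennreal C * (Liminf (at_right 0) (\<lambda>s. ennreal (s powr (1 / q)) * frac_seminorm M rho N q s f)
      + N (\<lambda>y. f y * indicator (space M - Q x0 n) y))" (is "_ \<le> ennreal C * (Liminf _ ?F + N ?h)")
    if f[measurable]: "f \<in> borel_measurable M" and n: "0 \<le> n" for f n
  proof -
    have [measurable]: "Q x0 n \<in> sets M" using x0 by (rule Q_sets)
    have h[measurable]: "?h \<in> borel_measurable M" by measurable
    obtain s1 where s1: "0 < s1" and low: "\<And>s x. 0 < s \<Longrightarrow> s < s1 \<Longrightarrow> x \<in> space M \<Longrightarrow>
        ennreal c * ennreal (cmod (f x) powr q) \<le>
         ennreal (2 powr q * overlap_const) * (ennreal s * frac_integral M rho q s f x +
           ennreal s * far_op (s * q) (\<lambda>y. ennreal (cmod (?h y) powr q)) x)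
         + ennreal c * ennreal (cmod (?h x) powr q)"
      using low[OF f n] by blast
    have bound: "N f \<le> ennreal C * (?F s + N ?h)" if s: "0 < s" "s < s1" "s < 1" for s
    proof -
      let ?g = "\<lambda>x. ennreal (s powr (1 / q)) * epowr (frac_integral M rho q s f x) (1 / q)"
      let ?T = "\<lambda>x. epowr (ennreal s * far_op (s * q) (\<lambda>y. ennreal (cmod (?h y) powr q)) x) (1 / q)"
      let ?H = "\<lambda>x. ?g x + ?T x"
      let ?R = "\<lambda>x. ennreal b * (ennreal e * ennreal (cmod (?h x)) + ennreal d * (ennreal b * ?H x))"
      have pt: "ennreal e * ennreal (cmod (f x)) \<le> ?R x" if x: "x \<in> space M" for x
      proof -
        have "epowr (ennreal c * ennreal (cmod (f x) powr q)) (1 / q) \<le>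
          epowr (ennreal c * ennreal (cmod (?h x) powr q) +
           ennreal (2 powr q * overlap_const) * (ennreal s * frac_integral M rho q s f x +
           ennreal s * far_op (s * q) (\<lambda>y. ennreal (cmod (?h y) powr q)) x)) (1 / q)"
          using low[OF s(1,2) x] pq by (intro epowr_mono) (auto simp: add.commute)
        also have "\<dots> \<le> ennreal b * (epowr (ennreal c * ennreal (cmod (?h x) powr q)) (1 / q) +
          epowr (ennreal (2 powr q * overlap_const)) (1 / q) *
            (ennreal b * (epowr (ennreal s * frac_integral M rho q s f x) (1 / q) + ?T x)))"
          unfolding b_def using pq by (intro epowr_add_mult_add_le) auto
        also have "epowr (ennreal (2 powr q * overlap_const)) (1 / q) = ennreal d"
          unfolding d_def using overlap_const_ge_1 by (intro epowr_ennreal) auto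
        also have "epowr (ennreal s * frac_integral M rho q s f x) (1 / q) = ?g x"
          using s by (simp add: epowr_mult)
        also have "epowr (ennreal c * ennreal (cmod (?h x) powr q)) (1 / q) = ennreal e * ennreal (cmod (?h x))"
          using pq c by (simp add: epowr_mult powr_powr e_def)
        also have "epowr (ennreal c * ennreal (cmod (f x) powr q)) (1 / q) = ennreal e * ennreal (cmod (f x))"
          using pq c by (simp add: epowr_mult powr_powr e_def)
        finally show ?thesis .
      qed
      have "ennreal e * N f = ext_norm M N (\<lambda>x. ennreal e * ennreal (cmod (f x)))"
        by (simp add: ext_norm_scale_eq[OF N pos(3)] ext_norm_ennreal_cmod[OF N f])
      also have "\<dots> \<le> ext_norm M N ?R" using pt by (intro ext_norm_mono) auto
      also have "\<dots> \<le> ennreal b * ext_norm M N (\<lambda>x. ennreal e * ennreal (cmod (?h x)) + ennreal d * (ennreal b * ?H x))"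
        by (rule ext_norm_scale[OF N pos(1)])
      also have "\<dots> \<le> ennreal b * (ennreal K1 * (ennreal e * N ?h + ennreal d * (ennreal b * (ennreal K1 * (?F s + ennreal C1 * N ?h)))))"
      proof (rule mult_left_mono)
        have g: "ext_norm M N ?g = ?F s"
          unfolding frac_seminorm_def using s by (intro ext_norm_scale_eq[OF N]) auto
        have "ext_norm M N ?H \<le> ennreal K1 * (ext_norm M N ?g + ext_norm M N ?T)" by (rule K1)
        also have "\<dots> \<le> ennreal K1 * (?F s + ennreal C1 * N ?h)"
          unfolding g by (intro mult_left_mono add_left_mono C1 s h) simp
        finally have H: "ext_norm M N ?H \<le> ennreal K1 * (?F s + ennreal C1 * N ?h)" .
        have e1: "ext_norm M N (\<lambda>x. ennreal e * ennreal (cmod (?h x))) = ennreal e * N ?h"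
          using ext_norm_scale_eq[OF N pos(3), of "\<lambda>x. ennreal (cmod (?h x))"] ext_norm_ennreal_cmod[OF N h] by simp
        have e2: "ext_norm M N (\<lambda>x. ennreal d * (ennreal b * ?H x)) = ennreal d * (ennreal b * ext_norm M N ?H)"
          using ext_norm_scale_eq[OF N pos(2), of "\<lambda>x. ennreal b * ?H x"] ext_norm_scale_eq[OF N pos(1), of ?H] by simp
        have "ext_norm M N (\<lambda>x. ennreal e * ennreal (cmod (?h x)) + ennreal d * (ennreal b * ?H x))
          \<le> ennreal K1 * (ext_norm M N (\<lambda>x. ennreal e * ennreal (cmod (?h x))) + ext_norm M N (\<lambda>x. ennreal d * (ennreal b * ?H x)))"
          by (rule K1)
        also have "\<dots> \<le> ennreal K1 * (ennreal e * N ?h + ennreal d * (ennreal b * (ennreal K1 * (?F s + ennreal C1 * N ?h))))"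
          unfolding e1 e2 by (intro mult_left_mono add_left_mono H) auto
        finally show "ext_norm M N (\<lambda>x. ennreal e * ennreal (cmod (?h x)) + ennreal d * (ennreal b * ?H x)) \<le> \<dots>" .
      qed simp
      also have "\<dots> \<le> ennreal (b * (K1 * (e + d * (b * (K1 * (1 + C1)))))) * (?F s + N ?h)"
      proof -
        define X where "X = ?F s + N ?h"
        have X: "?F s \<le> X" "N ?h \<le> X" by (auto simp: X_def)
        have "ennreal b * (ennreal K1 * (ennreal e * N ?h + ennreal d * (ennreal b * (ennreal K1 * (?F s + ennreal C1 * N ?h)))))
          \<le> ennreal b * (ennreal K1 * (ennreal e * X + ennreal d * (ennreal b * (ennreal K1 * (X + ennreal C1 * X)))))"
          by (intro mult_left_mono add_mono X) auto
        also have "\<dots> = ennreal (b * (K1 * (e + d * (b * (K1 * (1 + C1)))))) * X"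
          using pos K1(1) C1(1)
          by (simp add: ennreal_mult ennreal_plus distrib_left distrib_right mult.assoc)
        finally show ?thesis unfolding X_def .
      qed
      finally have "N f \<le> ennreal (1 / e) * (ennreal (b * (K1 * (e + d * (b * (K1 * (1 + C1)))))) * (?F s + N ?h))"
        using le_ennreal_mult_iff[of "1 / e" "N f"] pos(3) by simp
      also have "\<dots> = ennreal C * (?F s + N ?h)"
        unfolding C_def using pos K1(1) C1(1) by (subst ennreal_mult) (auto simp: mult.assoc)
      finally show ?thesis .
    qed
    show ?thesis
    proof (cases "N ?h = top")
      case True
      then show ?thesis using C by (simp add: ennreal_mult_top)
    next
      case False
      have "ennreal (1 / C) * N f - N ?h \<le> Liminf (at_right 0) ?F"
      proof (rule Liminf_bounded)
        have "eventually (\<lambda>s. s \<in> {0<..<min s1 1}) (at_right (0::real))"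
          using s1 by (intro eventually_at_right_real) auto
        then show "\<forall>\<^sub>F s in at_right 0. ennreal (1 / C) * N f - N ?h \<le> ?F s"
        proof eventually_elim
          case (elim s)
          then have "ennreal (1 / C) * N f \<le> ?F s + N ?h"
            using bound[of s] C by (simp add: le_ennreal_mult_iff)
          then show ?case using False by (simp add: ennreal_minus_le_iff add.commute)
        qed
      qed
      then have "ennreal (1 / C) * N f \<le> Liminf (at_right 0) ?F + N ?h"
        using False by (simp add: ennreal_minus_le_iff add.commute)
      then show ?thesis using C by (simp add: le_ennreal_mult_iff)
    qed
  qed
  show thesis by (rule that[OF x0 C main])
qed

lemma norm_le_Liminf_of_tails:
  assumes bound: "\<And>n::real. 0 \<le> n \<Longrightarrow> N f \<le> ennreal C * (l + N (\<lambda>y. f y * indicator (space M - Q x0 n) y))"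
    and tails: "(\<lambda>j. N (\<lambda>y. f y * indicator (space M - Q x0 (real j)) y)) \<longlonglongrightarrow> 0"
  shows "N f \<le> ennreal C * l"
proof (rule LIMSEQ_le_const)
  have "(\<lambda>j. ennreal C * (l + N (\<lambda>y. f y * indicator (space M - Q x0 (real j)) y))) \<longlonglongrightarrow> ennreal C * (l + 0)"
    using tails by (intro ennreal_tendsto_cmult tendsto_add tendsto_const) auto
  then show "(\<lambda>j. ennreal C * (l + N (\<lambda>y. f y * indicator (space M - Q x0 (real j)) y))) \<longlonglongrightarrow> ennreal C * l"
    by simp
  show "\<exists>j0. \<forall>j\<ge>j0. N f \<le> ennreal C * (l + N (\<lambda>y. f y * indicator (space M - Q x0 (real j)) y))"
    using bound by auto
qed

end

lemma homogeneous_type_doubling_space: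
  assumes "homogeneous_type M rho"
  obtains K L where "doubling_space M rho K L"
proof -
  obtain K where K: "1 \<le> K" "\<forall>x\<in>space M. \<forall>y\<in>space M. \<forall>z\<in>space M. rho x z \<le> K * (rho x y + rho y z)"
    using assms unfolding homogeneous_type_def quasi_metric_on_def by metis
  obtain L where L: "1 \<le> L" "\<forall>x\<in>space M. \<forall>r>0.
        0 < emeasure M (qball M rho x (2 * r)) \<and>
        emeasure M (qball M rho x (2 * r)) \<le> ennreal L * emeasure M (qball M rho x r) \<and>
        ennreal L * emeasure M (qball M rho x r) < \<infinity>"
    using assms unfolding homogeneous_type_def by metis
  have rest: "space M \<noteq> {}" "\<forall>x\<in>space M. \<forall>y\<in>space M. 0 \<le> rho x y \<and> (rho x y = 0 \<longleftrightarrow> x = y) \<and> rho x y = rho y x"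
    "qballs M rho \<subseteq> sets M"
    using assms unfolding homogeneous_type_def quasi_metric_on_def by blast+
  show thesis
    by (rule that, unfold_locales) (use K L rest in \<open>blast+\<close>)
qed

lemma frac_seminorm_add_const:
  "frac_seminorm M rho N q s (\<lambda>x. f x + a) = frac_seminorm M rho N q s f"
  unfolding frac_seminorm_def frac_integral_def by (simp cong: if_cong)

section \<open>Limits of the fractional seminorms\<close>

theorem theorem1p5:
  fixes M :: "'a measure" and rho :: "'a \<Rightarrow> 'a \<Rightarrow> real"
    and N :: "('a \<Rightarrow> complex) \<Rightarrow> ennreal" and p q :: real
  assumes "homogeneous_type M rho"
    and "weak_reverse_doubling M rho"
    and "0 < q" and "q \<le> p"
    and "ball_quasi_Banach M rho N"
    and "ball_Banach M rho (power_norm N (1 / p))"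
    and "maximal_bounded M rho (assoc_norm M (power_norm N (1 / p)))"
  shows "\<exists>C>0::real. \<exists>C'>0::real.
    (\<forall>b>0. \<forall>f \<in> holder_bounded_support M rho b \<inter> (\<Union>s\<in>{0<..<1}. frac_sobolev M rho N q s).
       ennreal C * N f
         \<le> Liminf (at_right 0) (\<lambda>s. ennreal (s powr (1 / q)) * frac_seminorm M rho N q s f) \<and>
       Liminf (at_right 0) (\<lambda>s. ennreal (s powr (1 / q)) * frac_seminorm M rho N q s f)
         \<le> Limsup (at_right 0) (\<lambda>s. ennreal (s powr (1 / q)) * frac_seminorm M rho N q s f) \<and>
       Limsup (at_right 0) (\<lambda>s. ennreal (s powr (1 / q)) * frac_seminorm M rho N q s f)
         \<le> ennreal C' * N f) \<and>
    (abs_continuous_norm M N \<longrightarrow>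
     (\<forall>f \<in> fun_space M (mod_const_norm N) \<inter> (\<Union>s\<in>{0<..<1}. frac_sobolev M rho N q s).
       ennreal C * mod_const_norm N f
         \<le> Liminf (at_right 0) (\<lambda>s. ennreal (s powr (1 / q)) * frac_seminorm M rho N q s f) \<and>
       Liminf (at_right 0) (\<lambda>s. ennreal (s powr (1 / q)) * frac_seminorm M rho N q s f)
         \<le> Limsup (at_right 0) (\<lambda>s. ennreal (s powr (1 / q)) * frac_seminorm M rho N q s f) \<and>
       Limsup (at_right 0) (\<lambda>s. ennreal (s powr (1 / q)) * frac_seminorm M rho N q s f)
         \<le> ennreal C' * mod_const_norm N f))"
proof -
  obtain K L where "doubling_space M rho K L"
    using homogeneous_type_doubling_space[OF assms(1)] .
  then interpret doubling_space M rho K L .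
  note N = assms(5)
  let ?F = "\<lambda>f s. ennreal (s powr (1 / q)) * frac_seminorm M rho N q s f"
  obtain C' where C': "0 < C'" and upper: "\<And>f s0. f \<in> borel_measurable M \<Longrightarrow> 0 < s0 \<Longrightarrow> s0 < 1 \<Longrightarrow>
      frac_seminorm M rho N q s0 f < \<infinity> \<Longrightarrow> Limsup (at_right 0) (?F f) \<le> ennreal C' * N f"
    using Limsup_frac_seminorm_le[OF assms(5,3,4,6,7)] by blast
  obtain x0 C where x0: "x0 \<in> space M" and C: "0 < C" and lower: "\<And>f n. f \<in> borel_measurable M \<Longrightarrow> 0 \<le> n \<Longrightarrow>
      N f \<le> ennreal C * (Liminf (at_right 0) (?F f) + N (\<lambda>y. f y * indicator (space M - Q x0 n) y))"
    using norm_le_Liminf_frac_seminorm[OF assms(2,5,3,4,6,7)] by blast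
  have mid: "Liminf (at_right 0) (?F f) \<le> Limsup (at_right 0) (?F f)" for f
    by (rule Liminf_le_Limsup) simp
  have divC: "ennreal (1 / C) * a \<le> b" if "a \<le> ennreal C * b" for a b
    using that C by (simp add: le_ennreal_mult_iff)
  have part1: "ennreal (1 / C) * N f \<le> Liminf (at_right 0) (?F f) \<and>
      Liminf (at_right 0) (?F f) \<le> Limsup (at_right 0) (?F f) \<and>
      Limsup (at_right 0) (?F f) \<le> ennreal C' * N f"
    if f: "f \<in> holder_bounded_support M rho b \<inter> (\<Union>s\<in>{0<..<1}. frac_sobolev M rho N q s)" for f b
  proof -
    obtain s0 where s0: "0 < s0" "s0 < 1" "frac_seminorm M rho N q s0 f < \<infinity>" and fm: "f \<in> borel_measurable M"
      using f by (auto simp: frac_sobolev_def)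
    obtain x1 R where x1: "x1 \<in> space M" "0 < R" and supp: "{x \<in> space M. f x \<noteq> 0} \<subseteq> Q x1 R"
      using f by (auto simp: holder_bounded_support_def qballs_def)
    obtain j0 :: nat where j0: "K * (rho x0 x1 + R) \<le> real j0" using real_arch_simple by blast
    have "N (\<lambda>y. f y * indicator (space M - Q x0 (real j)) y) = 0" if "j \<ge> j0" for j
    proof -
      have "K * (rho x0 x1 + R) \<le> real j" using j0 that by linarith
      then have "{x \<in> space M. f x \<noteq> 0} \<subseteq> Q x0 (real j)"
        using supp Q_subset[OF x1(1) x0] by blast
      then have "AE y in M. f y * indicator (space M - Q x0 (real j)) y = 0"
        by (intro AE_I2) (auto simp: indicator_def)
      then show ?thesis
        using fm Q_sets[OF x0] by (subst ball_quasi_Banach_eq_0_iff[OF N]) auto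
    qed
    then have "(\<lambda>j. N (\<lambda>y. f y * indicator (space M - Q x0 (real j)) y)) \<longlonglongrightarrow> 0"
      by (intro tendsto_eventually) (auto simp: eventually_sequentially)
    with lower[OF fm] have "N f \<le> ennreal C * Liminf (at_right 0) (?F f)"
      by (rule norm_le_Liminf_of_tails)
    then show ?thesis using divC mid upper[OF fm s0] by blast
  qed
  have part2: "ennreal (1 / C) * mod_const_norm N f \<le> Liminf (at_right 0) (?F f) \<and>
      Liminf (at_right 0) (?F f) \<le> Limsup (at_right 0) (?F f) \<and>
      Limsup (at_right 0) (?F f) \<le> ennreal C' * mod_const_norm N f"
    if ac: "abs_continuous_norm M N"
      and f: "f \<in> fun_space M (mod_const_norm N) \<inter> (\<Union>s\<in>{0<..<1}. frac_sobolev M rho N q s)" for f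
  proof -
    obtain s0 where s0: "0 < s0" "s0 < 1" "frac_seminorm M rho N q s0 f < \<infinity>" and fm[measurable]: "f \<in> borel_measurable M"
      using f by (auto simp: frac_sobolev_def)
    have F_add: "?F (\<lambda>x. f x + complex_of_real a) = ?F f" for a
      by (simp add: frac_seminorm_add_const)
    have "Limsup (at_right 0) (?F f) \<le> ennreal C' * mod_const_norm N f"
      unfolding mod_const_norm_def
    proof (rule le_ennreal_mult_INF[OF C'])
      fix a :: real
      have "Limsup (at_right 0) (?F (\<lambda>x. f x + complex_of_real a)) \<le> ennreal C' * N (\<lambda>x. f x + complex_of_real a)"
        using s0 by (intro upper[of _ s0]) (auto simp: frac_seminorm_add_const)
      then show "Limsup (at_right 0) (?F f) \<le> ennreal C' * N (\<lambda>x. f x + complex_of_real a)"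
        unfolding F_add .
    qed
    moreover have "mod_const_norm N f \<le> ennreal C * Liminf (at_right 0) (?F f)"
    proof -
      have "(INF a::real. N (\<lambda>x. f x + complex_of_real a)) < \<infinity>"
        using f by (auto simp: fun_space_def mod_const_norm_def)
      then obtain a :: real where a: "N (\<lambda>x. f x + complex_of_real a) < \<infinity>"
        by (auto simp: INF_less_iff)
      let ?g = "\<lambda>x. f x + complex_of_real a"
      have g: "?g \<in> fun_space M N" using a by (simp add: fun_space_def)
      let ?E = "\<lambda>j. space M - Q x0 (real j)"
      have tails: "(\<lambda>j. N (\<lambda>y. ?g y * indicator (?E j) y)) \<longlonglongrightarrow> 0"
      proof -
        have "AE x in M. (\<lambda>j. indicator (?E j) x :: real) \<longlonglongrightarrow> 0"
        proof (rule AE_I2)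
          fix x assume x: "x \<in> space M"
          obtain j0 :: nat where "rho x0 x < j0" using reals_Archimedean2 by blast
          then have "indicator (?E j) x = (0::real)" if "j \<ge> j0" for j
            using x that by (auto simp: indicator_def qball_def)
          then show "(\<lambda>j. indicator (?E j) x :: real) \<longlonglongrightarrow> 0"
            by (intro tendsto_eventually) (auto simp: eventually_sequentially)
        qed
        moreover have "?E j \<in> sets M" for j using Q_sets[OF x0] by auto
        moreover have "\<forall>E. (\<forall>j. E j \<in> sets M) \<longrightarrow> (AE x in M. (\<lambda>j. indicator (E j) x :: real) \<longlonglongrightarrow> 0) \<longrightarrow>
            (\<lambda>j. N (\<lambda>x. ?g x * indicator (E j) x)) \<longlonglongrightarrow> 0"
          using ac g unfolding abs_continuous_norm_def by (rule bspec)
        ultimately show ?thesis by (elim allE[of _ ?E]) simp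
      qed
      have gm: "?g \<in> borel_measurable M" by measurable
      have "N ?g \<le> ennreal C * Liminf (at_right 0) (?F ?g)"
        by (rule norm_le_Liminf_of_tails[OF lower[OF gm] tails])
      moreover have "mod_const_norm N f \<le> N ?g"
        unfolding mod_const_norm_def by (rule INF_lower) simp
      ultimately show ?thesis unfolding F_add by (rule order.trans[rotated])
    qed
    ultimately show ?thesis using divC mid by blast
  qed
  show ?thesis
    using C C' part1 part2 by (intro exI[of _ "1 / C"] exI[of _ C'] conjI) auto
qed

end
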